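(* Let $m$ and $n$ be nonnegative integers, and let $0<p<\infty$. (i) In order that every set $E$ in $\mathcal{Z}_n(H^p_m)$ satisfy the Blaschke condition $\sum_{z\in E}(1-|z|)<\infty$, it is necessary and sufficient that $m\ge n$. (ii) In order that every set in $\mathcal{Z}_n(H^p_m)$ be a (BC)-set, it is necessary and sufficient that $m\ge n+p^{-1}$.
   Context: $\mathbb{D}$ is the open unit disk, $\mathbb{T}=\partial\mathbb{D}$, $\mathcal{H}(\mathbb{D})$ is the set of holomorphic functions on $\mathbb{D}$, and $H^p$ is the usual holomorphic Hardy space on $\mathbb{D}$. $H^p_m:=\{f\in\mathcal{H}(\mathbb{D}):f^{(m)}\in H^p\}$ (so $H^p_0=H^p$). A zero of a holomorphic function is called $n$-deep if its multiplicity is at least $n+1$. For linearly independent $f_0,\dots,f_n\in\mathcal{H}(\mathbb{D})$, $\mathcal{Z}(f_0,\dots,f_n)$ is the set of points $z\in\mathbb{D}$ for which there exist complex numbers $\lambda_0,\dots,\lambda_n$ (depending on $z$), not all zero, such that $\sum_{j=0}^n\lambda_jf_j$ has an $n$-deep zero at $z$. For $X\subset\mathcal{H}(\mathbb{D})$, $\mathcal{Z}_n(X)$ is the collection of sets of the form $\mathcal{Z}(f_0,\dots,f_n)$ with $f_0,\dots,f_n$ linearly independent functions in $X$. A subset $E$ (not necessarily closed) of $\mathbb{D}\cup\mathbb{T}$ is a (BC)-set if $\sum_{z\in E\cap\mathbb{D}}(1-|z|)<\infty$ and $\int_{\mathbb{T}}\log\mathrm{dist}(\zeta,E)\,|d\zeta|>-\infty$;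 the empty set is regarded as a (BC)-set. *)

theory Defs
  imports "HOL-Complex_Analysis.Complex_Analysis"
begin

text \<open>
  A holomorphic function on the open unit disk is represented by a total function
  \<^typ>\<open>complex \<Rightarrow> complex\<close> whose values off the disk are irrelevant; every notion below
  depends only on the restriction to \<^term>\<open>ball (0::complex) 1\<close>.
\<close>

definition hardy :: "real \<Rightarrow> (complex \<Rightarrow> complex) set" where
  "hardy p = {f. f holomorphic_on ball 0 1 \<and>
     bdd_above ((\<lambda>r. integral {0..2 * pi} (\<lambda>t. norm (f (of_real r * cis t)) powr p)) ` {0..<1::real})}"

definition hardy_deriv :: "real \<Rightarrow> nat \<Rightarrow> (complex \<Rightarrow> complex) set" where
  "hardy_deriv p m = {f. f holomorphic_on ball 0 1 \<and> (deriv ^^ m) f \<in> hardy p}"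

definition lin_indep_on_disk :: "nat \<Rightarrow> (nat \<Rightarrow> complex \<Rightarrow> complex) \<Rightarrow> bool" where
  "lin_indep_on_disk n f \<longleftrightarrow>
     (\<forall>c :: nat \<Rightarrow> complex. (\<forall>z\<in>ball 0 1. (\<Sum>j\<le>n. c j * f j z) = 0) \<longrightarrow> (\<forall>j\<le>n. c j = 0))"

text \<open>
  The multiplicity of a zero is \<^const>\<open>zorder\<close>, which is unspecified for a function vanishing
  identically near the point; such a zero has infinite multiplicity.
\<close>

definition deep_zero :: "nat \<Rightarrow> (complex \<Rightarrow> complex) \<Rightarrow> complex \<Rightarrow> bool" where
  "deep_zero n g z \<longleftrightarrow>
     g z = 0 \<and> ((\<forall>\<^sub>F w in nhds z. g w = 0) \<or> zorder g z \<ge> int n + 1)"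

definition deep_zero_set :: "nat \<Rightarrow> (nat \<Rightarrow> complex \<Rightarrow> complex) \<Rightarrow> complex set" where
  "deep_zero_set n f = {z \<in> ball 0 1. \<exists>c :: nat \<Rightarrow> complex.
     (\<exists>j\<le>n. c j \<noteq> 0) \<and> deep_zero n (\<lambda>w. \<Sum>j\<le>n. c j * f j w) z}"

definition deep_zero_sets :: "nat \<Rightarrow> (complex \<Rightarrow> complex) set \<Rightarrow> complex set set" where
  "deep_zero_sets n X =
     {deep_zero_set n f | f. (\<forall>j\<le>n. f j \<in> X) \<and> lin_indep_on_disk n f}"

text \<open>The terms are positive, so summability is finiteness of the sum.\<close>

definition blaschke :: "complex set \<Rightarrow> bool" where
  "blaschke E \<longleftrightarrow> (\<lambda>z. 1 - norm z) summable_on E"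

text \<open>
  The logarithm of a distance takes the value $-\infty$ at distance zero, whereas
  \<^term>\<open>ln (0::real)\<close> is \<^term>\<open>0::real\<close>.
\<close>

definition ext_log :: "real \<Rightarrow> ereal" where
  "ext_log x = (if x \<le> 0 then - \<infinity> else ereal (ln x))"

text \<open>
  Integral over the unit circle with respect to arc length, as the difference of the integrals
  of the positive and negative parts (\<^const>\<open>e2ennreal\<close> sends negative arguments to zero).  It is
  meaningful when one of these is finite, as is the case for functions bounded above.
\<close>

definition circle_integral :: "(complex \<Rightarrow> ereal) \<Rightarrow> ereal" where
  "circle_integral h =
     enn2ereal (\<integral>\<^sup>+ t\<in>{0..2 * pi}. e2ennreal (h (cis t)) \<partial>lborel)
     - enn2ereal (\<integral>\<^sup>+ t\<in>{0..2 * pi}. e2ennreal (- h (cis t)) \<partial>lborel)"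

text \<open>
  The empty set is treated separately because \<^term>\<open>infdist (x::complex) {}\<close> is \<^term>\<open>0::real\<close>.
\<close>

definition bc_set :: "complex set \<Rightarrow> bool" where
  "bc_set E \<longleftrightarrow> E \<subseteq> cball 0 1 \<and>
     (E = {} \<or> blaschke (E \<inter> ball 0 1) \<and>
       circle_integral (\<lambda>\<zeta>. ext_log (infdist \<zeta> E)) > - \<infinity>)"

end

theory Submission
  imports Defs "Jordan_Normal_Form.Determinant"
begin

text \<open>
  A combination of \<open>f\<^sub>0, \<dots>, f\<^sub>n\<close> with an \<open>n\<close>-deep
  zero at \<open>z\<close> is a nonzero vector in the kernel of the matrix of the derivatives of
  orders \<open>0, \<dots>, n\<close> at \<open>z\<close>. So the set of the theorem is the zero
  set in the disc of the Wronskian \<open>W\<close>, and \<open>W\<close> does not vanish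
  identically because the functions are linearly independent
  (\<open>deep_zero_set_eq_wronskian_zeros\<close>, \<open>wronskian_nonzero\<close>).

  Sufficiency in (i). A primitive of an \<open>H\<^sup>p\<close> function is in
  \<open>H\<^sup>p\<close> (\<open>hardy_primitive\<close>), so for \<open>m \<ge> n\<close> all
  entries of the Wronskian matrix are in \<open>H\<^sup>p\<close>. The Nevanlinna class contains
  \<open>H\<^sup>p\<close> and is closed under sums and products, hence contains
  \<open>W\<close>, and Jensen's inequality gives the Blaschke condition
  (\<open>blaschke_zeros\<close>).

  Sufficiency in (ii). Each entry \<open>h\<close> of the Wronskian matrix has a derivative of
  some order \<open>k\<close> in \<open>H\<^sup>p\<close> with \<open>k p \<ge> 1\<close>, hence
  in \<open>H\<^sup>q\<close> with \<open>q = 1 / k\<close>. Let \<open>g\<close> be this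
  derivative. Since \<open>\<bar>g\<bar>\<^sup>q \<le> C / (1 - \<bar>z\<bar>)\<close>, the
  product \<open>\<bar>g\<bar> (1 - \<bar>z\<bar>)\<^bsup>k-1\<^esup>\<close> is at most a
  multiple of \<open>\<bar>g\<bar>\<^sup>q\<close>, which the Fejer-Riesz inequality integrates
  along every radius, and Hardy's inequality descends from \<open>g\<close> to the first
  derivative of \<open>h\<close>. Everything can be done with the weight \<open>\<bar>1 - cnj
  \<xi> z\<bar>\<^bsup>-1/2\<^esup>\<close>, where \<open>\<xi>\<close> is a point of the unit
  circle; the weighted means \<open>N(\<xi>)\<close> of \<open>\<bar>g\<bar>\<^sup>q\<close>
  that arise are integrable in \<open>\<xi>\<close>. The outcome is \<open>\<bar>h(z) - h(R
  \<xi>)\<bar> \<le> C \<bar>z - \<xi>\<bar>\<^bsup>1/4\<^esup> (1 + N(\<xi>))\<close> for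
  \<open>\<bar>z\<bar> \<le> R < 1\<close> (\<open>hardy_circle_hoelder\<close>). Functions with
  such an estimate form an algebra, so \<open>W\<close> has it too. At a zero \<open>z\<close>
  of \<open>W\<close> it reads \<open>ln \<bar>W(R \<xi>)\<bar> \<le> C + ln \<bar>z -
  \<xi>\<bar> / 4 + N(\<xi>)\<close>, and the mean of the left side is bounded below by Jensen's
  inequality; letting \<open>R\<close> tend to \<open>1\<close> yields the logarithmic integral
  of the distance (\<open>bc_set_zeros\<close>).

  Necessity. For \<open>f\<^sub>j = z\<^sup>j\<close> with \<open>j < n\<close> and
  \<open>f\<^sub>n = g\<close> the Wronskian is a constant multiple of the \<open>n\<close>-th
  derivative \<open>G\<close> of \<open>g\<close>, so \<open>G\<close> may be prescribed
  (\<open>deep_zero_sets_of_derivative_zeros\<close>). If \<open>m < n\<close>, take the product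
  of the factors \<open>1 - 2 z\<^sup>M\<close> with \<open>M = 4 \<cdot> 9\<^sup>j\<close>. It
  is bounded by \<open>(1 - \<bar>z\<bar>)\<^bsup>-1/2\<^esup>\<close>, so that all its
  primitives are bounded, and the \<open>M\<close> zeros of one factor contribute at least
  \<open>1/2\<close> to the Blaschke sum (\<open>exists_non_blaschke_set\<close>). If \<open>m
  \<ge> n\<close> and \<open>k = m - n\<close> satisfies \<open>k p < 1\<close>, take a product
  of factors \<open>(1 - \<epsilon> - cnj \<zeta> z) / (1 + \<epsilon> - cnj \<zeta> z)\<close>.
  Such a factor vanishes near the boundary point \<open>\<zeta>\<close>, and because of \<open>k
  p < 1\<close> the \<open>k\<close>-th derivative of its difference from the constant
  \<open>1\<close> is small in \<open>H\<^sup>p\<close> when \<open>\<epsilon>\<close> is small. The points \<open>\<zeta>\<close> can therefore be taken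
  dense in the circle, which makes the distance to the zero set vanish on the whole circle
  (\<open>exists_non_bc_set\<close>).
\<close>

section \<open>Integrals over circles\<close>

definition circ_int :: "real \<Rightarrow> (complex \<Rightarrow> 'a::banach) \<Rightarrow> 'a" where
  "circ_int R u = integral {0..2 * pi} (\<lambda>t. u (of_real R * cis t))"

lemma circ_continuous:
  assumes "continuous_on (sphere 0 R) u" "0 \<le> R"
  shows "continuous_on A (\<lambda>t. u (of_real R * cis t))"
  by (rule continuous_on_compose2[OF assms(1)])
     (use assms(2) in \<open>auto intro!: continuous_intros simp: norm_mult\<close>)

lemma circ_integrable:
  fixes u :: "complex \<Rightarrow> 'a::banach"
  assumes "continuous_on (sphere 0 R) u" "0 \<le> R"
  shows "(\<lambda>t. u (of_real R * cis t)) integrable_on {a..b}"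
  by (intro integrable_continuous_real circ_continuous assms)

lemma circ_int_mono:
  fixes u v :: "complex \<Rightarrow> real"
  assumes "continuous_on (sphere 0 R) u" "continuous_on (sphere 0 R) v" "0 \<le> R"
    and "\<And>z. norm z = R \<Longrightarrow> u z \<le> v z"
  shows "circ_int R u \<le> circ_int R v"
  unfolding circ_int_def
  by (intro integral_le circ_integrable assms) (use assms(3) in \<open>auto simp: norm_mult\<close>)

lemma circ_int_cong:
  assumes "\<And>z. norm z = R \<Longrightarrow> u z = v z" "0 \<le> R"
  shows "circ_int R u = circ_int R v"
  unfolding circ_int_def by (rule integral_cong) (use assms in \<open>auto simp: norm_mult\<close>)

lemma circ_int_const: "circ_int R (\<lambda>_. c::real) = 2 * pi * c"
  by (simp add: circ_int_def)

lemma circ_int_add: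
  fixes u v :: "complex \<Rightarrow> real"
  assumes "continuous_on (sphere 0 R) u" "continuous_on (sphere 0 R) v" "0 \<le> R"
  shows "circ_int R (\<lambda>z. u z + v z) = circ_int R u + circ_int R v"
  unfolding circ_int_def by (intro integral_add circ_integrable assms)

lemma circ_int_cmult:
  fixes u :: "complex \<Rightarrow> real"
  shows "circ_int R (\<lambda>z. c * u z) = c * circ_int R u"
  unfolding circ_int_def by (rule integral_mult_right)

lemma circ_int_nonneg:
  fixes u :: "complex \<Rightarrow> real"
  assumes "continuous_on (sphere 0 R) u" "0 \<le> R" "\<And>z. norm z = R \<Longrightarrow> 0 \<le> u z"
  shows "0 \<le> circ_int R u"
  using circ_int_mono[of R "\<lambda>_. 0" u] assms by (simp add: circ_int_const)

lemma cauchy_circle: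
  assumes "f holomorphic_on ball 0 S" "norm z < R" "R < S"
  shows "((\<lambda>t. f (of_real R * cis t) * (of_real R * cis t) / (of_real R * cis t - z))
            has_integral (2 * of_real pi * f z)) {0..2 * pi}"
proof -
  have "f holomorphic_on cball 0 R"
    by (rule holomorphic_on_subset[OF assms(1)]) (use assms in auto)
  then have "((\<lambda>u. f u / (u - z)) has_contour_integral (2 * of_real pi * \<i> * f z)) (circlepath 0 R)"
    by (intro Cauchy_integral_circlepath_simple) (use assms in auto)
  then have "((\<lambda>t. f (0 + of_real R * cis t) / (0 + of_real R * cis t - z) * of_real R * \<i> * cis t)
      has_integral (2 * of_real pi * \<i> * f z)) {0..2 * pi}"
    unfolding circlepath_def by (subst (asm) has_contour_integral_part_circlepath_iff) auto
  from has_integral_mult_right[OF this, of "- \<i>"]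
  show ?thesis by (simp add: algebra_simps)
qed

lemma mean_value_circle:
  assumes "f holomorphic_on ball 0 S" "0 < R" "R < S"
  shows "((\<lambda>t. f (of_real R * cis t)) has_integral (2 * of_real pi * f 0)) {0..2 * pi}"
  using cauchy_circle[of f S 0 R] assms by simp

lemma holomorphic_le_circ_int:
  assumes "f holomorphic_on ball 0 S" "norm z < R" "R < S"
  shows "2 * pi * norm (f z) \<le> circ_int R (\<lambda>w. norm (f w) * (R / norm (w - z)))"
proof -
  have R: "0 \<le> R" using assms(2) norm_ge_zero[of z] by linarith
  have cf: "continuous_on (sphere 0 R) f"
    by (rule continuous_on_subset[OF holomorphic_on_imp_continuous_on[OF assms(1)]])
       (use assms in auto)
  have c: "continuous_on (sphere 0 R) (\<lambda>w. norm (f w) * (R / norm (w - z)))"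
    using cf by (intro continuous_intros) (use assms in auto)
  note hi = cauchy_circle[OF assms]
  have "norm (2 * of_real pi * f z) \<le> circ_int R (\<lambda>w. norm (f w) * (R / norm (w - z)))"
    unfolding circ_int_def integral_unique[OF hi, symmetric]
    by (rule integral_norm_bound_integral[OF has_integral_integrable[OF hi] circ_integrable[OF c R]])
       (use R in \<open>auto simp: norm_mult norm_divide\<close>)
  then show ?thesis by (simp add: norm_mult)
qed

text \<open>
  The number \<open>1 - c z\<close> stays in the right half-plane, so the real part of its power
  \<open>-s\<close> is at least \<open>cos (s \<pi> / 2)\<close> times the modulus, and the mean
  of a holomorphic function over the circle is its value at the centre. The bound does not
  depend on how close \<open>c\<close> is to the unit circle.
\<close>

lemma kernel_integral_bound:
  assumes c: "norm c < 1" and s: "0 \<le> s" "s < 1"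
  shows "integral {0..2 * pi} (\<lambda>t. norm (1 - c * cis t) powr (- s)) \<le> 2 * pi / cos (s * pi / 2)"
proof -
  \<comment> \<open>A disc larger than the unit disc on which \<open>\<bar>c z\<bar> < 1\<close>; the formula also covers \<open>c = 0\<close>.\<close>
  define S where "S = 2 / (1 + norm c)"
  have S: "1 < S" "norm c * S < 1"
    using c unfolding S_def by (auto simp: field_simps add_pos_nonneg)
  have pos: "0 < Re (1 - c * z)" if "norm z < S" for z
  proof -
    have "norm (c * z) \<le> norm c * S"
      using that by (simp add: norm_mult mult_left_mono)
    then have "norm (c * z) < 1" using S by linarith
    then show ?thesis using complex_Re_le_cmod[of "c * z"] by simp
  qed
  define \<phi> where "\<phi> = (\<lambda>z. exp (of_real (- s) * Ln (1 - c * z)))"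
  have hol: "\<phi> holomorphic_on ball 0 S"
    unfolding \<phi>_def by (intro holomorphic_intros) (use pos in \<open>auto simp: complex_nonpos_Reals_iff; force\<close>)
  have cospos: "0 < cos (s * pi / 2)"
  proof (rule cos_gt_zero_pi)
    have "0 \<le> s * pi" "s * pi < 1 * pi" using s by (auto intro: mult_strict_right_mono)
    then show "- (pi / 2) < s * pi / 2" "s * pi / 2 < pi / 2" using pi_gt_zero by linarith+
  qed
  have Re: "norm (1 - c * z) powr (- s) * cos (s * pi / 2) \<le> Re (\<phi> z)" if "norm z < S" for z
  proof -
    let ?w = "1 - c * z"
    have nz: "?w \<noteq> 0" using pos[OF that] by force
    have im: "\<bar>Im (Ln ?w)\<bar> < pi / 2"
      using pos[OF that] nz Re_Ln_pos_lt by blast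
    have "cos (s * pi / 2) \<le> cos (s * \<bar>Im (Ln ?w)\<bar>)"
    proof (rule cos_monotone_0_pi_le)
      show "s * \<bar>Im (Ln ?w)\<bar> \<le> s * pi / 2" using mult_left_mono[of "\<bar>Im (Ln ?w)\<bar>" "pi / 2" s] im s by simp
      show "s * pi / 2 \<le> pi" using s by (simp add: field_simps)
    qed (use s in auto)
    also have "\<dots> = cos (s * Im (Ln ?w))" by (cases "Im (Ln ?w) \<ge> 0") auto
    finally have "cos (s * pi / 2) \<le> cos (s * Im (Ln ?w))" .
    moreover have "Re (\<phi> z) = norm ?w powr (- s) * cos (s * Im (Ln ?w))"
      using nz by (simp add: \<phi>_def Re_exp powr_def Re_Ln)
    ultimately show ?thesis by (simp add: mult_left_mono)
  qed
  have mv: "((\<lambda>t. Re (\<phi> (of_real 1 * cis t))) has_integral Re (2 * of_real pi * \<phi> 0)) {0..2 * pi}"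
    by (rule has_integral_Re[OF mean_value_circle[OF hol]]) (use S in auto)
  have ccont: "continuous_on {0..2*pi} (\<lambda>t. norm (1 - c * cis t) powr (- s))"
  proof (intro continuous_intros ballI)
    fix t :: real
    have "0 < Re (1 - c * cis t)" by (rule pos) (use S in simp)
    then show "norm (1 - c * cis t) \<noteq> 0" by (metis less_irrefl norm_eq_zero zero_complex.simps(1))
  qed
  have "integral {0..2*pi} (\<lambda>t. norm (1 - c * cis t) powr (- s)) * cos (s * pi / 2)
      = integral {0..2*pi} (\<lambda>t. norm (1 - c * cis t) powr (- s) * cos (s * pi / 2))"
    by simp
  also have "\<dots> \<le> integral {0..2*pi} (\<lambda>t. Re (\<phi> (of_real 1 * cis t)))"
    by (rule integral_le[OF integrable_continuous_real has_integral_integrable[OF mv]])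
       (use Re[of "cis _"] S in \<open>auto intro!: continuous_intros ccont\<close>)
  also have "\<dots> = 2 * pi" using integral_unique[OF mv] by (simp add: \<phi>_def)
  finally show ?thesis using cospos by (simp add: field_simps)
qed

lemma integral_periodic_shift:
  fixes u :: "real \<Rightarrow> 'a::banach"
  assumes u: "continuous_on UNIV u" and per: "\<And>t. u (t + T) = u t" and a: "0 \<le> a" "a \<le> T"
  shows "integral {a..a + T} u = integral {0..T} u"
proof -
  have int: "u integrable_on {x..y}" for x y
    by (intro integrable_continuous_real continuous_on_subset[OF u]) auto
  have "integral {T..a+T} u = integral {0..a} (u \<circ> (+) T)"
    using integral_shift_Icc_real[of 0 a u T] by simp
  also have "\<dots> = integral {0..a} u"
    using per by (simp add: o_def add.commute)
  finally have "integral {T..a+T} u = integral {0..a} u" .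
  moreover have "integral {a..T} u + integral {T..a+T} u = integral {a..a+T} u"
    by (rule Henstock_Kurzweil_Integration.integral_combine) (use a int in auto)
  moreover have "integral {0..a} u + integral {a..T} u = integral {0..T} u"
    by (rule Henstock_Kurzweil_Integration.integral_combine) (use a int in auto)
  ultimately show ?thesis by (simp add: algebra_simps)
qed

section \<open>Zeros, holomorphic majorants and Jensen's inequality\<close>

lemma divide_out_zero:
  assumes f: "f holomorphic_on S" "open S" "connected S" and a: "a \<in> S" and nz: "\<exists>z\<in>S. f z \<noteq> 0"
  obtains k g where "g holomorphic_on S" "g a \<noteq> 0" "\<forall>z\<in>S. f z = (z - a) ^ k * g z"
    "f a = 0 \<longrightarrow> 0 < k"
proof (cases "f a = 0")
  case True
  have "\<not> f constant_on S"
    using True a nz by (metis constant_on_def)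
  from holomorphic_factor_zero_nonconstant[OF f a True this]
  obtain g0 r k where k: "0 < k" "0 < r" "ball a r \<subseteq> S" "g0 holomorphic_on ball a r"
    and g0: "\<And>w. w \<in> ball a r \<Longrightarrow> f w = (w - a) ^ k * g0 w" "\<And>w. w \<in> ball a r \<Longrightarrow> g0 w \<noteq> 0"
    by metis
  define g where "g = (\<lambda>z. if z \<in> ball a r then g0 z else f z / (z - a) ^ k)"
  have 1: "g holomorphic_on ball a r"
    using k(4) by (rule holomorphic_transform) (simp add: g_def)
  have "(\<lambda>z. f z / (z - a) ^ k) holomorphic_on S - {a}"
    by (intro holomorphic_intros holomorphic_on_subset[OF f(1)]) auto
  then have 2: "g holomorphic_on S - {a}"
    by (rule holomorphic_transform) (auto simp: g_def g0)
  have "g holomorphic_on ball a r \<union> (S - {a})"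
    by (rule holomorphic_on_Un[OF 1 2]) (use f in auto)
  moreover have "ball a r \<union> (S - {a}) = S" using k by auto
  ultimately have hol: "g holomorphic_on S" by simp
  show ?thesis
  proof (rule that[OF hol])
    show "g a \<noteq> 0" using k g0 by (simp add: g_def)
    show "\<forall>z\<in>S. f z = (z - a) ^ k * g z"
      using g0(1) k(2) by (auto simp: g_def)
  qed (use k in auto)
next
  case False
  show ?thesis by (rule that[OF f(1) False, of 0]) (use False in auto)
qed

text \<open>
  The zeros are divided out one after the other, each with its full multiplicity.
\<close>

lemma factor_zeros:
  assumes S: "open S" "connected S" and K: "K \<subseteq> S"
    and f: "f holomorphic_on S" "\<exists>z\<in>S. f z \<noteq> 0" and fin: "finite {z\<in>K. f z = 0}"
  shows "\<exists>\<mu> \<phi>. \<phi> holomorphic_on S \<and> (\<forall>z\<in>K. \<phi> z \<noteq> 0) \<and> (\<forall>a\<in>{z\<in>K. f z = 0}. 0 < (\<mu> a :: nat)) \<and>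
           (\<forall>z\<in>S. f z = \<phi> z * (\<Prod>a\<in>{z\<in>K. f z = 0}. (z - a) ^ \<mu> a))"
  using fin f
proof (induction "{z\<in>K. f z = 0}" arbitrary: f rule: finite_induct)
  case empty
  have *: "\<forall>z\<in>K. f z \<noteq> 0" using empty.hyps by auto
  show ?case
    by (rule exI[of _ "\<lambda>_. 1"], rule exI[of _ f])
       (use empty.prems(1) * in \<open>simp flip: empty.hyps(1)\<close>)
next
  case (insert a Z)
  have "a \<in> {z\<in>K. f z = 0}" using insert.hyps(4) by blast
  then have a: "a \<in> K" "f a = 0" by simp_all
  then have aS: "a \<in> S" using K by blast
  obtain k g where g0: "g holomorphic_on S" "g a \<noteq> 0" "\<forall>z\<in>S. f z = (z - a) ^ k * g z" "f a = 0 \<longrightarrow> 0 < k"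
    by (rule divide_out_zero[OF insert.prems(1) S aS insert.prems(2)])
  then have g: "g holomorphic_on S" "g a \<noteq> 0" "\<And>z. z \<in> S \<Longrightarrow> f z = (z - a) ^ k * g z" "0 < k"
    using a(2) by blast+
  have Z: "{z \<in> K. g z = 0} = Z"
  proof -
    have "{z \<in> K. g z = 0} = {z \<in> K. f z = 0} - {a}"
    proof (rule Set.set_eqI)
      fix z
      show "z \<in> {z \<in> K. g z = 0} \<longleftrightarrow> z \<in> {z \<in> K. f z = 0} - {a}"
      proof (cases "z \<in> K")
        case True
        then have "f z = (z - a) ^ k * g z" using g(3) K by blast
        then show ?thesis using g(2) True by (cases "z = a") simp_all
      qed simp
    qed
    also have "\<dots> = insert a Z - {a}" by (simp only: insert.hyps(4))
    finally show ?thesis using insert.hyps(2) by simp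
  qed
  have "\<exists>z\<in>S. g z \<noteq> 0" using g(2) aS by blast
  from insert.hyps(3)[OF Z[symmetric] g(1) this]
  obtain \<mu> \<phi> where \<mu>: "\<phi> holomorphic_on S" "\<forall>z\<in>K. \<phi> z \<noteq> 0" "\<forall>a\<in>Z. 0 < (\<mu> a :: nat)"
    "\<forall>z\<in>S. g z = \<phi> z * (\<Prod>a\<in>Z. (z - a) ^ \<mu> a)"
    unfolding Z by blast
  have "f z = \<phi> z * (\<Prod>b\<in>insert a Z. (z - b) ^ (\<mu>(a := k)) b)" if "z \<in> S" for z
  proof -
    have "(\<Prod>b\<in>Z. (z - b) ^ (\<mu>(a := k)) b) = (\<Prod>b\<in>Z. (z - b) ^ \<mu> b)"
      by (rule prod.cong) (use insert.hyps(2) in auto)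
    then have "(\<Prod>b\<in>insert a Z. (z - b) ^ (\<mu>(a := k)) b) = (z - a) ^ k * (\<Prod>a\<in>Z. (z - a) ^ \<mu> a)"
      using insert.hyps(1,2) by simp
    moreover have "g z = \<phi> z * (\<Prod>a\<in>Z. (z - a) ^ \<mu> a)" using \<mu>(4) that by blast
    ultimately show ?thesis using g(3)[OF that] by (simp only: mult_ac)
  qed
  moreover have "\<forall>b\<in>insert a Z. 0 < (\<mu>(a := k)) b" using \<mu>(3) g(4) by simp
  ultimately show ?case unfolding insert.hyps(4)[symmetric] using \<mu>(1,2) by blast
qed

text \<open>
  For \<open>\<bar>a\<bar> < R\<close> this compares \<open>z - a\<close> with the factor
  \<open>(R\<^sup>2 - cnj a z) / R\<close> that vanishes at the reflection of \<open>a\<close>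
  in the circle of radius \<open>R\<close>: the moduli agree on the circle, and the reflected
  factor is larger inside.
\<close>

lemma reflect_factor_norm:
  fixes a z :: complex
  shows "norm (of_real (R\<^sup>2) - cnj a * z) ^ 2 = R\<^sup>2 * norm (z - a) ^ 2 + (R\<^sup>2 - norm z ^ 2) * (R\<^sup>2 - norm a ^ 2)"
  unfolding cmod_power2 by (simp add: power2_eq_square algebra_simps)

lemma zero_free_larger_ball:
  assumes f: "f holomorphic_on ball 0 1" and R: "0 < R" "R < 1" and nz: "\<And>z. norm z \<le> R \<Longrightarrow> f z \<noteq> 0"
  obtains S where "R < S" "S \<le> 1" "\<forall>z. norm z < S \<longrightarrow> f z \<noteq> 0"
proof -
  define T where "T = (1 + R) / 2"
  have T: "R < T" "T < 1" using R by (auto simp: T_def)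
  define K where "K = {z \<in> cball 0 T. f z \<in> {0}}"
  have "continuous_on (cball 0 T) f"
    by (rule continuous_on_subset[OF holomorphic_on_imp_continuous_on[OF f]]) (use T in auto)
  then have "closed K" unfolding K_def
    by (intro continuous_closed_preimage[unfolded vimage_def Int_def mem_Collect_eq]) auto
  moreover have "bounded K" unfolding K_def by (rule bounded_subset[OF bounded_cball[of 0 T]]) auto
  ultimately have comp: "compact K" by (simp add: compact_eq_bounded_closed)
  show ?thesis
  proof (cases "K = {}")
    case True
    then show ?thesis by (intro that[of T]) (use T in \<open>auto simp: K_def\<close>)
  next
    case False
    obtain x where x: "x \<in> K" "\<And>y. y \<in> K \<Longrightarrow> norm x \<le> norm y"
      using continuous_attains_inf[OF comp False continuous_on_norm[OF continuous_on_id]] by auto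
    have "R < norm x" using nz[of x] x(1) unfolding K_def by force
    moreover have "norm x \<le> T" using x(1) unfolding K_def by auto
    moreover have "f z \<noteq> 0" if "norm z < norm x" for z
      using x(2)[of z] that \<open>norm x \<le> T\<close> unfolding K_def by force
    ultimately show ?thesis using T by (intro that[of "norm x"]) auto
  qed
qed

lemma finite_zeros_cball:
  assumes f: "f holomorphic_on ball 0 1" "\<exists>z\<in>ball 0 1. f z \<noteq> 0" and R: "R < 1"
  shows "finite {z \<in> cball 0 R. f z = 0}"
proof (cases "f constant_on ball 0 1")
  case True
  then obtain c where c: "\<And>z. z \<in> ball 0 1 \<Longrightarrow> f z = c" by (auto simp: constant_on_def)
  then have "c \<noteq> 0" using f(2) by auto
  then have "{z \<in> cball 0 R. f z = 0} = {}" using c R by auto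
  then show ?thesis by (simp only: finite.emptyI)
next
  case False
  show ?thesis
    by (rule holomorphic_compact_finite_zeros[OF f(1) open_ball connected_ball compact_cball _ False])
       (use R in auto)
qed

text \<open>
  Replace every factor \<open>z - a\<close> of \<open>f\<close> by its reflection
  \<open>(R\<^sup>2 - cnj a z) / R\<close>. The new function has no zeros in the closed disc of
  radius \<open>R\<close>, has the same modulus as \<open>f\<close> on its boundary and a larger
  one inside; \<open>L\<close> is its logarithm. At the origin each factor has gained \<open>R /
  \<bar>a\<bar>\<close>, once for every unit of multiplicity.
\<close>

lemma log_majorant:
  assumes f: "f holomorphic_on ball 0 1" and R: "0 < R" "R < 1" and nz: "\<And>z. norm z = R \<Longrightarrow> f z \<noteq> 0"
  obtains S L where "R < S" "S \<le> 1" "L holomorphic_on ball 0 S"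
    "\<forall>z. norm z = R \<longrightarrow> exp (Re (L z)) = norm (f z)"
    "\<forall>z. norm z \<le> R \<longrightarrow> norm (f z) \<le> exp (Re (L z))"
    "f 0 \<noteq> 0 \<longrightarrow> ln (norm (f 0)) + (\<Sum>a\<in>{z \<in> cball 0 R. f z = 0}. ln (R / norm a)) \<le> Re (L 0)"
proof -
  define Z where "Z = {z \<in> cball 0 R. f z = 0}"
  have ex: "\<exists>z\<in>ball 0 1. f z \<noteq> 0" by (rule bexI[of _ "of_real R"]) (use nz R in auto)
  have fin: "finite Z" unfolding Z_def by (rule finite_zeros_cball[OF f ex R(2)])
  have "cball (0::complex) R \<subseteq> ball 0 1" using R by auto
  from factor_zeros[OF open_ball connected_ball this f ex fin[unfolded Z_def], folded Z_def]
  obtain \<mu> \<phi> where mp: "\<phi> holomorphic_on ball 0 1" "\<forall>z\<in>cball 0 R. \<phi> z \<noteq> 0"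
    "\<forall>a\<in>Z. 0 < (\<mu> a :: nat)" "\<forall>z\<in>ball 0 1. f z = \<phi> z * (\<Prod>a\<in>Z. (z - a) ^ \<mu> a)"
    by blast
  have \<phi>: "\<phi> holomorphic_on ball 0 1" "\<And>z. norm z \<le> R \<Longrightarrow> \<phi> z \<noteq> 0"
    "\<And>a. a \<in> Z \<Longrightarrow> 0 < \<mu> a"
    "\<And>z. norm z < 1 \<Longrightarrow> f z = \<phi> z * (\<Prod>a\<in>Z. (z - a) ^ \<mu> a)"
    using mp by simp_all
  have Zlt: "norm a < R" if "a \<in> Z" for a
    using that nz[of a] unfolding Z_def by force
  define b where "b = (\<lambda>a z. (of_real (R\<^sup>2) - cnj a * z) / of_real R)"
  have bnorm: "R\<^sup>2 * norm (b a z) ^ 2 = norm (of_real (R\<^sup>2) - cnj a * z) ^ 2" for a z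
    using R by (simp add: b_def norm_divide power_divide)
  have b_eq: "norm (b a z) = norm (z - a)" if "norm z = R" for a z
  proof -
    have "R\<^sup>2 * norm (b a z) ^ 2 = R\<^sup>2 * norm (z - a) ^ 2"
      unfolding bnorm reflect_factor_norm using that by simp
    then show ?thesis using R by simp
  qed
  have b_ge: "norm (z - a) \<le> norm (b a z)" if "norm z \<le> R" "norm a < R" for a z
  proof -
    have "norm z ^ 2 \<le> R ^ 2" "norm a ^ 2 \<le> R ^ 2" using that by (auto intro!: power_mono)
    then have "R\<^sup>2 * norm (z - a) ^ 2 \<le> R\<^sup>2 * norm (b a z) ^ 2"
      unfolding bnorm reflect_factor_norm by simp
    then have "norm (z - a) ^ 2 \<le> norm (b a z) ^ 2" using R by simp
    then show ?thesis by (rule power2_le_imp_le) simp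
  qed
  have b_nz: "b a z \<noteq> 0" if "norm z \<le> R" "norm a < R" for a z
  proof
    assume "b a z = 0"
    then have "cnj a * z = of_real (R\<^sup>2)" using R by (simp add: b_def)
    then have "norm a * norm z = R\<^sup>2" using R using norm_mult[of "cnj a" z] by (metis abs_power2 complex_mod_cnj norm_of_real)
    moreover have "norm a * norm z \<le> norm a * R" using that by (intro mult_left_mono) auto
    moreover have "norm a * R < R * R" using that R by simp
    ultimately show False by (simp add: power2_eq_square)
  qed
  define \<Phi> where "\<Phi> = (\<lambda>z. \<phi> z * (\<Prod>a\<in>Z. b a z ^ \<mu> a))"
  have hol: "\<Phi> holomorphic_on ball 0 1"
    unfolding \<Phi>_def b_def by (intro holomorphic_intros \<phi>) (use R in auto)
  have nz\<Phi>: "\<Phi> z \<noteq> 0" if "norm z \<le> R" for z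
    using \<phi>(2)[OF that] b_nz[OF that Zlt] fin by (auto simp: \<Phi>_def)
  obtain S where S: "R < S" "S \<le> 1" "\<forall>z. norm z < S \<longrightarrow> \<Phi> z \<noteq> 0"
    by (rule zero_free_larger_ball[OF hol R nz\<Phi>])
  have hol': "\<Phi> holomorphic_on ball 0 S" 
    by (rule holomorphic_on_subset[OF hol]) (use S(2) in \<open>simp add: subset_ball\<close>)
  have nz': "\<Phi> z \<noteq> 0" if "z \<in> ball 0 S" for z using S(3) that by simp
  have S0: "0 \<in> ball (0::complex) S" using S(1) R(1) by simp
  have "\<exists>L. L holomorphic_on ball 0 S \<and> (\<forall>z\<in>ball 0 S. exp (L z) = \<Phi> z)"
    by (rule holomorphic_logarithm_exists[OF convex_ball open_ball hol' nz' S0]) auto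
  then obtain L where L: "L holomorphic_on ball 0 S" "\<forall>z\<in>ball 0 S. exp (L z) = \<Phi> z" by blast
  have expL: "exp (Re (L z)) = norm (\<Phi> z)" if "norm z \<le> R" for z
  proof -
    have "\<Phi> z = exp (L z)" using L(2) that S(1) by simp
    then show ?thesis by simp
  qed
  show ?thesis
  proof (rule that[OF S(1,2) L(1)])
    have "exp (Re (L z)) = norm (f z)" if z: "norm z = R" for z
    proof -
    have "norm (f z) = norm (\<Phi> z)"
      using R z \<phi>(4)[of z] by (simp add: \<Phi>_def norm_mult prod_norm[symmetric] norm_power b_eq)
    then show ?thesis using expL[of z] z by simp
    qed
    then show "\<forall>z. norm z = R \<longrightarrow> exp (Re (L z)) = norm (f z)" by blast
  next
    have "norm (f z) \<le> exp (Re (L z))" if z: "norm z \<le> R" for z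
    proof -
    have "(\<Prod>a\<in>Z. norm (z - a) ^ \<mu> a) \<le> (\<Prod>a\<in>Z. norm (b a z) ^ \<mu> a)"
      by (intro prod_mono conjI power_mono b_ge z Zlt) auto
    then have "norm (f z) \<le> norm (\<Phi> z)"
      using R z \<phi>(4)[of z] by (simp add: \<Phi>_def norm_mult prod_norm[symmetric] norm_power mult_left_mono)
    then show ?thesis using expL[OF z] by simp
    qed
    then show "\<forall>z. norm z \<le> R \<longrightarrow> norm (f z) \<le> exp (Re (L z))" by blast
  next
    have "ln (norm (f 0)) + (\<Sum>a\<in>{z \<in> cball 0 R. f z = 0}. ln (R / norm a)) \<le> Re (L 0)" if f0: "f 0 \<noteq> 0"
    proof -
    have nza: "a \<noteq> 0" if "a \<in> Z" for a using that f0 by (auto simp: Z_def)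
    have "norm (\<Phi> 0) = norm (f 0) * (\<Prod>a\<in>Z. (R / norm a) ^ \<mu> a)"
    proof -
      have "norm (b a 0) = norm a * (R / norm a)" if "a \<in> Z" for a
        using R nza[OF that] by (simp add: b_def norm_divide power2_eq_square norm_mult)
      then have "(\<Prod>a\<in>Z. norm (b a 0) ^ \<mu> a) = (\<Prod>a\<in>Z. norm a ^ \<mu> a * (R / norm a) ^ \<mu> a)"
        by (intro prod.cong refl) (simp only: power_mult_distrib)
      then show ?thesis using \<phi>(4)[of 0]
        by (simp add: \<Phi>_def norm_mult prod_norm[symmetric] norm_power prod.distrib)
    qed
    also have "ln \<dots> = ln (norm (f 0)) + ln (\<Prod>a\<in>Z. (R / norm a) ^ \<mu> a)"
      using f0 nza R by (intro ln_mult_pos) (auto intro!: prod_pos)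
    also have "ln (\<Prod>a\<in>Z. (R / norm a) ^ \<mu> a) = (\<Sum>a\<in>Z. real (\<mu> a) * ln (R / norm a))"
      using nza R fin by (subst ln_prod) (auto simp: ln_realpow)
    finally have "ln (norm (\<Phi> 0)) = ln (norm (f 0)) + (\<Sum>a\<in>Z. real (\<mu> a) * ln (R / norm a))" .
    moreover have "(\<Sum>a\<in>Z. ln (R / norm a)) \<le> (\<Sum>a\<in>Z. real (\<mu> a) * ln (R / norm a))"
    proof (rule sum_mono)
      fix a assume a: "a \<in> Z"
      have "0 \<le> ln (R / norm a)" using Zlt[OF a] nza[OF a] by simp
      then show "ln (R / norm a) \<le> real (\<mu> a) * ln (R / norm a)"
        using \<phi>(3)[OF a] mult_right_mono[of 1 "real (\<mu> a)"] by simp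
    qed
    moreover have "Re (L 0) = ln (norm (\<Phi> 0))" using expL[of 0, symmetric] R by simp
    ultimately show ?thesis
      unfolding Z_def by linarith
    qed
    then show "f 0 \<noteq> 0 \<longrightarrow> ln (norm (f 0)) + (\<Sum>a\<in>{z \<in> cball 0 R. f z = 0}. ln (R / norm a)) \<le> Re (L 0)"
      by blast
  qed
qed

text \<open>
  The mean value property of the logarithm \<open>L\<close> from \<open>log_majorant\<close>.
  Every zero is counted once, which is why this is an inequality.
\<close>

lemma jensen_inequality:
  assumes f: "f holomorphic_on ball 0 1" and R: "0 < R" "R < 1" and nz: "\<And>z. norm z = R \<Longrightarrow> f z \<noteq> 0"
    and f0: "f 0 \<noteq> 0"
  shows "2 * pi * (ln (norm (f 0)) + (\<Sum>a\<in>{z \<in> cball 0 R. f z = 0}. ln (R / norm a)))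
           \<le> circ_int R (\<lambda>z. ln (norm (f z)))"
proof -
  obtain S L where L: "R < S" "S \<le> 1" "L holomorphic_on ball 0 S"
    "\<forall>z. norm z = R \<longrightarrow> exp (Re (L z)) = norm (f z)"
    "\<forall>z. norm z \<le> R \<longrightarrow> norm (f z) \<le> exp (Re (L z))"
    "f 0 \<noteq> 0 \<longrightarrow> ln (norm (f 0)) + (\<Sum>a\<in>{z \<in> cball 0 R. f z = 0}. ln (R / norm a)) \<le> Re (L 0)"
    by (rule log_majorant[OF f R nz])
  have "((\<lambda>t. Re (L (of_real R * cis t))) has_integral Re (2 * of_real pi * L 0)) {0..2 * pi}"
    by (rule has_integral_Re[OF mean_value_circle[OF L(3) R(1) L(1)]])
  then have "circ_int R (\<lambda>z. Re (L z)) = 2 * pi * Re (L 0)"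
    by (simp add: circ_int_def integral_unique)
  moreover have "circ_int R (\<lambda>z. Re (L z)) = circ_int R (\<lambda>z. ln (norm (f z)))"
  proof (rule circ_int_cong)
    fix z :: complex assume "norm z = R"
    then have "exp (Re (L z)) = norm (f z)" using L(4) by blast
    then show "Re (L z) = ln (norm (f z))" by (metis ln_exp)
  qed (use R in simp)
  moreover have "2 * pi * (ln (norm (f 0)) + (\<Sum>a\<in>{z \<in> cball 0 R. f z = 0}. ln (R / norm a))) \<le> 2 * pi * Re (L 0)"
    using L(6) f0 by (intro mult_left_mono) auto
  ultimately show ?thesis by simp
qed

text \<open>
  The function \<open>\<psi> = exp (p L)\<close> makes holomorphic function theory available for
  the power \<open>\<bar>f\<bar>\<^sup>p\<close> with an arbitrary exponent \<open>p >
  0\<close>.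
\<close>

lemma power_majorant_zero_free_circle:
  assumes f: "f holomorphic_on ball 0 1" and R: "0 < R" "R < 1" and nz: "\<And>z. norm z = R \<Longrightarrow> f z \<noteq> 0"
    and p: "0 < p"
  obtains S \<psi> where "R < S" "S \<le> 1" "\<psi> holomorphic_on ball 0 S"
    "\<forall>z. norm z = R \<longrightarrow> norm (\<psi> z) = norm (f z) powr p"
    "\<forall>z. norm z \<le> R \<longrightarrow> norm (f z) powr p \<le> norm (\<psi> z)"
proof -
  obtain S L where L: "R < S" "S \<le> 1" "L holomorphic_on ball 0 S"
    "\<forall>z. norm z = R \<longrightarrow> exp (Re (L z)) = norm (f z)"
    "\<forall>z. norm z \<le> R \<longrightarrow> norm (f z) \<le> exp (Re (L z))"
    "f 0 \<noteq> 0 \<longrightarrow> ln (norm (f 0)) + (\<Sum>a\<in>{z \<in> cball 0 R. f z = 0}. ln (R / norm a)) \<le> Re (L 0)"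
    by (rule log_majorant[OF f R nz])
  define \<psi> where "\<psi> = (\<lambda>z. exp (of_real p * L z))"
  have n: "norm (\<psi> z) = exp (Re (L z)) powr p" for z
    by (simp add: \<psi>_def powr_def)
  show ?thesis
  proof (rule that[OF L(1,2)])
    show "\<psi> holomorphic_on ball 0 S" unfolding \<psi>_def by (intro holomorphic_intros L)
    show "\<forall>z. norm z = R \<longrightarrow> norm (\<psi> z) = norm (f z) powr p" using L(4) by (simp add: n)
    show "\<forall>z. norm z \<le> R \<longrightarrow> norm (f z) powr p \<le> norm (\<psi> z)"
      unfolding n using L(5) p by (auto intro!: powr_mono2)
  qed
qed

section \<open>Hardy spaces and primitives\<close>

text \<open>
  The order of integration is exchanged and \<open>kernel_integral_bound\<close> is applied to
  the inner integral. With \<open>c w = r / w\<close> the kernel is the distance from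
  \<open>w\<close> to a point of the circle of radius \<open>r\<close>, with \<open>c w = cnj
  w\<close> it is the distance from \<open>w\<close> to a point of the unit circle, up to
  constant factors.
\<close>

lemma integral_of_kernel_means:
  fixes U :: "complex \<Rightarrow> real" and c :: "complex \<Rightarrow> complex"
  assumes U: "continuous_on (sphere 0 R) U" "\<And>w. norm w = R \<Longrightarrow> 0 \<le> U w"
    and c: "continuous_on (sphere 0 R) c" "\<And>w. norm w = R \<Longrightarrow> norm (c w) < 1"
    and R: "0 \<le> R" and s: "0 \<le> s" "s < 1"
  defines "N \<equiv> \<lambda>\<alpha>. circ_int R (\<lambda>w. U w * norm (1 - c w * cis \<alpha>) powr (- s))"
  shows "continuous_on A N" "integral {0..2 * pi} N \<le> 2 * pi / cos (s * pi / 2) * circ_int R U"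
    "\<And>\<alpha>. 0 \<le> N \<alpha>"
proof -
  have nz: "norm (1 - c w * cis \<alpha>) \<noteq> 0" if "norm w = R" for w \<alpha>
  proof
    assume "norm (1 - c w * cis \<alpha>) = 0"
    then have "norm (c w * cis \<alpha>) = 1" by simp
    then show False using c(2)[OF that] by (simp add: norm_mult)
  qed
  define k where "k = (\<lambda>\<alpha> t. U (of_real R * cis t) * norm (1 - c (of_real R * cis t) * cis \<alpha>) powr (- s))"
  have Neq: "N = (\<lambda>\<alpha>. integral (cbox 0 (2 * pi)) (k \<alpha>))"
    by (simp add: N_def circ_int_def k_def)
  have sph: "norm (of_real R * cis t) = R" for t :: real using R by (simp add: norm_mult)
  have cont: "continuous_on B (\<lambda>(\<alpha>, t). k \<alpha> t)" for B
    unfolding k_def case_prod_beta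
    by (intro continuous_intros continuous_on_compose2[OF U(1)] continuous_on_compose2[OF c(1)])
       (use nz sph in auto)
  show "continuous_on A N"
    unfolding Neq by (rule integral_continuous_on_param) (rule cont)
  have kint: "k \<alpha> integrable_on {0..2*pi}" for \<alpha>
    by (rule integrable_continuous_real)
       (rule continuous_on_compose2[OF cont[of UNIV], of _ "\<lambda>t. (\<alpha>, t)", simplified], intro continuous_intros)
  show N0: "0 \<le> N \<alpha>" for \<alpha>
    unfolding Neq by (rule integral_nonneg) (use kint U(2) sph in \<open>auto simp: k_def\<close>)
  have "integral {0..2*pi} N = integral (cbox 0 (2*pi)) (\<lambda>\<alpha>. integral (cbox 0 (2*pi)) (k \<alpha>))"
    by (simp add: Neq)
  also have "\<dots> = integral (cbox 0 (2*pi)) (\<lambda>t. integral (cbox 0 (2*pi)) (\<lambda>\<alpha>. k \<alpha> t))"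
    by (rule integral_swap_continuous) (rule cont)
  also have "\<dots> \<le> integral {0..2*pi} (\<lambda>t. 2 * pi / cos (s * pi / 2) * U (of_real R * cis t))"
    unfolding interval_cbox[symmetric]
  proof (rule integral_le)
    have "continuous_on {0..2*pi} (\<lambda>t. integral (cbox 0 (2*pi)) (\<lambda>\<alpha>. k \<alpha> t))"
    proof (rule integral_continuous_on_param)
      have "continuous_on ({0..2*pi} \<times> cbox 0 (2*pi)) (\<lambda>x. (\<lambda>(\<alpha>, t). k \<alpha> t) (snd x, fst x))"
        by (rule continuous_on_compose2[OF cont[of UNIV]]) (auto intro!: continuous_intros)
      then show "continuous_on ({0..2*pi} \<times> cbox 0 (2*pi)) (\<lambda>(t, \<alpha>). k \<alpha> t)"
        by (simp add: case_prod_beta)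
    qed
    then show "(\<lambda>t. integral {0..2*pi} (\<lambda>\<alpha>. k \<alpha> t)) integrable_on {0..2*pi}"
      by (simp add: integrable_continuous_real)
    show "(\<lambda>t. 2 * pi / cos (s * pi / 2) * U (of_real R * cis t)) integrable_on {0..2*pi}"
      by (intro integrable_continuous_real continuous_intros circ_continuous U R)
    fix t :: real
    have "integral {0..2*pi} (\<lambda>\<alpha>. k \<alpha> t)
       = U (of_real R * cis t) * integral {0..2*pi} (\<lambda>\<alpha>. norm (1 - c (of_real R * cis t) * cis \<alpha>) powr (- s))"
      unfolding k_def by simp
    also have "\<dots> \<le> U (of_real R * cis t) * (2 * pi / cos (s * pi / 2))"
      by (intro mult_left_mono kernel_integral_bound c U s sph)
    finally show "integral {0..2*pi} (\<lambda>\<alpha>. k \<alpha> t) \<le> 2 * pi / cos (s * pi / 2) * U (of_real R * cis t)"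
      by (simp add: mult.commute)
  qed
  also have "\<dots> = 2 * pi / cos (s * pi / 2) * circ_int R U" by (simp add: circ_int_def)
  finally show "integral {0..2 * pi} N \<le> 2 * pi / cos (s * pi / 2) * circ_int R U" .
qed

text \<open>
  Circles with these radii are avoided because the logarithm of \<open>\<bar>f\<bar>\<close> is
  singular on them. The zero function is exempted: its powers are majorized by zero on every
  circle.
\<close>

definition zero_radii :: "(complex \<Rightarrow> complex) \<Rightarrow> real set" where
  "zero_radii f = (if \<forall>z\<in>ball 0 1. f z = 0 then {} else norm ` {z \<in> ball 0 1. f z = 0})"

lemma countable_zero_radii:
  assumes "f holomorphic_on ball 0 1"
  shows "countable (zero_radii f)"
proof (cases "\<forall>z\<in>ball 0 1. f z = 0")
  case False
  then have ex: "\<exists>z\<in>ball 0 1. f z \<noteq> 0" by blast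
  have "{z \<in> ball 0 1. f z = 0} \<subseteq> (\<Union>n. {z \<in> cball 0 (1 - 1 / real (Suc n)). f z = 0})"
  proof
    fix z assume z: "z \<in> {z \<in> ball 0 1. f z = 0}"
    then have "0 < 1 - norm z" by simp
    then obtain n where "1 / real (Suc n) < 1 - norm z" by (rule nat_approx_posE)
    then show "z \<in> (\<Union>n. {z \<in> cball 0 (1 - 1 / real (Suc n)). f z = 0})"
      using z by (intro UN_I[of n UNIV]) (simp_all del: of_nat_Suc)
  qed
  moreover have "countable (\<Union>n. {z \<in> cball 0 (1 - 1 / real (Suc n)). f z = 0})"
    by (rule countable_UN[OF _ countable_finite[OF finite_zeros_cball[OF assms ex]]]) simp_all
  ultimately have "countable {z \<in> ball 0 1. f z = 0}" by (rule countable_subset)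
  then show ?thesis by (simp add: zero_radii_def)
qed (simp add: zero_radii_def)

lemma zero_radiiD:
  assumes "R \<notin> zero_radii f" "R < 1" "\<exists>z\<in>ball 0 1. f z \<noteq> 0" "norm z = R"
  shows "f z \<noteq> 0"
proof
  assume "f z = 0"
  then have "R \<in> norm ` {z \<in> ball 0 1. f z = 0}" using assms(2,4) by (intro image_eqI[of _ _ z]) auto
  moreover have "zero_radii f = norm ` {z \<in> ball 0 1. f z = 0}"
    unfolding zero_radii_def using assms(3) by (intro if_not_P) blast
  ultimately show False using assms(1) by simp
qed

lemma obtain_radius:
  assumes "countable X" "r < 1"
  obtains R :: real where "r < R" "R < 1" "R \<notin> X"
  using real_interval_avoid_countable_set[OF assms(2,1)] by auto

lemma power_majorant:
  assumes f: "f holomorphic_on ball 0 1" and R: "0 < R" "R < 1" "R \<notin> zero_radii f" and p: "0 < p"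
  obtains S \<psi> where "R < S" "S \<le> 1" "\<psi> holomorphic_on ball 0 S"
    "\<forall>z. norm z = R \<longrightarrow> norm (\<psi> z) = norm (f z) powr p"
    "\<forall>z. norm z \<le> R \<longrightarrow> norm (f z) powr p \<le> norm (\<psi> z)"
proof (cases "\<forall>z\<in>ball 0 1. f z = 0")
  case True
  show ?thesis by (rule that[of 1 "\<lambda>_. 0"]) (use R True in auto)
next
  case False
  then have "f z \<noteq> 0" if "norm z = R" for z using zero_radiiD[OF R(3,2) _ that] by blast
  from power_majorant_zero_free_circle[OF f R(1,2) this p] show ?thesis using that by blast
qed

lemma hardy_circ_int:
  "f \<in> hardy p \<longleftrightarrow> f holomorphic_on ball 0 1 \<and>
     (\<exists>A\<ge>0. \<forall>r. 0 \<le> r \<and> r < 1 \<longrightarrow> circ_int r (\<lambda>z. norm (f z) powr p) \<le> A)"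
proof -
  have "bdd_above ((\<lambda>r. integral {0..2 * pi} (\<lambda>t. norm (f (of_real r * cis t)) powr p)) ` {0..<1::real})
    \<longleftrightarrow> (\<exists>A. \<forall>r. 0 \<le> r \<and> r < 1 \<longrightarrow> circ_int r (\<lambda>z. norm (f z) powr p) \<le> A)"
    unfolding bdd_above_def circ_int_def by (simp only: ball_simps(9)) (simp add: Ball_def)
  also have "\<dots> \<longleftrightarrow> (\<exists>A\<ge>0. \<forall>r. 0 \<le> r \<and> r < 1 \<longrightarrow> circ_int r (\<lambda>z. norm (f z) powr p) \<le> A)"
  proof
    assume "\<exists>A. \<forall>r. 0 \<le> r \<and> r < 1 \<longrightarrow> circ_int r (\<lambda>z. norm (f z) powr p) \<le> A"
    then obtain A where "\<forall>r. 0 \<le> r \<and> r < 1 \<longrightarrow> circ_int r (\<lambda>z. norm (f z) powr p) \<le> A" by blast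
    then show "\<exists>A\<ge>0. \<forall>r. 0 \<le> r \<and> r < 1 \<longrightarrow> circ_int r (\<lambda>z. norm (f z) powr p) \<le> A"
      by (intro exI[of _ "max A 0"]) force
  qed blast
  finally show ?thesis by (simp add: hardy_def)
qed

lemma continuous_on_circle:
  assumes "f holomorphic_on ball 0 1" "R < 1"
  shows "continuous_on (sphere 0 R) f"
  by (rule continuous_on_subset[OF holomorphic_on_imp_continuous_on[OF assms(1)]]) (use assms in auto)

lemma continuous_on_norm_powr:
  assumes "continuous_on A f" "0 < p"
  shows "continuous_on A (\<lambda>z. norm (f z) powr p)"
  by (intro continuous_on_powr' continuous_on_norm continuous_intros assms) (use assms in auto)

lemma hardyI_bounded:
  assumes f: "f holomorphic_on ball 0 1" and B: "\<And>z. norm z < 1 \<Longrightarrow> norm (f z) \<le> B" and p: "0 < p"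
  shows "f \<in> hardy p"
  unfolding hardy_circ_int
proof (intro conjI f exI[of _ "2 * pi * B powr p"] allI impI)
  fix r :: real assume r: "0 \<le> r \<and> r < 1"
  have "circ_int r (\<lambda>z. norm (f z) powr p) \<le> circ_int r (\<lambda>_. B powr p)"
    by (rule circ_int_mono)
       (use r p B in \<open>auto intro!: continuous_on_norm_powr continuous_on_circle[OF f] powr_mono2\<close>)
  then show "circ_int r (\<lambda>z. norm (f z) powr p) \<le> 2 * pi * B powr p" by (simp add: circ_int_const)
qed auto

lemma hardy_antimono:
  assumes f: "f \<in> hardy p" and q: "0 < q" "q \<le> p"
  shows "f \<in> hardy q"
proof -
  obtain A where hol: "f holomorphic_on ball 0 1"
    and A: "0 \<le> A" "\<forall>r. 0 \<le> r \<and> r < 1 \<longrightarrow> circ_int r (\<lambda>z. norm (f z) powr p) \<le> A"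
    using f unfolding hardy_circ_int by blast
  have le: "x powr q \<le> 1 + x powr p" if "0 \<le> x" for x :: real
  proof (cases "x \<le> 1")
    case True
    then have "x powr q \<le> 1" using that q by (simp add: powr_le1)
    then show ?thesis by (simp add: add_increasing2)
  next
    case False
    then have "x powr q \<le> x powr p" using q by (intro powr_mono) auto
    then show ?thesis by linarith
  qed
  show ?thesis unfolding hardy_circ_int
  proof (intro conjI hol exI[of _ "2 * pi + A"] allI impI)
    fix r :: real assume r: "0 \<le> r \<and> r < 1"
    note ci = continuous_on_norm_powr[OF continuous_on_circle[OF hol]]
    have "circ_int r (\<lambda>z. norm (f z) powr q) \<le> circ_int r (\<lambda>z. 1 + norm (f z) powr p)"
      by (rule circ_int_mono) (use r q le in \<open>auto intro!: ci continuous_intros\<close>)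
    also have "\<dots> = 2 * pi + circ_int r (\<lambda>z. norm (f z) powr p)"
      using r q by (subst circ_int_add) (auto intro!: ci simp: circ_int_const)
    also have "\<dots> \<le> 2 * pi + A" using A r by simp
    finally show "circ_int r (\<lambda>z. norm (f z) powr q) \<le> 2 * pi + A" .
  qed (use A in auto)
qed

text \<open>
  Cauchy's formula for the majorant of \<open>\<bar>f\<bar>\<^sup>p\<close> on a circle of
  radius at least \<open>(1 + \<bar>z\<bar>) / 2\<close>.
\<close>

lemma hardy_growth:
  assumes f: "f \<in> hardy p" and p: "0 < p"
  obtains C where "0 \<le> C" "\<forall>z. norm z < 1 \<longrightarrow> norm (f z) powr p \<le> C / (1 - norm z)"
proof -
  obtain A where hol: "f holomorphic_on ball 0 1"
    and A: "0 \<le> A" "\<forall>r. 0 \<le> r \<and> r < 1 \<longrightarrow> circ_int r (\<lambda>z. norm (f z) powr p) \<le> A"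
    using f unfolding hardy_circ_int by blast
  have "norm (f z) powr p \<le> (A / pi) / (1 - norm z)" if z: "norm z < 1" for z
  proof -
    obtain R where R: "(1 + norm z) / 2 < R" "R < 1" "R \<notin> zero_radii f"
      using obtain_radius[OF countable_zero_radii[OF hol], of "(1 + norm z) / 2"] z by auto
    have R0: "0 < R" "norm z < R" "(1 - norm z) / 2 \<le> R - norm z" 
    proof -
      have "1 + norm z < 2 * R" using R(1) by simp
      then show "0 < R" "norm z < R" "(1 - norm z) / 2 \<le> R - norm z"
        using z norm_ge_zero[of z] by (linarith, linarith, simp add: field_simps)
    qed
    obtain S \<psi> where \<psi>: "R < S" "S \<le> 1" "\<psi> holomorphic_on ball 0 S"
      "\<forall>z. norm z = R \<longrightarrow> norm (\<psi> z) = norm (f z) powr p"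
      "\<forall>z. norm z \<le> R \<longrightarrow> norm (f z) powr p \<le> norm (\<psi> z)"
      by (rule power_majorant[OF hol R0(1) R(2,3) p])
    have c\<psi>: "continuous_on (sphere 0 R) \<psi>"
      by (rule continuous_on_subset[OF holomorphic_on_imp_continuous_on[OF \<psi>(3)]]) (use \<psi> in auto)
    have "2 * pi * norm (\<psi> z) \<le> circ_int R (\<lambda>w. norm (\<psi> w) * (R / norm (w - z)))"
      by (rule holomorphic_le_circ_int[OF \<psi>(3) R0(2) \<psi>(1)])
    also have "\<dots> \<le> circ_int R (\<lambda>w. (2 / (1 - norm z)) * norm (f w) powr p)"
    proof (rule circ_int_mono)
      show "continuous_on (sphere 0 R) (\<lambda>w. norm (\<psi> w) * (R / norm (w - z)))"
        using R0 by (intro continuous_intros c\<psi>) auto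
      show "continuous_on (sphere 0 R) (\<lambda>w. 2 / (1 - norm z) * norm (f w) powr p)"
        by (intro continuous_intros continuous_on_norm_powr continuous_on_circle[OF hol] R p)
      fix w :: complex assume w: "norm w = R"
      have "(1 - norm z) / 2 \<le> norm (w - z)" using norm_triangle_ineq2[of w z] R0 w by linarith
      then have "1 / norm (w - z) \<le> 1 / ((1 - norm z) / 2)" using z by (intro divide_left_mono mult_pos_pos) auto
      then have "R / norm (w - z) \<le> 2 / (1 - norm z)"
        using R R0 mult_mono[of R 1 "1 / norm (w - z)" "2 / (1 - norm z)"] by simp
      then have "R / norm (w - z) * norm (f w) powr p \<le> 2 / (1 - norm z) * norm (f w) powr p"
        by (rule mult_right_mono) simp
      then show "norm (\<psi> w) * (R / norm (w - z)) \<le> 2 / (1 - norm z) * norm (f w) powr p"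
        using \<psi>(4) w by (simp add: mult.commute)
    qed (use R0 in auto)
    also have "\<dots> = 2 / (1 - norm z) * circ_int R (\<lambda>w. norm (f w) powr p)" by (rule circ_int_cmult)
    also have "\<dots> \<le> 2 / (1 - norm z) * A" using A R R0 z by (intro mult_left_mono) auto
    finally have "norm (\<psi> z) \<le> (A / pi) / (1 - norm z)" using z by (simp add: field_simps)
    moreover have "norm (f z) powr p \<le> norm (\<psi> z)" using \<psi>(5) R0 by simp
    ultimately show ?thesis by linarith
  qed
  then show ?thesis using that[of "A / pi"] A by auto
qed

lemma radial_growth:
  assumes F: "F holomorphic_on ball 0 1" and r: "0 \<le> r" "r < 1"
    and bnd: "\<And>\<rho>. 0 \<le> \<rho> \<Longrightarrow> \<rho> < r \<Longrightarrow> norm (deriv F (of_real \<rho> * cis t)) \<le> B / sqrt (r - \<rho>)"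
  shows "norm (F (of_real r * cis t) - F 0) \<le> 2 * B * sqrt r"
proof (cases "r = 0")
  case False
  then have r0: "0 < r" using r by simp
  have inb: "of_real x * cis t \<in> ball 0 1" if "0 \<le> x" "x \<le> r" for x
    using that r by (simp add: norm_mult)
  have "norm (F (of_real r * cis t) - F (of_real 0 * cis t)) \<le> (- 2 * B * sqrt (r - r)) - (- 2 * B * sqrt (r - 0))"
  proof (rule differentiable_bound_general[OF r0])
    show "continuous_on {0..r} (\<lambda>x. F (of_real x * cis t))"
      by (rule continuous_on_compose2[OF holomorphic_on_imp_continuous_on[OF F]])
         (use inb in \<open>auto intro!: continuous_intros\<close>)
    show "continuous_on {0..r} (\<lambda>x. - 2 * B * sqrt (r - x))" by (intro continuous_intros)
    fix x assume x: "0 < x" "x < r"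
    have "(F has_field_derivative deriv F (of_real x * cis t)) (at (of_real x * cis t))"
      by (rule holomorphic_derivI[OF F]) (use inb[of x] x in auto)
    moreover have "((\<lambda>x. of_real x * cis t) has_vector_derivative cis t) (at x)"
      by (auto intro!: derivative_eq_intros)
    ultimately show "((\<lambda>x. F (of_real x * cis t)) has_vector_derivative (cis t * deriv F (of_real x * cis t))) (at x)"
      using field_vector_diff_chain_at[of "\<lambda>x. of_real x * cis t" "cis t" x F] by (simp add: o_def)
    show "((\<lambda>x. - 2 * B * sqrt (r - x)) has_vector_derivative (B / sqrt (r - x))) (at x)"
      using x unfolding has_real_derivative_iff_has_vector_derivative[symmetric]
      by (auto intro!: derivative_eq_intros simp: divide_simps)
    show "norm (cis t * deriv F (of_real x * cis t)) \<le> B / sqrt (r - x)"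
      using bnd[of x] x by (simp add: norm_mult)
  qed
  then show ?thesis by simp
qed simp

text \<open>
  Let \<open>z = \<rho> cis t\<close> and \<open>\<rho> < r < R = \<bar>w\<bar>\<close>. By
  Cauchy's formula \<open>\<bar>F'(z)\<bar>\<^sup>p\<close> is at most a mean of
  \<open>\<bar>\<psi>(w)\<bar> / \<bar>w - z\<bar>\<close>, where \<open>\<psi>\<close>
  majorizes \<open>\<bar>F'\<bar>\<^sup>p\<close>. Split the kernel into the powers
  \<open>-\<epsilon>\<close> and \<open>-q = \<epsilon> - 1\<close>. The first one is at most
  \<open>(r - \<rho>)\<^bsup>-\<epsilon>\<^esup>\<close>. In the second one \<open>z\<close> may
  be moved outwards to \<open>r cis t\<close>, at the price of a factor \<open>2\<close>, so
  that the mean becomes a function \<open>N(t)\<close> whose integral is controlled by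
  \<open>integral_of_kernel_means\<close>. Hence \<open>\<bar>F'(z)\<bar> \<le> (r -
  \<rho>)\<^bsup>-\<epsilon>/p\<^esup> N(t)\<^bsup>1/p\<^esup>\<close>, which is integrable in
  \<open>\<rho>\<close> because \<open>\<epsilon> / p \<le> 1 / 2\<close>.
\<close>

lemma hardy_primitive:
  assumes F: "F holomorphic_on ball 0 1" and dF: "deriv F \<in> hardy p" and p: "0 < p"
  shows "F \<in> hardy p"
proof -
  define g where "g = deriv F"
  obtain A where hol: "g holomorphic_on ball 0 1"
    and A: "0 \<le> A" "\<forall>r. 0 \<le> r \<and> r < 1 \<longrightarrow> circ_int r (\<lambda>z. norm (g z) powr p) \<le> A"
    using dF unfolding hardy_circ_int g_def by blast
  \<comment> \<open>\<open>\<epsilon> / p \<le> 1 / 2\<close> makes the radial factor integrable; the minimum keeps \<open>\<epsilon> < 1\<close> for large \<open>p\<close>.\<close>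
  define \<epsilon> where "\<epsilon> = min p 1 / 2"
  have \<epsilon>: "0 < \<epsilon>" "\<epsilon> < 1" "\<epsilon> / p \<le> 1 / 2" using p by (auto simp: \<epsilon>_def min_def field_simps)
  define q where "q = 1 - \<epsilon>"
  have q: "0 \<le> q" "q < 1" "q \<le> 1" using \<epsilon> by (auto simp: q_def)
  define K where "K = 2 * pi / cos (q * pi / 2)"
  define A2 where "A2 = A * K / pi"
  have Kpos: "0 < K"
  proof -
    have "0 < cos (q * pi / 2)"
    proof (rule cos_gt_zero_pi)
      have "0 \<le> q * pi" "q * pi < 1 * pi" using q by (auto intro: mult_strict_right_mono)
      then show "- (pi / 2) < q * pi / 2" "q * pi / 2 < pi / 2" using pi_gt_zero by linarith+
    qed
    then show ?thesis by (simp add: K_def)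
  qed
  show ?thesis unfolding hardy_circ_int
  proof (intro conjI F exI[of _ "2 powr p * (2 * pi * norm (F 0) powr p + 2 powr p * A2)"] allI impI)
    show "0 \<le> 2 powr p * (2 * pi * norm (F 0) powr p + 2 powr p * A2)"
      using A Kpos by (simp add: A2_def)
    fix r :: real assume r: "0 \<le> r \<and> r < 1"
    obtain R where R: "r < R" "R < 1" "R \<notin> zero_radii g"
      using obtain_radius[OF countable_zero_radii[OF hol]] r by blast
    have R0: "0 < R" using R r by linarith
    obtain S \<psi> where \<psi>: "R < S" "S \<le> 1" "\<psi> holomorphic_on ball 0 S"
      "\<forall>z. norm z = R \<longrightarrow> norm (\<psi> z) = norm (g z) powr p"
      "\<forall>z. norm z \<le> R \<longrightarrow> norm (g z) powr p \<le> norm (\<psi> z)"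
      by (rule power_majorant[OF hol R0 R(2,3) p])
    have c\<psi>: "continuous_on (sphere 0 R) \<psi>"
      by (rule continuous_on_subset[OF holomorphic_on_imp_continuous_on[OF \<psi>(3)]]) (use \<psi> in auto)
    define N where "N = (\<lambda>t. circ_int R (\<lambda>w. norm (\<psi> w) / pi * norm (1 - (of_real r / w) * cis t) powr (- q)))"
    have ccw: "continuous_on (sphere 0 R) (\<lambda>w. norm (\<psi> w) / pi)"
      by (intro continuous_intros c\<psi>) auto
    have ccw2: "continuous_on (sphere 0 R) (\<lambda>w. of_real r / w :: complex)"
      by (intro continuous_intros) (use R0 in auto)
    have cw: "norm (of_real r / w) < 1" if "norm w = R" for w :: complex
      using that R r by (simp add: norm_divide)
    note dk = integral_of_kernel_means[OF ccw(1) _ ccw2 cw less_imp_le[OF R0] q(1,2), folded N_def K_def]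
    have N: "continuous_on {0..2*pi} N" "integral {0..2*pi} N \<le> A2" "\<And>t. 0 \<le> N t"
    proof -
      have "circ_int R (\<lambda>w. norm (\<psi> w) / pi) = circ_int R (\<lambda>w. (1 / pi) * norm (g w) powr p)"
        by (rule circ_int_cong) (use \<psi>(4) R0 in auto)
      also have "\<dots> = 1 / pi * circ_int R (\<lambda>w. norm (g w) powr p)" by (rule circ_int_cmult)
      also have "\<dots> \<le> 1 / pi * A" using A R R0 by (intro mult_left_mono) auto
      finally have le: "circ_int R (\<lambda>w. norm (\<psi> w) / pi) \<le> 1 / pi * A" .
      show "integral {0..2*pi} N \<le> A2"
        by (rule order_trans[OF dk(2)]) (use mult_left_mono[OF le, of K] Kpos in \<open>auto simp: A2_def mult_ac\<close>)
      show "continuous_on {0..2*pi} N" by (rule dk(1)) simp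
      show "0 \<le> N t" for t unfolding N_def by (rule dk(3)[unfolded N_def]) simp
    qed
    have gN: "norm (g (of_real \<rho> * cis t)) \<le> N t powr (1 / p) / sqrt (r - \<rho>)" if \<rho>: "0 \<le> \<rho>" "\<rho> < r" for \<rho> t
    proof -
      define z where "z = of_real \<rho> * cis t"
      have nz: "norm z = \<rho>" using \<rho> by (simp add: z_def norm_mult)
      have wz: "R / norm (w - z) \<le> (r - \<rho>) powr (- \<epsilon>) * (2 * norm (1 - (of_real r / w) * cis t) powr (- q))"
        if w: "norm w = R" for w
      proof -
        have w0: "w \<noteq> 0" using w R0 by auto
        have d1: "r - \<rho> \<le> norm (w - z)" using norm_triangle_ineq2[of w z] w nz R by linarith
        have "norm (w - of_real r * cis t) \<le> norm (w - z) + norm (z - of_real r * cis t)"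
          using norm_triangle_ineq[of "w - z" "z - of_real r * cis t"] by simp
        also have "norm (z - of_real r * cis t) = r - \<rho>"
        proof -
          have "z - of_real r * cis t = of_real (\<rho> - r) * cis t" by (simp add: z_def algebra_simps)
          then have "norm (z - of_real r * cis t) = \<bar>\<rho> - r\<bar>" by (simp only: norm_mult norm_of_real norm_cis mult_1_right)
          then show ?thesis using \<rho> by simp
        qed
        finally have d2: "norm (w - of_real r * cis t) \<le> 2 * norm (w - z)" using d1 by linarith
        have fac: "w - of_real r * cis t = w * (1 - (of_real r / w) * cis t)" using w0 by (simp add: field_simps)
        let ?k = "norm (1 - (of_real r / w) * cis t)"
        have d2': "R * ?k / 2 \<le> norm (w - z)" using d2 unfolding fac norm_mult w by simp
        have kpos: "0 < ?k"
        proof -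
          have "norm (of_real r / w * cis t) < 1" unfolding norm_mult norm_cis using cw[OF w] by simp
          then have "of_real r / w * cis t \<noteq> 1" by auto
          then show ?thesis by auto
        qed
        have pos: "0 < norm (w - z)" using d1 \<rho> by linarith
        have "1 / norm (w - z) = norm (w - z) powr (- \<epsilon>) * norm (w - z) powr (- q)"
          using pos powr_minus_divide[of "norm (w - z)" 1] unfolding powr_add[symmetric] q_def by simp
        also have "\<dots> \<le> (r - \<rho>) powr (- \<epsilon>) * (R * ?k / 2) powr (- q)"
          using d1 d2' \<rho> \<epsilon> q kpos R0 by (intro mult_mono powr_mono2') auto
        also have "(R * ?k / 2) powr (- q) = R powr (- q) * ?k powr (- q) * 2 powr q"
          using R0 kpos by (simp add: powr_mult powr_divide powr_minus field_simps)
        finally have "R * (1 / norm (w - z)) \<le> R * ((r - \<rho>) powr (- \<epsilon>) * (R powr (- q) * ?k powr (- q) * 2 powr q))"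
          using R0 by (intro mult_left_mono) auto
        also have "\<dots> = (r - \<rho>) powr (- \<epsilon>) * ((R powr (1 - q) * 2 powr q) * ?k powr (- q))"
          using R0 by (simp add: powr_diff powr_minus field_simps)
        also have "\<dots> \<le> (r - \<rho>) powr (- \<epsilon>) * ((1 * 2) * ?k powr (- q))"
        proof -
          have "R powr (1 - q) \<le> 1" using R0 R q by (intro powr_le1) auto
          moreover have "2 powr q \<le> (2::real)" using q powr_mono[of q 1 2] by simp
          ultimately show ?thesis by (intro mult_left_mono mult_right_mono mult_mono) auto
        qed
        finally show ?thesis by simp
      qed
      have "2 * pi * norm (\<psi> z) \<le> circ_int R (\<lambda>w. norm (\<psi> w) * (R / norm (w - z)))"
        by (rule holomorphic_le_circ_int[OF \<psi>(3) _ \<psi>(1)]) (use nz \<rho> R in simp)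
      also have "\<dots> \<le> circ_int R (\<lambda>w. (2 * pi * (r - \<rho>) powr (- \<epsilon>)) *
                 (norm (\<psi> w) / pi * norm (1 - (of_real r / w) * cis t) powr (- q)))"
      proof (rule circ_int_mono)
        show "continuous_on (sphere 0 R) (\<lambda>w. norm (\<psi> w) * (R / norm (w - z)))"
          by (intro continuous_intros c\<psi>) (use nz \<rho> R in auto)
        have "norm (1 - (of_real r / w) * cis t) \<noteq> 0" if "norm w = R" for w
        proof -
          have "norm (of_real r / w * cis t) < 1" unfolding norm_mult norm_cis using cw[OF that] by simp
          then have "of_real r / w * cis t \<noteq> 1" by auto
          then show ?thesis by auto
        qed
        then show "continuous_on (sphere 0 R) (\<lambda>w. (2 * pi * (r - \<rho>) powr (- \<epsilon>)) *
                 (norm (\<psi> w) / pi * norm (1 - (of_real r / w) * cis t) powr (- q)))"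
          by (intro continuous_intros ccw ccw2) auto
        fix w :: complex assume w: "norm w = R"
        show "norm (\<psi> w) * (R / norm (w - z)) \<le> (2 * pi * (r - \<rho>) powr (- \<epsilon>)) *
                 (norm (\<psi> w) / pi * norm (1 - (of_real r / w) * cis t) powr (- q))"
          using mult_left_mono[OF wz[OF w], of "norm (\<psi> w)"] by (simp add: field_simps)
      qed (use R0 in auto)
      also have "\<dots> = 2 * pi * ((r - \<rho>) powr (- \<epsilon>) * N t)" unfolding circ_int_cmult N_def by simp
      finally have "norm (\<psi> z) \<le> (r - \<rho>) powr (- \<epsilon>) * N t" by simp
      moreover have "norm (g z) powr p \<le> norm (\<psi> z)" using \<psi>(5) nz \<rho> R by simp
      ultimately have "norm (g z) powr p \<le> (r - \<rho>) powr (- \<epsilon>) * N t" by linarith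
      then have "(norm (g z) powr p) powr (1 / p) \<le> ((r - \<rho>) powr (- \<epsilon>) * N t) powr (1 / p)"
        using p by (intro powr_mono2) auto
      then have "norm (g z) \<le> (r - \<rho>) powr (- (\<epsilon> / p)) * N t powr (1 / p)"
        using p N(3) \<rho> by (simp add: powr_powr powr_mult)
      also have "\<dots> \<le> (r - \<rho>) powr (- (1 / 2)) * N t powr (1 / p)"
      proof (rule mult_right_mono)
        show "(r - \<rho>) powr (- (\<epsilon> / p)) \<le> (r - \<rho>) powr (- (1 / 2))"
          using \<epsilon> \<rho> r by (intro powr_mono') auto
      qed simp
      also have "(r - \<rho>) powr (- (1 / 2)) = 1 / sqrt (r - \<rho>)"
        using \<rho> by (simp add: powr_minus_divide powr_half_sqrt)
      finally show ?thesis by (simp add: z_def)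
    qed
    have FN: "norm (F (of_real r * cis t)) powr p \<le> 2 powr p * (norm (F 0) powr p + 2 powr p * N t)" for t
    proof -
      have "norm (F (of_real r * cis t) - F 0) \<le> 2 * N t powr (1 / p) * sqrt r"
        by (rule radial_growth[OF F]) (use r gN in \<open>auto simp: g_def\<close>)
      also have "\<dots> \<le> 2 * N t powr (1 / p) * 1" using r by (intro mult_left_mono) auto
      finally have "norm (F (of_real r * cis t)) \<le> norm (F 0) + 2 * N t powr (1 / p)"
        using norm_triangle_sub[of "F (of_real r * cis t)" "F 0"] by linarith
      also have "\<dots> \<le> 2 * max (norm (F 0)) (2 * N t powr (1 / p))" by linarith
      finally have "norm (F (of_real r * cis t)) powr p \<le> (2 * max (norm (F 0)) (2 * N t powr (1 / p))) powr p"
        using p by (intro powr_mono2) auto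
      also have "\<dots> = 2 powr p * (max (norm (F 0)) (2 * N t powr (1 / p))) powr p"
        by (subst powr_mult) auto
      also have "(max (norm (F 0)) (2 * N t powr (1 / p))) powr p \<le> norm (F 0) powr p + (2 * N t powr (1 / p)) powr p"
        by (cases "norm (F 0) \<le> 2 * N t powr (1 / p)") (auto simp: max_def)
      also have "(2 * N t powr (1 / p)) powr p = 2 powr p * N t"
        using p N(3)[of t] by (simp add: powr_mult powr_powr)
      finally show ?thesis by simp
    qed
    have "continuous_on {0..2*pi} (\<lambda>t. norm (F (of_real r * cis t)) powr p)"
      by (rule circ_continuous[where u = "\<lambda>z. norm (F z) powr p"])
         (use r p in \<open>auto intro!: continuous_on_norm_powr continuous_on_circle[OF F]\<close>)
    then have "circ_int r (\<lambda>z. norm (F z) powr p) \<le> integral {0..2*pi} (\<lambda>t. 2 powr p * (norm (F 0) powr p + 2 powr p * N t))"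
      unfolding circ_int_def
      by (intro integral_le integrable_continuous_real) (use FN in \<open>auto intro!: continuous_intros N\<close>)
    also have "\<dots> = 2 powr p * (2 * pi * norm (F 0) powr p + 2 powr p * integral {0..2*pi} N)"
      by (subst integral_mult_right, subst integral_add)
         (auto intro!: integrable_continuous_real continuous_intros N)
    also have "\<dots> \<le> 2 powr p * (2 * pi * norm (F 0) powr p + 2 powr p * A2)"
      using N(2) by (intro mult_left_mono add_left_mono) auto
    finally show "circ_int r (\<lambda>z. norm (F z) powr p) \<le> 2 powr p * (2 * pi * norm (F 0) powr p + 2 powr p * A2)" .
  qed
qed

section \<open>The Nevanlinna class and the Blaschke condition\<close>

text \<open>
  The logarithm of \<open>1 + \<bar>u\<bar>\<close> is used in place of the positive part of
  \<open>ln \<bar>u\<bar>\<close> since both \<open>1 + \<bar>u + v\<bar>\<close> and \<open>1 +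
  \<bar>u v\<bar>\<close> are at most \<open>(1 + \<bar>u\<bar>) (1 + \<bar>v\<bar>)\<close>.
\<close>

definition nevanlinna :: "(complex \<Rightarrow> complex) \<Rightarrow> bool" where
  "nevanlinna u \<longleftrightarrow> continuous_on (ball 0 1) u \<and>
     (\<exists>C. \<forall>r. 0 \<le> r \<and> r < 1 \<longrightarrow> circ_int r (\<lambda>z. ln (1 + norm (u z))) \<le> C)"

lemma continuous_ln_norm:
  assumes "continuous_on (ball 0 1) u" "r < 1"
  shows "continuous_on (sphere 0 r) (\<lambda>z. ln (1 + norm (u z)))"
proof -
  have "1 + norm (u z) \<noteq> 0" for z using norm_ge_zero[of "u z"] by linarith
  then show ?thesis
    by (intro continuous_intros continuous_on_subset[OF assms(1)]) (use assms(2) in auto)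
qed

lemma nevanlinna_le:
  assumes u: "continuous_on (ball 0 1) u" and v: "nevanlinna v" and w: "nevanlinna w"
    and le: "\<And>z. norm z < 1 \<Longrightarrow> 1 + norm (u z) \<le> (1 + norm (v z)) * (1 + norm (w z))"
  shows "nevanlinna u"
proof -
  obtain C D where C: "\<forall>r. 0 \<le> r \<and> r < 1 \<longrightarrow> circ_int r (\<lambda>z. ln (1 + norm (v z))) \<le> C"
    and D: "\<forall>r. 0 \<le> r \<and> r < 1 \<longrightarrow> circ_int r (\<lambda>z. ln (1 + norm (w z))) \<le> D"
    and cv: "continuous_on (ball 0 1) v" "continuous_on (ball 0 1) w"
    using v w unfolding nevanlinna_def by blast
  have "circ_int r (\<lambda>z. ln (1 + norm (u z))) \<le> C + D" if r: "0 \<le> r" "r < 1" for r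
  proof -
    have "circ_int r (\<lambda>z. ln (1 + norm (u z))) \<le> circ_int r (\<lambda>z. ln (1 + norm (v z)) + ln (1 + norm (w z)))"
    proof (rule circ_int_mono)
      fix z :: complex assume "norm z = r"
      then have "ln (1 + norm (u z)) \<le> ln ((1 + norm (v z)) * (1 + norm (w z)))"
        using le[of z] r norm_ge_zero[of "u z"] by (intro ln_mono) linarith+
      also have "\<dots> = ln (1 + norm (v z)) + ln (1 + norm (w z))"
        by (rule ln_mult_pos) (use norm_ge_zero[of "v z"] norm_ge_zero[of "w z"] in linarith)+
      finally show "ln (1 + norm (u z)) \<le> ln (1 + norm (v z)) + ln (1 + norm (w z))" .
    qed (use r in \<open>auto intro!: continuous_on_add continuous_ln_norm u cv\<close>)
    also have "\<dots> = circ_int r (\<lambda>z. ln (1 + norm (v z))) + circ_int r (\<lambda>z. ln (1 + norm (w z)))"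
      by (rule circ_int_add) (use r in \<open>auto intro!: continuous_ln_norm cv\<close>)
    also have "\<dots> \<le> C + D" using C D r by (intro add_mono) auto
    finally show ?thesis .
  qed
  then show ?thesis using u unfolding nevanlinna_def by blast
qed

lemma nevanlinna_const: "nevanlinna (\<lambda>_. c)"
  by (auto simp: nevanlinna_def circ_int_const)

lemma nevanlinna_add:
  assumes "nevanlinna u" "nevanlinna v"
  shows "nevanlinna (\<lambda>z. u z + v z)"
proof (rule nevanlinna_le[OF _ assms])
  show "continuous_on (ball 0 1) (\<lambda>z. u z + v z)"
    using assms by (intro continuous_intros) (auto simp: nevanlinna_def)
  show "1 + norm (u z + v z) \<le> (1 + norm (u z)) * (1 + norm (v z))" for z
  proof -
    have "0 \<le> norm (u z) * norm (v z)" by simp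
    moreover have "(1 + norm (u z)) * (1 + norm (v z)) = 1 + norm (u z) + norm (v z) + norm (u z) * norm (v z)"
      by (simp add: algebra_simps)
    ultimately show ?thesis using norm_triangle_ineq[of "u z" "v z"] by linarith
  qed
qed

lemma nevanlinna_mult:
  assumes "nevanlinna u" "nevanlinna v"
  shows "nevanlinna (\<lambda>z. u z * v z)"
proof (rule nevanlinna_le[OF _ assms])
  show "continuous_on (ball 0 1) (\<lambda>z. u z * v z)"
    using assms by (intro continuous_intros) (auto simp: nevanlinna_def)
  show "1 + norm (u z * v z) \<le> (1 + norm (u z)) * (1 + norm (v z))" for z
    by (simp add: norm_mult algebra_simps)
qed

lemma nevanlinna_sum:
  assumes "finite I" "\<And>i. i \<in> I \<Longrightarrow> nevanlinna (u i)"
  shows "nevanlinna (\<lambda>z. \<Sum>i\<in>I. u i z)"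
  using assms by (induction I rule: finite_induct) (auto intro: nevanlinna_add nevanlinna_const)

lemma nevanlinna_prod:
  assumes "finite I" "\<And>i. i \<in> I \<Longrightarrow> nevanlinna (u i)"
  shows "nevanlinna (\<lambda>z. \<Prod>i\<in>I. u i z)"
  using assms by (induction I rule: finite_induct) (auto intro: nevanlinna_mult nevanlinna_const)

text \<open>
  Because \<open>ln (1 + x) \<le> ln 2 + x\<^sup>p / p\<close> for \<open>x \<ge> 0\<close>.
\<close>

lemma hardy_nevanlinna:
  assumes f: "f \<in> hardy p" and p: "0 < p"
  shows "nevanlinna f"
proof -
  obtain A where hol: "f holomorphic_on ball 0 1"
    and A: "\<forall>r. 0 \<le> r \<and> r < 1 \<longrightarrow> circ_int r (\<lambda>z. norm (f z) powr p) \<le> A"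
    using f unfolding hardy_circ_int by blast
  have c: "continuous_on (ball 0 1) f" by (rule holomorphic_on_imp_continuous_on[OF hol])
  have le: "ln (1 + x) \<le> ln 2 + (1 / p) * x powr p" if x: "0 \<le> x" for x :: real
  proof (cases "x \<le> 1")
    case True
    then have "ln (1 + x) \<le> ln 2" using x by simp
    moreover have "0 \<le> (1 / p) * x powr p" using p by simp
    ultimately show ?thesis by linarith
  next
    case False
    have "ln (1 + x) \<le> ln (2 * x)" using False by simp
    also have "\<dots> = ln 2 + ln x" using False by (simp add: ln_mult_pos)
    also have "ln x = (1 / p) * ln (x powr p)" using False p by (simp add: ln_powr)
    also have "\<dots> \<le> (1 / p) * x powr p" using False p by (intro mult_left_mono less_imp_le[OF ln_less_self]) auto
    finally show ?thesis by simp
  qed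
  have "circ_int r (\<lambda>z. ln (1 + norm (f z))) \<le> 2 * pi * ln 2 + (1 / p) * A" if r: "0 \<le> r" "r < 1" for r
  proof -
    note cn = continuous_on_norm_powr[OF continuous_on_circle[OF hol r(2)] p]
    have "circ_int r (\<lambda>z. ln (1 + norm (f z))) \<le> circ_int r (\<lambda>z. ln 2 + (1 / p) * norm (f z) powr p)"
      by (rule circ_int_mono[OF continuous_ln_norm[OF c r(2)]
            continuous_on_add[OF continuous_on_const continuous_on_mult[OF continuous_on_const cn]] r(1)])
         (use le norm_ge_zero in blast)
    also have "\<dots> = circ_int r (\<lambda>z. ln 2) + circ_int r (\<lambda>z. (1 / p) * norm (f z) powr p)"
      by (rule circ_int_add[OF continuous_on_const continuous_on_mult[OF continuous_on_const cn] r(1)])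
    also have "\<dots> = 2 * pi * ln 2 + (1 / p) * circ_int r (\<lambda>z. norm (f z) powr p)"
      unfolding circ_int_const circ_int_cmult by simp
    also have "\<dots> \<le> 2 * pi * ln 2 + (1 / p) * A" using A r p by (intro add_left_mono mult_left_mono) auto
    finally show ?thesis .
  qed
  then show ?thesis using c unfolding nevanlinna_def by blast
qed

text \<open>
  If \<open>W(z) = z\<^sup>k V(z)\<close> with \<open>V(0) \<noteq> 0\<close>, then the means of
  \<open>ln \<bar>V\<bar>\<close> and \<open>ln \<bar>W\<bar>\<close> on the circle of radius
  \<open>R\<close> differ by \<open>2 \<pi> k ln R\<close>, which is bounded for \<open>R \<ge>
  1 / 2\<close>.
\<close>

lemma jensen_with_zero_at_origin:
  assumes W: "W holomorphic_on ball 0 1" "\<exists>z\<in>ball 0 1. W z \<noteq> 0"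
  obtains B where "\<forall>R. 1 / 2 \<le> R \<and> R < 1 \<and> R \<notin> zero_radii W \<longrightarrow>
      (\<Sum>a\<in>{z \<in> cball 0 R. W z = 0} - {0}. ln (R / norm a)) \<le> B + circ_int R (\<lambda>z. ln (norm (W z))) / (2 * pi)"
proof -
  obtain k V where V0: "V holomorphic_on ball 0 1" "V 0 \<noteq> 0" "\<forall>z\<in>ball 0 1. W z = (z - 0) ^ k * V z"
    "W 0 = 0 \<longrightarrow> 0 < k"
    by (rule divide_out_zero[OF W(1) open_ball connected_ball _ W(2), of 0]) auto
  then have V: "V holomorphic_on ball 0 1" "V 0 \<noteq> 0" "\<And>z. norm z < 1 \<Longrightarrow> W z = z ^ k * V z"
    by auto
  have "(\<Sum>a\<in>{z \<in> cball 0 R. W z = 0} - {0}. ln (R / norm a))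
      \<le> (real k * ln 2 - ln (norm (V 0))) + circ_int R (\<lambda>z. ln (norm (W z))) / (2 * pi)"
    if R: "1 / 2 \<le> R" "R < 1" "R \<notin> zero_radii W" for R
  proof -
    have R0: "0 < R" using R by simp
    have nzW: "W z \<noteq> 0" if "norm z = R" for z by (rule zero_radiiD[OF R(3,2) W(2) that])
    have nzV: "V z \<noteq> 0" if "norm z = R" for z using nzW[OF that] V(3)[of z] that R by auto
    have "{z \<in> cball 0 R. W z = 0} - {0} = {z \<in> cball 0 R. V z = 0}"
    proof (rule Set.set_eqI)
      fix z
      show "z \<in> {z \<in> cball 0 R. W z = 0} - {0} \<longleftrightarrow> z \<in> {z \<in> cball 0 R. V z = 0}"
      proof (cases "norm z \<le> R")
        case True
        then have "W z = z ^ k * V z" using V(3)[of z] R by simp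
        then show ?thesis using V(2) True by (cases "z = 0") simp_all
      qed simp
    qed
    then have Seq: "(\<Sum>a\<in>{z \<in> cball 0 R. W z = 0} - {0}. ln (R / norm a))
        = (\<Sum>a\<in>{z \<in> cball 0 R. V z = 0}. ln (R / norm a))" by simp
    have "circ_int R (\<lambda>z. ln (norm (V z))) \<le> circ_int R (\<lambda>z. ln (norm (W z))) + 2 * pi * (real k * ln 2)"
    proof -
      have cl: "continuous_on (sphere 0 R) (\<lambda>z. ln (norm (W z)))" "continuous_on (sphere 0 R) (\<lambda>z. ln (norm (V z)))"
        using nzW nzV by (auto intro!: continuous_intros continuous_on_circle W(1) V(1) R)
      have "circ_int R (\<lambda>z. ln (norm (V z))) \<le> circ_int R (\<lambda>z. ln (norm (W z)) + real k * ln 2)"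
      proof (rule circ_int_mono)
        fix z :: complex assume z: "norm z = R"
        have "ln (norm (W z)) = real k * ln R + ln (norm (V z))"
          using V(3)[of z] z R R0 nzV[OF z] by (simp add: norm_mult norm_power ln_mult_pos ln_realpow)
        moreover have "real k * (- ln 2) \<le> real k * ln R"
        proof (rule mult_left_mono)
          have "ln (1 / 2) \<le> ln R" using R by (intro ln_mono) auto
          then show "- ln 2 \<le> ln R" by (simp add: ln_div)
        qed simp
        ultimately show "ln (norm (V z)) \<le> ln (norm (W z)) + real k * ln 2" by simp
      qed (use cl R0 in \<open>auto intro!: continuous_intros\<close>)
      also have "\<dots> = circ_int R (\<lambda>z. ln (norm (W z))) + 2 * pi * (real k * ln 2)"
        by (subst circ_int_add) (use cl R0 in \<open>auto simp: circ_int_const\<close>)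
      finally show ?thesis .
    qed
    moreover have "2 * pi * (ln (norm (V 0)) + (\<Sum>a\<in>{z \<in> cball 0 R. V z = 0}. ln (R / norm a)))
        \<le> circ_int R (\<lambda>z. ln (norm (V z)))"
      by (rule jensen_inequality[OF V(1) R0 R(2) nzV V(2)])
    ultimately have "2 * pi * (ln (norm (V 0)) + (\<Sum>a\<in>{z \<in> cball 0 R. W z = 0} - {0}. ln (R / norm a)))
        \<le> circ_int R (\<lambda>z. ln (norm (W z))) + 2 * pi * (real k * ln 2)"
      unfolding Seq by linarith
    then show ?thesis by (simp add: field_simps)
  qed
  then show ?thesis using that by blast
qed

text \<open>
  The inequality \<open>R - \<bar>a\<bar> \<le> ln (R / \<bar>a\<bar>)\<close> turns Jensen's
  inequality into a bound for the sum of \<open>R - \<bar>a\<bar>\<close>. For a finite set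
  \<open>F\<close> of zeros, \<open>R\<close> can be taken so close to \<open>1\<close> that
  replacing \<open>R\<close> by \<open>1\<close> in this sum costs at most \<open>1\<close>.
\<close>

lemma blaschke_zeros:
  assumes W: "W holomorphic_on ball 0 1" "\<exists>z\<in>ball 0 1. W z \<noteq> 0" and nev: "nevanlinna W"
  shows "blaschke {z \<in> ball 0 1. W z = 0}"
proof -
  obtain C where C: "\<forall>r. 0 \<le> r \<and> r < 1 \<longrightarrow> circ_int r (\<lambda>z. ln (1 + norm (W z))) \<le> C"
    using nev unfolding nevanlinna_def by blast
  obtain B where B: "\<forall>R. 1 / 2 \<le> R \<and> R < 1 \<and> R \<notin> zero_radii W \<longrightarrow>
      (\<Sum>a\<in>{z \<in> cball 0 R. W z = 0} - {0}. ln (R / norm a)) \<le> B + circ_int R (\<lambda>z. ln (norm (W z))) / (2 * pi)"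
    by (rule jensen_with_zero_at_origin[OF W])
  define D where "D = \<bar>B + C / (2 * pi)\<bar>"
  have bound: "(\<Sum>a\<in>F. 1 - norm a) \<le> D + 2" if F: "F \<subseteq> {z \<in> ball 0 1. W z = 0}" "finite F" for F
  proof -
    \<comment> \<open>Beyond this radius all points of \<open>F\<close> are counted and \<open>card F * (1 - R)\<close> is at most \<open>1\<close>.\<close>
    define r where "r = Max (insert (1/2) (insert (1 - 1 / (real (card F) + 1)) (norm ` F)))"
    have r: "1 / 2 \<le> r" "1 - 1 / (real (card F) + 1) \<le> r" "\<And>a. a \<in> F \<Longrightarrow> norm a \<le> r"
      unfolding r_def using F(2) by (intro Max_ge; simp)+
    have "0 < 1 / (real (card F) + 1)" by (rule divide_pos_pos) auto
    then have "r < 1" unfolding r_def using F by (subst Max_less_iff) auto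
    then obtain R where R: "r < R" "R < 1" "R \<notin> zero_radii W"
      by (rule obtain_radius[OF countable_zero_radii[OF W(1)]])
    have R0: "1 / 2 \<le> R" "0 < R" using r(1) R(1) by auto
    have card: "real (card F) * (1 - R) \<le> 1"
    proof -
      have "1 - R \<le> 1 / (real (card F) + 1)" using r(2) R(1) by linarith
      then have "real (card F) * (1 - R) \<le> real (card F) * (1 / (real (card F) + 1))" by (intro mult_left_mono) auto
      also have "\<dots> \<le> 1" by simp
      finally show ?thesis .
    qed
    have nz: "W z \<noteq> 0" if "norm z = R" for z by (rule zero_radiiD[OF R(3,2) W(2) that])
    have "circ_int R (\<lambda>z. ln (norm (W z))) \<le> circ_int R (\<lambda>z. ln (1 + norm (W z)))"
    proof (rule circ_int_mono)
      show "continuous_on (sphere 0 R) (\<lambda>z. ln (norm (W z)))"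
        by (intro continuous_intros continuous_on_circle W(1) R) (use nz in auto)
      show "continuous_on (sphere 0 R) (\<lambda>z. ln (1 + norm (W z)))"
        by (intro continuous_ln_norm holomorphic_on_imp_continuous_on W(1) R)
      show "ln (norm (W z)) \<le> ln (1 + norm (W z))" if "norm z = R" for z
        using nz[OF that] by (intro ln_mono) auto
    qed (use R0 in simp)
    also have "\<dots> \<le> C" using C R R0 by simp
    finally have "circ_int R (\<lambda>z. ln (norm (W z))) / (2 * pi) \<le> C / (2 * pi)" by (intro divide_right_mono) auto
    moreover have "(\<Sum>a\<in>{z \<in> cball 0 R. W z = 0} - {0}. ln (R / norm a)) \<le> B + circ_int R (\<lambda>z. ln (norm (W z))) / (2 * pi)"
      using B R R0 by blast
    ultimately have S1: "(\<Sum>a\<in>{z \<in> cball 0 R. W z = 0} - {0}. ln (R / norm a)) \<le> D"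
      unfolding D_def by linarith
    have "(\<Sum>a\<in>F - {0}. R - norm a) \<le> (\<Sum>a\<in>F - {0}. ln (R / norm a))"
    proof (rule sum_mono)
      fix a assume a: "a \<in> F - {0}"
      then have a0: "0 < norm a" "norm a \<le> R" using r(3)[of a] R by auto
      have "ln (norm a / R) \<le> norm a / R - 1" using a0 R0 by (intro ln_le_minus_one) auto
      then have l: "1 - norm a / R \<le> ln (R / norm a)" using a0 R0 by (simp add: ln_div)
      have "R - norm a = R * (1 - norm a / R)" using R0 by (simp add: field_simps)
      also have "\<dots> \<le> 1 * (1 - norm a / R)" using a0 R R0 by (intro mult_right_mono) auto
      finally show "R - norm a \<le> ln (R / norm a)" using l by simp
    qed
    also have "\<dots> \<le> (\<Sum>a\<in>{z \<in> cball 0 R. W z = 0} - {0}. ln (R / norm a))"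
    proof (rule sum_mono2)
      show "finite ({z \<in> cball 0 R. W z = 0} - {0})" using finite_zeros_cball[OF W R(2)] by blast
      show "F - {0} \<subseteq> {z \<in> cball 0 R. W z = 0} - {0}" using F r(3) R by fastforce
      fix b assume "b \<in> {z \<in> cball 0 R. W z = 0} - {0} - (F - {0})"
      then show "0 \<le> ln (R / norm b)" using R0 by simp
    qed
    also have "\<dots> \<le> D" by (rule S1)
    finally have S2: "(\<Sum>a\<in>F - {0}. R - norm a) \<le> D" .
    have "(\<Sum>a\<in>F. 1 - norm a) \<le> 1 + (\<Sum>a\<in>F - {0}. 1 - norm a)"
    proof (cases "0 \<in> F")
      case True
      then show ?thesis using F(2) by (subst sum.remove[of F 0]) auto
    qed auto
    also have "(\<Sum>a\<in>F - {0}. 1 - norm a) = (\<Sum>a\<in>F - {0}. R - norm a) + real (card (F - {0})) * (1 - R)"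
      by (simp add: sum.distrib[symmetric] sum_subtractf algebra_simps)
    also have "real (card (F - {0})) * (1 - R) \<le> real (card F) * (1 - R)"
      using F(2) R by (intro mult_right_mono) (auto intro: card_mono)
    finally show ?thesis using S2 card by linarith
  qed
  show ?thesis unfolding blaschke_def
  proof (rule nonneg_bdd_above_summable_on)
    show "bdd_above (sum (\<lambda>z. 1 - norm z) ` {F. F \<subseteq> {z \<in> ball 0 1. W z = 0} \<and> finite F})"
      by (rule bdd_aboveI2[of _ _ "D + 2"]) (use bound in auto)
  qed auto
qed

text \<open>
  The sum over the zeros in \<open>jensen_with_zero_at_origin\<close> is nonnegative.
\<close>

lemma log_mean_lower_bound:
  assumes W: "W holomorphic_on ball 0 1" "\<exists>z\<in>ball 0 1. W z \<noteq> 0"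
  obtains B where "\<forall>R. 1 / 2 \<le> R \<and> R < 1 \<and> R \<notin> zero_radii W \<longrightarrow> - B \<le> circ_int R (\<lambda>z. ln (norm (W z)))"
proof -
  obtain B where B: "\<forall>R. 1 / 2 \<le> R \<and> R < 1 \<and> R \<notin> zero_radii W \<longrightarrow>
      (\<Sum>a\<in>{z \<in> cball 0 R. W z = 0} - {0}. ln (R / norm a)) \<le> B + circ_int R (\<lambda>z. ln (norm (W z))) / (2 * pi)"
    by (rule jensen_with_zero_at_origin[OF W])
  have "- (2 * pi * B) \<le> circ_int R (\<lambda>z. ln (norm (W z)))" if R: "1 / 2 \<le> R" "R < 1" "R \<notin> zero_radii W" for R
  proof -
    have "0 \<le> (\<Sum>a\<in>{z \<in> cball 0 R. W z = 0} - {0}. ln (R / norm a))"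
      by (rule sum_nonneg) (use R in auto)
    also have "\<dots> \<le> B + circ_int R (\<lambda>z. ln (norm (W z))) / (2 * pi)" using B R by blast
    finally show ?thesis by (simp add: field_simps)
  qed
  then show ?thesis using that[of "2 * pi * B"] by blast
qed

section \<open>The Fejer-Riesz inequality\<close>

text \<open>
  On the real axis \<open>\<bar>K\<bar>\<^sup>2\<close> coincides with the holomorphic function
  \<open>P(z) = K(z) cnj (K (cnj z))\<close>. The integral of \<open>P\<close> over a diameter
  is minus that over the upper half-circle, where \<open>\<bar>P(z)\<bar>\<close> is at most the
  arithmetic mean of \<open>\<bar>K(z)\<bar>\<^sup>2\<close> and \<open>\<bar>K(cnj
  z)\<bar>\<^sup>2\<close>.
\<close>

lemma fejer_riesz_axis:
  assumes K: "K holomorphic_on ball 0 S" and R: "0 < R" "R < S"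
  shows "integral {0..R} (\<lambda>x. norm (K (of_real x)) ^ 2)
     \<le> R / 2 * (integral {0..pi} (\<lambda>t. norm (K (of_real R * cis t)) ^ 2)
               + integral {0..pi} (\<lambda>t. norm (K (of_real R * cis (- t))) ^ 2))"
proof -
  define Kt where "Kt = (\<lambda>z. cnj (K (cnj z)))"
  have "(cnj \<circ> K \<circ> cnj) holomorphic_on ball 0 S"
  proof (rule holomorphic_on_compose_cnj_cnj)
    have "cnj ` ball 0 S \<subseteq> ball 0 S" by auto
    then show "K holomorphic_on cnj ` ball 0 S" by (rule holomorphic_on_subset[OF K])
  qed simp
  then have Kt: "Kt holomorphic_on ball 0 S" by (simp add: Kt_def o_def)
  define P where "P = (\<lambda>z. K z * Kt z)"
  have P: "P holomorphic_on ball 0 S" unfolding P_def by (intro holomorphic_intros K Kt)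
  obtain \<Phi> where \<Phi>0: "\<And>z. z \<in> ball 0 S \<Longrightarrow> (\<Phi> has_field_derivative P z) (at z within ball 0 S)"
    using holomorphic_convex_primitive'[OF convex_ball open_ball P] by blast
  have \<Phi>: "(\<Phi> has_field_derivative P z) (at z)" if "norm z < S" for z
    using \<Phi>0[of z] that by (simp add: at_within_open[of z "ball 0 S"])
  have cK: "continuous_on (ball 0 S) K" by (rule holomorphic_on_imp_continuous_on[OF K])
  have real_axis: "P (of_real x) = of_real (norm (K (of_real x)) ^ 2)" for x
    by (simp only: P_def Kt_def complex_cnj_complex_of_real complex_norm_square)
  have 1: "((\<lambda>x. P (of_real x)) has_integral (\<Phi> (of_real R) - \<Phi> (of_real (- R)))) {- R..R}"
  proof (rule fundamental_theorem_of_calculus)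
    fix x :: real assume x: "x \<in> {- R..R}"
    have "(\<Phi> has_field_derivative P (of_real x)) (at (of_real x))" by (rule \<Phi>) (use x R in auto)
    moreover have "((\<lambda>x. of_real x) has_vector_derivative (1::complex)) (at x within {- R..R})"
      by (auto intro!: derivative_eq_intros)
    ultimately show "((\<lambda>x. \<Phi> (of_real x)) has_vector_derivative P (of_real x)) (at x within {- R..R})"
      using field_vector_diff_chain_within[of "\<lambda>x. of_real x" 1 x "{- R..R}" \<Phi>]
      by (simp add: o_def has_field_derivative_at_within)
  qed (use R in simp)
  have 2: "((\<lambda>t. (\<i> * of_real R * cis t) * P (of_real R * cis t)) has_integral
      (\<Phi> (of_real R * cis pi) - \<Phi> (of_real R * cis 0))) {0..pi}"
  proof (rule fundamental_theorem_of_calculus)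
    fix t :: real
    have "(\<Phi> has_field_derivative P (of_real R * cis t)) (at (of_real R * cis t))"
      by (rule \<Phi>) (use R in \<open>auto simp: norm_mult\<close>)
    moreover have "((\<lambda>t. of_real R * cis t) has_vector_derivative (\<i> * of_real R * cis t)) (at t within {0..pi})"
      unfolding cis_conv_exp
      by (rule has_vector_derivative_at_within, auto intro!: derivative_eq_intros has_vector_derivative_real_field)
    ultimately show "((\<lambda>t. \<Phi> (of_real R * cis t)) has_vector_derivative (\<i> * of_real R * cis t) * P (of_real R * cis t))
        (at t within {0..pi})"
      using field_vector_diff_chain_within[of "\<lambda>t. of_real R * cis t" "\<i> * of_real R * cis t" t "{0..pi}" \<Phi>]
      by (simp add: o_def has_field_derivative_at_within)
  qed simp
  have ci: "(\<lambda>t. norm (K (of_real R * cis (a * t))) ^ 2) integrable_on {0..pi}" for a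
    by (intro integrable_continuous_real continuous_intros continuous_on_compose2[OF cK])
       (use R in \<open>auto intro!: continuous_intros simp: norm_mult\<close>)
  have cr: "(\<lambda>x. norm (K (of_real x)) ^ 2) integrable_on {a..b}" if "- R \<le> a" "b \<le> R" for a b
    by (intro integrable_continuous_real continuous_intros continuous_on_compose2[OF cK])
       (use R that in \<open>auto intro!: continuous_intros\<close>)
  have "integral {0..R} (\<lambda>x. norm (K (of_real x)) ^ 2) \<le> integral {- R..R} (\<lambda>x. norm (K (of_real x)) ^ 2)"
    by (intro integral_subset_le cr) (use R in auto)
  also have "\<dots> = norm (\<Phi> (of_real R) - \<Phi> (of_real (- R)))"
  proof -
    have "((\<lambda>x. complex_of_real (norm (K (of_real x)) ^ 2)) has_integral
        of_real (integral {- R..R} (\<lambda>x. norm (K (of_real x)) ^ 2))) {- R..R}"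
      by (rule has_integral_of_real[OF integrable_integral[OF cr]]) auto
    then have "\<Phi> (of_real R) - \<Phi> (of_real (- R)) = of_real (integral {- R..R} (\<lambda>x. norm (K (of_real x)) ^ 2))"
      using has_integral_unique[OF 1] unfolding real_axis by blast
    moreover have "0 \<le> integral {- R..R} (\<lambda>x. norm (K (of_real x)) ^ 2)"
      by (rule integral_nonneg[OF cr]) auto
    ultimately show ?thesis by (simp only: norm_of_real abs_of_nonneg)
  qed
  also have "\<dots> = norm (integral {0..pi} (\<lambda>t. (\<i> * of_real R * cis t) * P (of_real R * cis t)))"
    using integral_unique[OF 2] by (simp add: norm_minus_commute)
  also have "\<dots> \<le> integral {0..pi} (\<lambda>t. R / 2 * (norm (K (of_real R * cis (1 * t))) ^ 2 + norm (K (of_real R * cis (- 1 * t))) ^ 2))"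
  proof (rule integral_norm_bound_integral[OF has_integral_integrable[OF 2]])
    show "(\<lambda>t. R / 2 * (norm (K (of_real R * cis (1 * t))) ^ 2 + norm (K (of_real R * cis (- 1 * t))) ^ 2)) integrable_on {0..pi}"
      by (intro integrable_on_mult_right integrable_add ci)
    fix t :: real
    let ?a = "norm (K (of_real R * cis t))" and ?b = "norm (K (of_real R * cis (- t)))"
    have "norm (\<i> * of_real R * cis t * P (of_real R * cis t)) = R * (?a * ?b)"
      using R by (simp add: norm_mult P_def Kt_def cis_cnj)
    also have "?a * ?b \<le> (?a ^ 2 + ?b ^ 2) / 2"
      using sum_squares_bound[of ?a ?b] by simp
    finally show "norm (\<i> * of_real R * cis t * P (of_real R * cis t))
        \<le> R / 2 * (norm (K (of_real R * cis (1 * t))) ^ 2 + norm (K (of_real R * cis (- 1 * t))) ^ 2)"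
      using R by (simp add: mult_left_mono)
  qed
  also have "\<dots> = R / 2 * (integral {0..pi} (\<lambda>t. norm (K (of_real R * cis t)) ^ 2)
               + integral {0..pi} (\<lambda>t. norm (K (of_real R * cis (- t))) ^ 2))"
    using integral_add[OF ci[of 1] ci[of "-1"]] by simp
  finally show ?thesis .
qed

lemma fejer_riesz:
  assumes H: "H holomorphic_on ball 0 S" and R: "0 < R" "R < S" and \<beta>: "0 \<le> \<beta>" "\<beta> \<le> 2 * pi"
  shows "integral {0..R} (\<lambda>x. norm (H (of_real x * cis \<beta>)) ^ 2) \<le> R / 2 * circ_int R (\<lambda>z. norm (H z) ^ 2)"
proof -
  define v where "v = (\<lambda>t. norm (H (of_real R * cis t)) ^ 2)"
  have cH: "continuous_on (ball 0 S) H" by (rule holomorphic_on_imp_continuous_on[OF H])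
  have cv: "continuous_on A v" for A
    unfolding v_def by (intro continuous_intros continuous_on_compose2[OF cH])
       (use R in \<open>auto intro!: continuous_intros simp: norm_mult\<close>)
  have iv: "v integrable_on {a..b}" for a b by (intro integrable_continuous_real cv)
  have per: "v (t + 2 * pi) = v t" for t by (simp add: v_def cis.ctr)
  define K where "K = (\<lambda>z. H (cis \<beta> * z))"
  have K: "K holomorphic_on ball 0 S"
    unfolding K_def by (rule holomorphic_on_compose_gen[of _ _ H, unfolded o_def, OF _ H])
       (auto intro!: holomorphic_intros simp: norm_mult)
  have Kv: "norm (K (of_real R * cis t)) ^ 2 = v (\<beta> + t)" for t
    by (simp add: K_def v_def cis_mult[symmetric] mult_ac)
  have "integral {0..R} (\<lambda>x. norm (K (of_real x)) ^ 2)
     \<le> R / 2 * (integral {0..pi} (\<lambda>t. v (\<beta> + t)) + integral {0..pi} (\<lambda>t. v (\<beta> + - t)))"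
    using fejer_riesz_axis[OF K R] unfolding Kv .
  also have "integral {0..pi} (\<lambda>t. v (\<beta> + t)) = integral {\<beta>..\<beta> + pi} v"
    using integral_shift_Icc_real[of 0 pi v \<beta>] by (simp add: o_def add.commute)
  also have "integral {0..pi} (\<lambda>t. v (\<beta> + - t)) = integral {\<beta> + pi..\<beta> + 2 * pi} v"
  proof -
    have "integral {0..pi} (\<lambda>t. v (\<beta> + - t)) = integral {- pi..0} (\<lambda>t. v (\<beta> + t))"
      using Henstock_Kurzweil_Integration.integral_reflect_real[of 0 "- pi" "\<lambda>t. v (\<beta> + t)"] by simp
    also have "\<dots> = integral {- pi..0} (v \<circ> (+) (\<beta> + 2 * pi))"
      using per[of "\<beta> + _"] by (simp add: o_def add_ac)
    also have "\<dots> = integral {\<beta> + pi..\<beta> + 2 * pi} v"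
      unfolding integral_shift_Icc_real by (simp add: add_ac)
    finally show ?thesis .
  qed
  also have "integral {\<beta>..\<beta> + pi} v + integral {\<beta> + pi..\<beta> + 2 * pi} v = integral {\<beta>..\<beta> + 2 * pi} v"
    by (rule Henstock_Kurzweil_Integration.integral_combine) (use iv in auto)
  also have "\<dots> = integral {0..2 * pi} v"
    by (rule integral_periodic_shift[OF cv per \<beta>])
  finally show ?thesis by (simp add: K_def v_def circ_int_def mult.commute)
qed

text \<open>
  The majorant of \<open>\<bar>g\<bar>\<^bsup>p/2\<^esup>\<close> times a branch of \<open>(1 -
  cnj \<xi> z)\<^bsup>-s/2\<^esup>\<close> is holomorphic, so that the inequality for squares
  covers all powers and this weight.
\<close>

lemma fejer_riesz_weighted:
  assumes g: "g holomorphic_on ball 0 1" and R: "0 < R" "R < 1" "R \<notin> zero_radii g" and p: "0 < p"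
    and \<xi>: "norm \<xi> = 1" and \<beta>: "0 \<le> \<beta>" "\<beta> \<le> 2 * pi"
  shows "integral {0..R} (\<lambda>x. norm (g (of_real x * cis \<beta>)) powr p * norm (1 - cnj \<xi> * (of_real x * cis \<beta>)) powr (- s))
     \<le> R / 2 * circ_int R (\<lambda>w. norm (g w) powr p * norm (1 - cnj \<xi> * w) powr (- s))"
proof -
  have p2: "0 < p / 2" using p by simp
  obtain S \<psi> where \<psi>: "R < S" "S \<le> 1" "\<psi> holomorphic_on ball 0 S"
    "\<forall>z. norm z = R \<longrightarrow> norm (\<psi> z) = norm (g z) powr (p / 2)"
    "\<forall>z. norm z \<le> R \<longrightarrow> norm (g z) powr (p / 2) \<le> norm (\<psi> z)"
    by (rule power_majorant[OF g R p2])
  have lt1: "norm (cnj \<xi> * z) < 1" if "norm z < S" for z using that \<xi> \<psi>(2) by (simp add: norm_mult)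
  have pos: "0 < Re (1 - cnj \<xi> * z)" if "norm z < S" for z
    using lt1[OF that] complex_Re_le_cmod[of "cnj \<xi> * z"] by simp
  define H where "H = (\<lambda>z. \<psi> z * exp (of_real (- s / 2) * Ln (1 - cnj \<xi> * z)))"
  have H: "H holomorphic_on ball 0 S"
    unfolding H_def by (intro holomorphic_intros \<psi>(3))
       (use pos in \<open>auto simp: complex_nonpos_Reals_iff; force\<close>)
  have sq: "(norm (g z) powr (p / 2)) ^ 2 = norm (g z) powr p" for z
    by (simp add: power2_eq_square powr_add[symmetric])
  have nH: "norm (H z) ^ 2 = norm (\<psi> z) ^ 2 * norm (1 - cnj \<xi> * z) powr (- s)" if z: "norm z < S" for z
  proof -
    have nz: "1 - cnj \<xi> * z \<noteq> 0" using pos[OF z] by force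
    have "norm (exp (of_real (- s / 2) * Ln (1 - cnj \<xi> * z))) = norm (1 - cnj \<xi> * z) powr (- s / 2)"
      using nz by (simp add: powr_def Re_Ln)
    moreover have "(norm (1 - cnj \<xi> * z) powr (- s / 2)) ^ 2 = norm (1 - cnj \<xi> * z) powr (- s)"
      by (simp add: power2_eq_square powr_add[symmetric])
    ultimately show ?thesis by (simp add: H_def norm_mult power_mult_distrib)
  qed
  have inb: "norm (of_real x * cis \<beta>) = x" if "x \<in> {0..R}" for x using that by (simp add: norm_mult)
  have "integral {0..R} (\<lambda>x. norm (g (of_real x * cis \<beta>)) powr p * norm (1 - cnj \<xi> * (of_real x * cis \<beta>)) powr (- s))
     \<le> integral {0..R} (\<lambda>x. norm (H (of_real x * cis \<beta>)) ^ 2)"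
  proof (rule integral_le)
    have nz: "norm (1 - cnj \<xi> * (of_real x * cis \<beta>)) \<noteq> 0" if "x \<in> {0..R}" for x
    proof -
      have "0 < Re (1 - cnj \<xi> * (of_real x * cis \<beta>))" by (rule pos) (use inb[OF that] that \<psi>(1) in auto)
      then have "1 - cnj \<xi> * (of_real x * cis \<beta>) \<noteq> 0" by (metis less_irrefl zero_complex.simps(1))
      then show ?thesis by (simp only: norm_eq_zero not_False_eq_True)
    qed
    show "(\<lambda>x. norm (g (of_real x * cis \<beta>)) powr p * norm (1 - cnj \<xi> * (of_real x * cis \<beta>)) powr (- s)) integrable_on {0..R}"
    proof (intro integrable_continuous_real continuous_on_mult)
      show "continuous_on {0..R} (\<lambda>x. norm (g (of_real x * cis \<beta>)) powr p)"
        by (rule continuous_on_norm_powr[OF continuous_on_compose2[OF holomorphic_on_imp_continuous_on[OF g]] p])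
           (use inb R in \<open>auto intro!: continuous_intros\<close>)
      show "continuous_on {0..R} (\<lambda>x. norm (1 - cnj \<xi> * (of_real x * cis \<beta>)) powr (- s))"
        using nz by (intro continuous_intros) auto
    qed
    show "(\<lambda>x. norm (H (of_real x * cis \<beta>)) ^ 2) integrable_on {0..R}"
      by (intro integrable_continuous_real continuous_intros
            continuous_on_compose2[OF holomorphic_on_imp_continuous_on[OF H]])
         (use inb \<psi>(1) in \<open>auto intro!: continuous_intros\<close>)
    fix x assume x: "x \<in> {0..R}"
    let ?z = "of_real x * cis \<beta>"
    have "norm (g ?z) powr p \<le> norm (\<psi> ?z) ^ 2"
      unfolding sq[symmetric] using \<psi>(5) inb[OF x] x by (intro power_mono) auto
    then show "norm (g ?z) powr p * norm (1 - cnj \<xi> * ?z) powr (- s) \<le> norm (H ?z) ^ 2"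
      using nH[of ?z] inb[OF x] x \<psi>(1) by (simp add: mult_right_mono)
  qed
  also have "\<dots> \<le> R / 2 * circ_int R (\<lambda>z. norm (H z) ^ 2)"
    by (rule fejer_riesz[OF H R(1) \<psi>(1) \<beta>])
  also have "circ_int R (\<lambda>z. norm (H z) ^ 2) = circ_int R (\<lambda>w. norm (g w) powr p * norm (1 - cnj \<xi> * w) powr (- s))"
    by (rule circ_int_cong) (use nH \<psi>(1,4) R sq in auto)
  finally show ?thesis .
qed

section \<open>Hardy's inequality along radii\<close>

lemma radial_difference_le:
  assumes h: "h holomorphic_on ball 0 1" and ab: "0 \<le> a" "a \<le> b" "b < 1"
  shows "norm (h (of_real b * cis \<beta>) - h (of_real a * cis \<beta>))
      \<le> integral {a..b} (\<lambda>x. norm (deriv h (of_real x * cis \<beta>)))"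
proof -
  have inb: "of_real x * cis \<beta> \<in> ball 0 1" if "x \<in> {a..b}" for x using that ab by (simp add: norm_mult)
  have hi: "((\<lambda>x. cis \<beta> * deriv h (of_real x * cis \<beta>)) has_integral
      (h (of_real b * cis \<beta>) - h (of_real a * cis \<beta>))) {a..b}"
  proof (rule fundamental_theorem_of_calculus)
    fix x assume x: "x \<in> {a..b}"
    have "(h has_field_derivative deriv h (of_real x * cis \<beta>)) (at (of_real x * cis \<beta>))"
      by (rule holomorphic_derivI[OF h open_ball inb[OF x]])
    moreover have "((\<lambda>x. of_real x * cis \<beta>) has_vector_derivative cis \<beta>) (at x within {a..b})"
      by (auto intro!: derivative_eq_intros)
    ultimately show "((\<lambda>x. h (of_real x * cis \<beta>)) has_vector_derivative cis \<beta> * deriv h (of_real x * cis \<beta>)) (at x within {a..b})"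
      using field_vector_diff_chain_within[of "\<lambda>x. of_real x * cis \<beta>" "cis \<beta>" x "{a..b}" h]
      by (simp add: o_def has_field_derivative_at_within)
  qed (use ab in simp)
  show ?thesis unfolding integral_unique[OF hi, symmetric]
  proof (rule integral_norm_bound_integral[OF has_integral_integrable[OF hi]])
    show "(\<lambda>x. norm (deriv h (of_real x * cis \<beta>))) integrable_on {a..b}"
      by (intro integrable_continuous_real continuous_on_norm
           continuous_on_compose2[OF holomorphic_on_imp_continuous_on[OF holomorphic_deriv[OF h open_ball]]])
         (use inb in \<open>auto intro!: continuous_intros\<close>)
  qed (simp add: norm_mult)
qed

text \<open>
  Bound \<open>h\<close> by \<open>\<bar>h(0)\<bar>\<close> plus the integral of the derivative
  and integrate by parts. The weight of the derivative becomes \<open>V(y)\<close>, the integral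
  of \<open>(1 - x)\<^sup>j w(x)\<close> from \<open>y\<close> to \<open>R\<close>, and the
  growth condition on \<open>w\<close> gives \<open>V(y) \<le> 4 (1 - y)\<^bsup>j+1\<^esup>
  w(y)\<close>.
\<close>

lemma hardy_inequality_step:
  fixes w :: "real \<Rightarrow> real"
  assumes h: "h holomorphic_on ball 0 1" and R: "0 < R" "R < 1"
    and w: "continuous_on {0..R} w" "\<And>x. x \<in> {0..R} \<Longrightarrow> 0 \<le> w x" "w 0 = 1"
    and dbl: "\<And>x y. 0 \<le> y \<Longrightarrow> y \<le> x \<Longrightarrow> x \<le> R \<Longrightarrow> w x * sqrt (1 - x) \<le> 2 * (w y * sqrt (1 - y))"
  shows "integral {0..R} (\<lambda>x. norm (h (of_real x * cis \<beta>)) * (1 - x) ^ j * w x)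
     \<le> 4 * (norm (h 0) + integral {0..R} (\<lambda>x. norm (deriv h (of_real x * cis \<beta>)) * (1 - x) ^ Suc j * w x))"
proof -
  have inb: "norm (of_real x * cis \<beta>) < 1" if "x \<in> {0..R}" for x using that R by (simp add: norm_mult)
  have ch: "continuous_on {0..R} (\<lambda>x. h (of_real x * cis \<beta>))" "continuous_on {0..R} (\<lambda>x. deriv h (of_real x * cis \<beta>))"
    by (rule continuous_on_compose2[OF holomorphic_on_imp_continuous_on[OF h]]
             continuous_on_compose2[OF holomorphic_on_imp_continuous_on[OF holomorphic_deriv[OF h open_ball]]];
        use inb in \<open>auto intro!: continuous_intros\<close>)+
  define D where "D = (\<lambda>x. norm (deriv h (of_real x * cis \<beta>)))"
  define k where "k = (\<lambda>x. (1 - x) ^ j * w x)"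
  define \<Phi> where "\<Phi> = (\<lambda>x. norm (h 0) + integral {0..x} D)"
  define V where "V = (\<lambda>y. integral {y..R} k)"
  have cD: "continuous_on {0..R} D" unfolding D_def by (intro continuous_intros ch)
  have ck: "continuous_on {0..R} k" unfolding k_def by (intro continuous_intros w)
  have k0: "0 \<le> k x" if "x \<in> {0..R}" for x using w(2)[OF that] that R by (simp add: k_def)
  have d\<Phi>: "(\<Phi> has_real_derivative D x) (at x within {0..R})" if "x \<in> {0..R}" for x
    unfolding \<Phi>_def by (auto intro!: derivative_eq_intros integral_has_real_derivative[OF cD that])
  have dV: "(V has_real_derivative - k x) (at x within {0..R})" if "x \<in> {0..R}" for x
    unfolding V_def by (rule integral_has_real_derivative'[OF ck that])
  have c\<Phi>: "continuous_on {0..R} \<Phi>" by (rule DERIV_continuous_on[OF d\<Phi>])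
  have cV: "continuous_on {0..R} V" by (rule DERIV_continuous_on[OF dV])
  have "((\<lambda>x. D x * V x + \<Phi> x * (- k x)) has_integral (\<Phi> R * V R - \<Phi> 0 * V 0)) {0..R}"
  proof (rule fundamental_theorem_of_calculus)
    fix x assume x: "x \<in> {0..R}"
    show "((\<lambda>x. \<Phi> x * V x) has_vector_derivative (D x * V x + \<Phi> x * (- k x))) (at x within {0..R})"
      unfolding has_real_derivative_iff_has_vector_derivative[symmetric]
      using DERIV_mult[OF d\<Phi>[OF x] dV[OF x]] by (simp add: algebra_simps)
  qed (use R in simp)
  moreover have "V R = 0" "\<Phi> 0 = norm (h 0)" by (simp_all add: V_def \<Phi>_def)
  ultimately have "integral {0..R} (\<lambda>x. D x * V x - \<Phi> x * k x) = - (norm (h 0) * V 0)"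
    by (simp add: integral_unique)
  moreover have iDV: "(\<lambda>x. D x * V x) integrable_on {0..R}" and i\<Phi>k: "(\<lambda>x. \<Phi> x * k x) integrable_on {0..R}"
    by (intro integrable_continuous_real continuous_intros cD cV c\<Phi> ck)+
  ultimately have parts: "integral {0..R} (\<lambda>x. \<Phi> x * k x) = norm (h 0) * V 0 + integral {0..R} (\<lambda>x. D x * V x)"
    by (simp add: integral_diff)
  have Vle: "V y \<le> 4 * (1 - y) ^ Suc j * w y" if y: "y \<in> {0..R}" for y
  proof -
    have "((\<lambda>x. 1 / sqrt (1 - x)) has_integral (- 2 * sqrt (1 - R) - (- 2 * sqrt (1 - y)))) {y..R}"
    proof (rule fundamental_theorem_of_calculus)
      fix x assume "x \<in> {y..R}"
      then have x: "x < 1" using R by simp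
      have "((\<lambda>x. - 2 * sqrt (1 - x)) has_real_derivative (1 / sqrt (1 - x))) (at x)"
        using x by (auto intro!: derivative_eq_intros simp: divide_simps)
      then show "((\<lambda>x. - 2 * sqrt (1 - x)) has_vector_derivative (1 / sqrt (1 - x))) (at x within {y..R})"
        by (simp add: has_real_derivative_iff_has_vector_derivative has_vector_derivative_at_within)
    qed (use y in simp)
    then have s: "((\<lambda>x. (1 - y) ^ j * (2 * (w y * sqrt (1 - y))) * (1 / sqrt (1 - x))) has_integral
        (1 - y) ^ j * (2 * (w y * sqrt (1 - y))) * (- 2 * sqrt (1 - R) - (- 2 * sqrt (1 - y)))) {y..R}"
      by (rule has_integral_mult_right)
    have "V y \<le> (1 - y) ^ j * (2 * (w y * sqrt (1 - y))) * (- 2 * sqrt (1 - R) - (- 2 * sqrt (1 - y)))"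
      unfolding V_def
    proof (rule has_integral_le[OF integrable_integral s])
      show "k integrable_on {y..R}"
        by (intro integrable_continuous_real continuous_on_subset[OF ck]) (use y in auto)
      fix x assume x: "x \<in> {y..R}"
      have sx: "0 < sqrt (1 - x)" using x R by simp
      have "w x \<le> 2 * (w y * sqrt (1 - y)) * (1 / sqrt (1 - x))"
        using dbl[of y x] x y sx by (simp add: field_simps)
      moreover have "(1 - x) ^ j \<le> (1 - y) ^ j" using x R by (intro power_mono) auto
      ultimately have "k x \<le> (1 - y) ^ j * (2 * (w y * sqrt (1 - y)) * (1 / sqrt (1 - x)))"
        unfolding k_def using w(2)[of x] x y R by (intro mult_mono) auto
      then show "k x \<le> (1 - y) ^ j * (2 * (w y * sqrt (1 - y))) * (1 / sqrt (1 - x))" by (simp only: mult.assoc)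
    qed
    also have "\<dots> \<le> (1 - y) ^ j * (2 * (w y * sqrt (1 - y))) * (2 * sqrt (1 - y))"
      using y R w(2)[OF y] by (intro mult_left_mono) auto
    also have "\<dots> = 4 * (1 - y) ^ j * w y * (sqrt (1 - y) * sqrt (1 - y))" by simp
    also have "sqrt (1 - y) * sqrt (1 - y) = 1 - y" using y R by simp
    finally show ?thesis by (simp add: mult_ac)
  qed
  have hle: "norm (h (of_real x * cis \<beta>)) \<le> \<Phi> x" if x: "x \<in> {0..R}" for x
    using radial_difference_le[OF h, of 0 x \<beta>] x R norm_triangle_sub[of "h (of_real x * cis \<beta>)" "h 0"]
    unfolding \<Phi>_def D_def by simp
  have "integral {0..R} (\<lambda>x. norm (h (of_real x * cis \<beta>)) * (1 - x) ^ j * w x) \<le> integral {0..R} (\<lambda>x. \<Phi> x * k x)"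
  proof (rule integral_le[OF _ i\<Phi>k])
    show "(\<lambda>x. norm (h (of_real x * cis \<beta>)) * (1 - x) ^ j * w x) integrable_on {0..R}"
      by (intro integrable_continuous_real continuous_intros ch w)
    show "norm (h (of_real x * cis \<beta>)) * (1 - x) ^ j * w x \<le> \<Phi> x * k x" if "x \<in> {0..R}" for x
      using mult_right_mono[OF hle[OF that] k0[OF that]] by (simp add: k_def mult.assoc)
  qed
  also have "\<dots> = norm (h 0) * V 0 + integral {0..R} (\<lambda>x. D x * V x)" by (rule parts)
  also have "norm (h 0) * V 0 \<le> norm (h 0) * 4"
    using Vle[of 0] R w(3) by (intro mult_left_mono) auto
  also have "integral {0..R} (\<lambda>x. D x * V x) \<le> integral {0..R} (\<lambda>x. 4 * (D x * (1 - x) ^ Suc j * w x))"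
  proof (rule integral_le[OF iDV])
    show "(\<lambda>x. 4 * (D x * (1 - x) ^ Suc j * w x)) integrable_on {0..R}"
      by (intro integrable_continuous_real continuous_intros cD w)
    show "D x * V x \<le> 4 * (D x * (1 - x) ^ Suc j * w x)" if "x \<in> {0..R}" for x
      using mult_left_mono[OF Vle[OF that], of "D x"] by (simp add: D_def mult_ac)
  qed
  also have "\<dots> = 4 * integral {0..R} (\<lambda>x. D x * (1 - x) ^ Suc j * w x)" by simp
  finally show ?thesis unfolding D_def by (simp add: algebra_simps)
qed

text \<open>
  The last condition lets \<open>w\<close> increase at most like \<open>(1 -
  x)\<^bsup>-1/2\<^esup>\<close>, which is integrable up to \<open>1\<close>.
\<close>

definition hardy_weight :: "real \<Rightarrow> (real \<Rightarrow> real) \<Rightarrow> bool" where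
  "hardy_weight R w \<longleftrightarrow> continuous_on {0..R} w \<and> (\<forall>x\<in>{0..R}. 0 \<le> w x) \<and> w 0 = 1 \<and>
     (\<forall>x y. 0 \<le> y \<and> y \<le> x \<and> x \<le> R \<longrightarrow> w x * sqrt (1 - x) \<le> 2 * (w y * sqrt (1 - y)))"

text \<open>
  It matters that \<open>C\<close> does not depend on the radius, the direction or the weight.
\<close>

lemma hardy_inequality_iterated:
  assumes h: "h holomorphic_on ball 0 1"
  obtains C where "0 \<le> C" "\<forall>R w \<beta>. 0 < R \<and> R < 1 \<and> hardy_weight R w \<longrightarrow>
     integral {0..R} (\<lambda>x. norm (deriv h (of_real x * cis \<beta>)) * w x)
     \<le> C + C * integral {0..R} (\<lambda>x. norm ((deriv ^^ Suc k) h (of_real x * cis \<beta>)) * (1 - x) ^ k * w x)"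
proof -
  let ?Q = "\<lambda>R w. 0 < R \<and> R < 1 \<and> hardy_weight R w"
  have "\<exists>C\<ge>0. \<forall>R w \<beta>. ?Q R w \<longrightarrow> integral {0..R} (\<lambda>x. norm (deriv h (of_real x * cis \<beta>)) * w x)
     \<le> C + C * integral {0..R} (\<lambda>x. norm ((deriv ^^ Suc k) h (of_real x * cis \<beta>)) * (1 - x) ^ k * w x)"
  proof (induction k)
    case 0
    show ?case by (intro exI[of _ 1]) auto
  next
    case (Suc k)
    then obtain C where C: "0 \<le> C" "\<forall>R w \<beta>. ?Q R w \<longrightarrow> integral {0..R} (\<lambda>x. norm (deriv h (of_real x * cis \<beta>)) * w x)
     \<le> C + C * integral {0..R} (\<lambda>x. norm ((deriv ^^ Suc k) h (of_real x * cis \<beta>)) * (1 - x) ^ k * w x)" by blast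
    define c0 where "c0 = norm ((deriv ^^ Suc k) h 0)"
    define C' where "C' = C + C * 4 * (c0 + 1)"
    have c0: "0 \<le> c0" by (simp add: c0_def)
    have hol: "(deriv ^^ Suc k) h holomorphic_on ball 0 1" by (rule holomorphic_higher_deriv[OF h open_ball])
    show ?case
    proof (intro exI[of _ C'] conjI allI impI)
      show "0 \<le> C'" using C c0 by (simp add: C'_def)
      fix R w \<beta> assume Q: "?Q R w"
      let ?I = "integral {0..R} (\<lambda>x. norm ((deriv ^^ Suc k) h (of_real x * cis \<beta>)) * (1 - x) ^ k * w x)"
      let ?J = "integral {0..R} (\<lambda>x. norm (deriv ((deriv ^^ Suc k) h) (of_real x * cis \<beta>)) * (1 - x) ^ Suc k * w x)"
      have "?I \<le> 4 * (c0 + ?J)"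
        unfolding c0_def by (rule hardy_inequality_step[OF hol]) (use Q in \<open>auto simp: hardy_weight_def\<close>)
      moreover have J0: "0 \<le> ?J"
      proof (rule integral_nonneg)
        have inb: "norm (of_real x * cis \<beta>) < 1" if "x \<in> {0..R}" for x using that Q by (simp add: norm_mult)
        show "(\<lambda>x. norm (deriv ((deriv ^^ Suc k) h) (of_real x * cis \<beta>)) * (1 - x) ^ Suc k * w x) integrable_on {0..R}"
          by (intro integrable_continuous_real continuous_on_mult continuous_on_norm
               continuous_on_compose2[OF holomorphic_on_imp_continuous_on[OF holomorphic_deriv[OF hol open_ball]]])
             (use Q inb in \<open>auto simp: hardy_weight_def intro!: continuous_intros\<close>)
      qed (use Q in \<open>auto simp: hardy_weight_def\<close>)
      ultimately have "C + C * ?I \<le> C + C * (4 * (c0 + ?J))" using C by (intro add_left_mono mult_left_mono) auto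
      also have "\<dots> \<le> C' + C' * ?J"
      proof -
        have "C' + C' * ?J - (C + C * (4 * (c0 + ?J))) = C * 4 + (C + C * 4 * c0) * ?J"
          by (simp add: C'_def algebra_simps)
        moreover have "0 \<le> C * 4 + (C + C * 4 * c0) * ?J" using C c0 J0 by simp
        ultimately show ?thesis by linarith
      qed
      finally have "C + C * ?I \<le> C' + C' * ?J" .
      moreover have "integral {0..R} (\<lambda>x. norm (deriv h (of_real x * cis \<beta>)) * w x) \<le> C + C * ?I"
        using C(2) Q by blast
      ultimately have "integral {0..R} (\<lambda>x. norm (deriv h (of_real x * cis \<beta>)) * w x) \<le> C' + C' * ?J" by linarith
      then show "integral {0..R} (\<lambda>x. norm (deriv h (of_real x * cis \<beta>)) * w x)
         \<le> C' + C' * integral {0..R} (\<lambda>x. norm ((deriv ^^ Suc (Suc k)) h (of_real x * cis \<beta>)) * (1 - x) ^ Suc k * w x)"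
        by simp
    qed
  qed
  then show ?thesis using that by blast
qed

section \<open>Hoelder estimates towards points of the circle\<close>

text \<open>
  The constant in a Hoelder estimate at the boundary point \<open>cis t\<close> may depend on
  \<open>t\<close> through a function \<open>N\<close> whose integral is bounded uniformly in
  the radius \<open>R\<close>. The difference is taken with the value at \<open>R cis t\<close>,
  but estimated by the distance to \<open>cis t\<close>, which is larger for
  \<open>\<bar>z\<bar> \<le> R\<close>; no boundary values enter. The countable set
  \<open>X\<close> allows for the radii of circles through zeros of a derivative, on which
  powers of that derivative have no holomorphic majorant of equal modulus.
\<close>

definition circle_hoelder :: "(complex \<Rightarrow> complex) \<Rightarrow> bool" where
  "circle_hoelder u \<longleftrightarrow> (\<exists>C\<ge>0. \<exists>X. countable X \<and> (\<forall>z. norm z < 1 \<longrightarrow> norm (u z) \<le> C) \<and>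
     (\<forall>R. 0 < R \<and> R < 1 \<and> R \<notin> X \<longrightarrow>
       (\<exists>N. continuous_on {0..2 * pi} N \<and> (\<forall>t. 0 \<le> N t) \<and> integral {0..2 * pi} N \<le> C \<and>
          (\<forall>t\<in>{0..2 * pi}. \<forall>z. norm z \<le> R \<longrightarrow>
             norm (u z - u (of_real R * cis t)) \<le> C * norm (z - cis t) powr (1 / 4) * (1 + N t)))))"

lemma circle_hoelderE:
  assumes "circle_hoelder u"
  obtains C X N where "0 \<le> C" "countable X" "\<forall>z. norm z < 1 \<longrightarrow> norm (u z) \<le> C"
    "\<forall>R. 0 < R \<and> R < 1 \<and> R \<notin> X \<longrightarrow>
       continuous_on {0..2 * pi} (N R) \<and> (\<forall>t. 0 \<le> N R t) \<and> integral {0..2 * pi} (N R) \<le> C \<and>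
          (\<forall>t\<in>{0..2 * pi}. \<forall>z. norm z \<le> R \<longrightarrow>
             norm (u z - u (of_real R * cis t)) \<le> C * norm (z - cis t) powr (1 / 4) * (1 + N R t))"
  using assms unfolding circle_hoelder_def by metis

lemma circle_hoelder_const: "circle_hoelder (\<lambda>_. c)"
  unfolding circle_hoelder_def
  by (intro exI[of _ "norm c"] exI[of _ "{}"] conjI allI impI exI[of _ "\<lambda>_. 0"]) auto

text \<open>
  The common part of the closure of the class under sums and under products.
\<close>

lemma circle_hoelder_combine:
  assumes u: "circle_hoelder u" and v: "circle_hoelder v" and K: "0 \<le> K"
    and bd: "\<And>B z. (\<And>z. norm z < 1 \<Longrightarrow> norm (u z) \<le> B \<and> norm (v z) \<le> B) \<Longrightarrow> norm z < 1 \<Longrightarrow> norm (f z) \<le> K * (B + 1) ^ 2"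
    and df: "\<And>B z z'. (\<And>z. norm z < 1 \<Longrightarrow> norm (u z) \<le> B \<and> norm (v z) \<le> B) \<Longrightarrow> norm z < 1 \<Longrightarrow> norm z' < 1 \<Longrightarrow>
        norm (f z - f z') \<le> (B + 1) * (norm (u z - u z') + norm (v z - v z'))"
  shows "circle_hoelder f"
proof -
  obtain C X N where C: "0 \<le> C" "countable X" "\<forall>z. norm z < 1 \<longrightarrow> norm (u z) \<le> C"
    and N: "\<forall>R. 0 < R \<and> R < 1 \<and> R \<notin> X \<longrightarrow>
       continuous_on {0..2 * pi} (N R) \<and> (\<forall>t. 0 \<le> N R t) \<and> integral {0..2 * pi} (N R) \<le> C \<and>
          (\<forall>t\<in>{0..2 * pi}. \<forall>z. norm z \<le> R \<longrightarrow>
             norm (u z - u (of_real R * cis t)) \<le> C * norm (z - cis t) powr (1 / 4) * (1 + N R t))"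
    by (rule circle_hoelderE[OF u])
  obtain D Y M where D: "0 \<le> D" "countable Y" "\<forall>z. norm z < 1 \<longrightarrow> norm (v z) \<le> D"
    and M: "\<forall>R. 0 < R \<and> R < 1 \<and> R \<notin> Y \<longrightarrow>
       continuous_on {0..2 * pi} (M R) \<and> (\<forall>t. 0 \<le> M R t) \<and> integral {0..2 * pi} (M R) \<le> D \<and>
          (\<forall>t\<in>{0..2 * pi}. \<forall>z. norm z \<le> R \<longrightarrow>
             norm (v z - v (of_real R * cis t)) \<le> D * norm (z - cis t) powr (1 / 4) * (1 + M R t))"
    by (rule circle_hoelderE[OF v])
  define B where "B = C + D"
  have B: "norm (u z) \<le> B \<and> norm (v z) \<le> B" if "norm z < 1" for z
  proof -
    have "norm (u z) \<le> C" "norm (v z) \<le> D" using C(3) D(3) that by blast+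
    then show ?thesis using C(1) D(1) unfolding B_def by linarith
  qed
  have B0: "0 \<le> B" using C D by (simp add: B_def)
  define E where "E = (K + 2) * (B + 1) ^ 2"
  have E: "0 \<le> E" "K * (B + 1) ^ 2 \<le> E" "B \<le> E" "2 * (B + 1) * B \<le> E"
  proof -
    show "0 \<le> E" using K by (simp add: E_def)
    show "K * (B + 1) ^ 2 \<le> E" by (simp add: E_def algebra_simps)
    have *: "2 * (B + 1) ^ 2 \<le> E" using K by (simp add: E_def mult_right_mono)
    moreover have "2 * (B + 1) * B \<le> 2 * (B + 1) ^ 2" using B0 by (simp add: power2_eq_square algebra_simps)
    moreover have "B \<le> 2 * (B + 1) ^ 2" using B0 by (simp add: power2_eq_square algebra_simps add_increasing2)
    ultimately show "2 * (B + 1) * B \<le> E" "B \<le> E" by linarith+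
  qed
  show ?thesis unfolding circle_hoelder_def
  proof (intro exI[of _ E] conjI exI[of _ "X \<union> Y"] allI impI)
    show "0 \<le> E" by (rule E)
    show "countable (X \<union> Y)" using C D by simp
    show "norm (f z) \<le> E" if "norm z < 1" for z
      using bd[OF B that] E(2) by linarith
    fix R :: real assume R: "0 < R \<and> R < 1 \<and> R \<notin> X \<union> Y"
    then have NR: "continuous_on {0..2 * pi} (N R)" "\<And>t. 0 \<le> N R t" "integral {0..2 * pi} (N R) \<le> C"
      "\<And>t z. t \<in> {0..2 * pi} \<Longrightarrow> norm z \<le> R \<Longrightarrow>
             norm (u z - u (of_real R * cis t)) \<le> C * norm (z - cis t) powr (1 / 4) * (1 + N R t)"
      using N by blast+
    have MR: "continuous_on {0..2 * pi} (M R)" "\<And>t. 0 \<le> M R t" "integral {0..2 * pi} (M R) \<le> D"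
      "\<And>t z. t \<in> {0..2 * pi} \<Longrightarrow> norm z \<le> R \<Longrightarrow>
             norm (v z - v (of_real R * cis t)) \<le> D * norm (z - cis t) powr (1 / 4) * (1 + M R t)"
      using M R by blast+
    show "\<exists>N. continuous_on {0..2 * pi} N \<and> (\<forall>t. 0 \<le> N t) \<and> integral {0..2 * pi} N \<le> E \<and>
          (\<forall>t\<in>{0..2 * pi}. \<forall>z. norm z \<le> R \<longrightarrow>
             norm (f z - f (of_real R * cis t)) \<le> E * norm (z - cis t) powr (1 / 4) * (1 + N t))"
    proof (intro exI[of _ "\<lambda>t. N R t + M R t"] conjI ballI allI impI)
      show "continuous_on {0..2 * pi} (\<lambda>t. N R t + M R t)" by (intro continuous_intros NR MR)
      show "0 \<le> N R t + M R t" for t using NR(2) MR(2) by (simp add: add_nonneg_nonneg)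
      have "integral {0..2 * pi} (\<lambda>t. N R t + M R t) = integral {0..2 * pi} (N R) + integral {0..2 * pi} (M R)"
        by (intro integral_add integrable_continuous_real NR MR)
      then show "integral {0..2 * pi} (\<lambda>t. N R t + M R t) \<le> E" using NR(3) MR(3) E(3) by (simp add: B_def)
      fix t :: real and z :: complex assume t: "t \<in> {0..2 * pi}" and z: "norm z \<le> R"
      let ?\<zeta> = "of_real R * cis t" and ?d = "norm (z - cis t) powr (1 / 4)"
      have "norm (f z - f ?\<zeta>) \<le> (B + 1) * (norm (u z - u ?\<zeta>) + norm (v z - v ?\<zeta>))"
        by (rule df[OF B]) (use z R in \<open>auto simp: norm_mult\<close>)
      also have "\<dots> \<le> (B + 1) * (C * ?d * (1 + N R t) + D * ?d * (1 + M R t))"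
        using NR(4)[OF t z] MR(4)[OF t z] B0 by (intro mult_left_mono add_mono) auto
      also have "\<dots> \<le> (B + 1) * (B * ?d * (1 + (N R t + M R t)) + B * ?d * (1 + (N R t + M R t)))"
        using NR(2)[of t] MR(2)[of t] B0 C D
        by (intro mult_left_mono add_mono mult_mono) (auto simp: B_def)
      also have "\<dots> = (2 * (B + 1) * B) * (?d * (1 + (N R t + M R t)))" by (simp only: algebra_simps)
      also have "\<dots> \<le> E * (?d * (1 + (N R t + M R t)))"
        using E(4) NR(2)[of t] MR(2)[of t] by (intro mult_right_mono) auto
      finally show "norm (f z - f ?\<zeta>) \<le> E * ?d * (1 + (N R t + M R t))" by (simp only: mult.assoc)
    qed
  qed
qed

lemma circle_hoelder_add:
  assumes "circle_hoelder u" "circle_hoelder v"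
  shows "circle_hoelder (\<lambda>z. u z + v z)"
proof (rule circle_hoelder_combine[OF assms, of 2])
  fix B and z :: complex
  assume B: "\<And>z. norm z < 1 \<Longrightarrow> norm (u z) \<le> B \<and> norm (v z) \<le> B" and z: "norm z < 1"
  have "0 \<le> B" by (rule order_trans[OF norm_ge_zero[of "u 0"]]) (use B[of 0] in simp)
  have "norm (u z + v z) \<le> 2 * B" using B[OF z] norm_triangle_ineq[of "u z" "v z"] by linarith
  also have "\<dots> \<le> 2 * (B + 1) ^ 2" using \<open>0 \<le> B\<close> by (simp add: power2_eq_square algebra_simps)
  finally show "norm (u z + v z) \<le> 2 * (B + 1) ^ 2" .
next
  fix B and z z' :: complex
  assume B: "\<And>z. norm z < 1 \<Longrightarrow> norm (u z) \<le> B \<and> norm (v z) \<le> B"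
  have B0: "0 \<le> B" by (rule order_trans[OF norm_ge_zero[of "u 0"]]) (use B[of 0] in simp)
  have "norm (u z + v z - (u z' + v z')) \<le> 1 * (norm (u z - u z') + norm (v z - v z'))"
    using norm_triangle_ineq[of "u z - u z'" "v z - v z'"] by (simp add: algebra_simps)
  also have "\<dots> \<le> (B + 1) * (norm (u z - u z') + norm (v z - v z'))" using B0 by (intro mult_right_mono) auto
  finally show "norm (u z + v z - (u z' + v z')) \<le> (B + 1) * (norm (u z - u z') + norm (v z - v z'))" .
qed simp

lemma circle_hoelder_mult:
  assumes "circle_hoelder u" "circle_hoelder v"
  shows "circle_hoelder (\<lambda>z. u z * v z)"
proof (rule circle_hoelder_combine[OF assms, of 1])
  fix B and z :: complex
  assume B: "\<And>z. norm z < 1 \<Longrightarrow> norm (u z) \<le> B \<and> norm (v z) \<le> B" and z: "norm z < 1"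
  have "0 \<le> B" by (rule order_trans[OF norm_ge_zero[of "u 0"]]) (use B[of 0] in simp)
  have "norm (u z * v z) \<le> B * B" unfolding norm_mult using B[OF z] \<open>0 \<le> B\<close> by (intro mult_mono) auto
  also have "\<dots> \<le> 1 * (B + 1) ^ 2" using \<open>0 \<le> B\<close> by (simp add: power2_eq_square algebra_simps)
  finally show "norm (u z * v z) \<le> 1 * (B + 1) ^ 2" .
next
  fix B and z z' :: complex
  assume B: "\<And>z. norm z < 1 \<Longrightarrow> norm (u z) \<le> B \<and> norm (v z) \<le> B" and z: "norm z < 1" "norm z' < 1"
  have "u z * v z - u z' * v z' = u z * (v z - v z') + v z' * (u z - u z')" by (simp add: algebra_simps)
  then have "norm (u z * v z - u z' * v z') \<le> norm (u z) * norm (v z - v z') + norm (v z') * norm (u z - u z')"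
    by (metis norm_mult norm_triangle_ineq)
  also have "\<dots> \<le> (B + 1) * norm (v z - v z') + (B + 1) * norm (u z - u z')"
    using B[OF z(1)] B[OF z(2)] by (intro add_mono mult_right_mono) auto
  finally show "norm (u z * v z - u z' * v z') \<le> (B + 1) * (norm (u z - u z') + norm (v z - v z'))"
    by (simp add: algebra_simps)
qed simp

lemma circle_hoelder_sum:
  assumes "finite I" "\<And>i. i \<in> I \<Longrightarrow> circle_hoelder (u i)"
  shows "circle_hoelder (\<lambda>z. \<Sum>i\<in>I. u i z)"
  using assms by (induction I rule: finite_induct) (auto intro: circle_hoelder_add circle_hoelder_const)

lemma circle_hoelder_prod:
  assumes "finite I" "\<And>i. i \<in> I \<Longrightarrow> circle_hoelder (u i)"
  shows "circle_hoelder (\<lambda>z. \<Prod>i\<in>I. u i z)"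
  using assms by (induction I rule: finite_induct) (auto intro: circle_hoelder_mult circle_hoelder_const)

text \<open>
  With \<open>X\<close> and \<open>Y\<close> the distances of \<open>\<xi>\<close> to the points
  at radius \<open>x\<close> and \<open>y\<close>, the claim is, after squaring, \<open>(1 - x)
  Y \<le> 4 (1 - y) X\<close>. It follows from \<open>Y \<le> X + (x - y)\<close>, \<open>1 - x
  \<le> X\<close> and \<open>x - y \<le> 1 - y\<close>.
\<close>

lemma unit_weight_doubling:
  fixes x y :: real
  assumes "0 \<le> y" "y \<le> x" "x < 1" "norm \<xi> = 1"
  shows "norm (1 - cnj \<xi> * (of_real x * cis \<beta>)) powr (- (1 / 2)) * sqrt (1 - x)
     \<le> 2 * (norm (1 - cnj \<xi> * (of_real y * cis \<beta>)) powr (- (1 / 2)) * sqrt (1 - y))"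
proof -
  let ?X = "norm (1 - cnj \<xi> * (of_real x * cis \<beta>))" and ?Y = "norm (1 - cnj \<xi> * (of_real y * cis \<beta>))"
  have X: "1 - x \<le> ?X"
    using norm_triangle_ineq2[of 1 "cnj \<xi> * (of_real x * cis \<beta>)"] assms by (simp add: norm_mult)
  have Y: "1 - y \<le> ?Y"
    using norm_triangle_ineq2[of 1 "cnj \<xi> * (of_real y * cis \<beta>)"] assms by (simp add: norm_mult)
  have "?Y \<le> ?X + norm (cnj \<xi> * (of_real (x - y) * cis \<beta>))"
    using norm_triangle_ineq[of "1 - cnj \<xi> * (of_real x * cis \<beta>)" "cnj \<xi> * (of_real (x - y) * cis \<beta>)"]
    by (simp add: algebra_simps)
  also have "norm (cnj \<xi> * (of_real (x - y) * cis \<beta>)) = x - y"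
    using assms by (simp only: norm_mult complex_mod_cnj norm_of_real norm_cis) simp
  finally have YX: "?Y \<le> ?X + (x - y)" .
  have "(1 - x) * ?Y \<le> (1 - x) * (?X + (x - y))" using YX assms by (intro mult_left_mono) auto
  also have "\<dots> = (1 - x) * ?X + (1 - x) * (x - y)" by (simp add: algebra_simps)
  also have "\<dots> \<le> (1 - y) * ?X + ?X * (1 - y)"
    using assms X by (intro add_mono mult_right_mono mult_mono) auto
  finally have "(1 - x) * ?Y \<le> 2 * ((1 - y) * ?X)" by (simp add: algebra_simps)
  moreover have "0 \<le> (1 - y) * ?X" using assms by simp
  ultimately have main: "(1 - x) * ?Y \<le> 4 * ((1 - y) * ?X)" by linarith
  have pos: "0 < ?X" "0 < ?Y" using X Y assms by linarith+
  have "(1 - x) / ?X \<le> 4 * ((1 - y) / ?Y)" using main pos by (simp add: field_simps)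
  then have "sqrt ((1 - x) / ?X) \<le> sqrt (4 * ((1 - y) / ?Y))" by simp
  then have "sqrt (1 - x) / sqrt ?X \<le> 2 * (sqrt (1 - y) / sqrt ?Y)"
    by (simp only: real_sqrt_mult real_sqrt_divide real_sqrt_four)
  then show ?thesis using pos by (simp add: powr_minus_divide powr_half_sqrt mult.commute)
qed

lemma deriv_bound_of_bounded:
  assumes h: "h holomorphic_on ball 0 1" and B: "\<And>z. norm z < 1 \<Longrightarrow> norm (h z) \<le> B" and z: "norm z < 1"
  shows "norm (deriv h z) \<le> 2 * B / (1 - norm z)"
proof -
  define r where "r = (1 - norm z) / 2"
  have r: "0 < r" using z by (simp add: r_def)
  have sub: "norm w < 1" if "norm (z - w) \<le> r" for w
  proof -
    have "norm w \<le> norm z + norm (z - w)" by (metis norm_minus_commute norm_triangle_sub)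
    then show ?thesis using that z unfolding r_def by (simp add: field_simps)
  qed
  have "norm ((deriv ^^ 1) h z) \<le> fact 1 * B / r ^ 1"
  proof (rule Cauchy_inequality)
    show "h holomorphic_on ball z r"
      by (rule holomorphic_on_subset[OF h]) (use sub in \<open>auto simp: dist_norm\<close>)
    show "continuous_on (cball z r) h"
      by (rule continuous_on_subset[OF holomorphic_on_imp_continuous_on[OF h]]) (use sub in \<open>auto simp: dist_norm\<close>)
  qed (use r B sub in auto)
  then show ?thesis using z by (simp add: r_def field_simps)
qed

lemma cis_polar:
  obtains \<beta> where "0 \<le> \<beta>" "\<beta> \<le> 2 * pi" "z = of_real (norm z) * cis \<beta>"
proof (rule that[of "Arg2pi z"])
  show "z = of_real (norm z) * cis (Arg2pi z)"
    using Arg2pi[of z] by (simp add: is_Arg_def cis_conv_exp)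
qed (use Arg2pi[of z] in auto)

text \<open>
  The exponent \<open>q = 1 / (k + 1)\<close> is the critical one: writing \<open>\<bar>g\<bar>
  = \<bar>g\<bar>\<^sup>q (\<bar>g\<bar>\<^sup>q)\<^sup>k\<close> for the derivative
  \<open>g\<close> of order \<open>k + 1\<close> and using \<open>\<bar>g\<bar>\<^sup>q \<le> G
  / (1 - \<bar>z\<bar>)\<close> in the second factor, the power of \<open>1 -
  \<bar>z\<bar>\<close> that Hardy's inequality provides cancels exactly, and Fejer-Riesz
  applies to \<open>\<bar>g\<bar>\<^sup>q\<close>. The value \<open>s = 0\<close> serves to
  bound \<open>h\<close>, the value \<open>s = 1 / 2\<close> to estimate its oscillation.
\<close>

lemma hardy_weighted_radial_integral:
  assumes h: "h holomorphic_on ball 0 1" and g: "(deriv ^^ Suc k) h \<in> hardy q" and q: "q * real (Suc k) = 1"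
  obtains C where "0 \<le> C" "\<forall>R s \<xi> \<beta>. 0 < R \<and> R < 1 \<and> R \<notin> zero_radii ((deriv ^^ Suc k) h) \<and> (s = 0 \<or> s = 1 / 2) \<and> norm \<xi> = 1
      \<and> 0 \<le> \<beta> \<and> \<beta> \<le> 2 * pi \<longrightarrow>
     integral {0..R} (\<lambda>x. norm (deriv h (of_real x * cis \<beta>)) * norm (1 - cnj \<xi> * (of_real x * cis \<beta>)) powr (- s))
     \<le> C * (1 + circ_int R (\<lambda>w. norm ((deriv ^^ Suc k) h w) powr q * norm (1 - cnj \<xi> * w) powr (- s)))"
proof -
  define g where "g = (deriv ^^ Suc k) h"
  have "q = 1 / real (Suc k)" using q by (simp add: field_simps del: of_nat_Suc)
  then have q0: "0 < q" by simp
  have ghol: "g holomorphic_on ball 0 1" unfolding g_def by (rule holomorphic_higher_deriv[OF h open_ball])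
  obtain G where G: "0 \<le> G" "\<forall>z. norm z < 1 \<longrightarrow> norm (g z) powr q \<le> G / (1 - norm z)"
    by (rule hardy_growth[OF g[folded g_def] q0])
  obtain C where C: "0 \<le> C" and Cle: "\<forall>R w \<beta>. 0 < R \<and> R < 1 \<and> hardy_weight R w \<longrightarrow>
     integral {0..R} (\<lambda>x. norm (deriv h (of_real x * cis \<beta>)) * w x)
     \<le> C + C * integral {0..R} (\<lambda>x. norm (g (of_real x * cis \<beta>)) * (1 - x) ^ k * w x)"
    unfolding g_def by (rule hardy_inequality_iterated[OF h])
  have gpow: "norm (g z) * (1 - norm z) ^ k \<le> G ^ k * norm (g z) powr q" if z: "norm z < 1" for z
  proof -
    let ?a = "norm (g z) powr q"
    have "norm (g z) = ?a ^ Suc k"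
      using q by (cases "g z = 0") (simp_all add: powr_realpow'[symmetric] powr_powr del: power_Suc)
    then have "norm (g z) * (1 - norm z) ^ k = ?a * (?a * (1 - norm z)) ^ k" by (simp add: power_mult_distrib)
    also have "\<dots> \<le> ?a * G ^ k"
    proof (intro mult_left_mono power_mono)
      show "?a * (1 - norm z) \<le> G" using G(2) z by (simp add: pos_le_divide_eq)
    qed (use z in auto)
    finally show ?thesis by (simp add: mult.commute)
  qed
  have main: "integral {0..R} (\<lambda>x. norm (deriv h (of_real x * cis \<beta>)) * norm (1 - cnj \<xi> * (of_real x * cis \<beta>)) powr (- s))
     \<le> (C + C * G ^ k) * (1 + circ_int R (\<lambda>w. norm (g w) powr q * norm (1 - cnj \<xi> * w) powr (- s)))"
    if R: "0 < R" "R < 1" "R \<notin> zero_radii g" and s: "s = 0 \<or> s = 1 / 2" and \<xi>: "norm \<xi> = 1" and \<beta>: "0 \<le> \<beta>" "\<beta> \<le> 2 * pi"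
    for R s \<xi> \<beta>
  proof -
    define w where "w = (\<lambda>x. norm (1 - cnj \<xi> * (of_real x * cis \<beta>)) powr (- s))"
    let ?M = "circ_int R (\<lambda>w. norm (g w) powr q * norm (1 - cnj \<xi> * w) powr (- s))"
    have lt: "norm (cnj \<xi> * z) < 1" if "norm z < 1" for z using that \<xi> by (simp add: norm_mult)
    have nz: "norm (1 - cnj \<xi> * z) \<noteq> 0" if "norm z < 1" for z
    proof
      assume "norm (1 - cnj \<xi> * z) = 0"
      then have "cnj \<xi> * z = 1" by simp
      then show False using lt[OF that] by simp
    qed
    have inb: "norm (of_real x * cis \<beta>) = x" if "x \<in> {0..R}" for x using that by (simp add: norm_mult)
    have inb1: "norm (of_real x * cis \<beta>) < 1" if "x \<in> {0..R}" for x using inb[OF that] that R by simp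
    have cw: "continuous_on {0..R} w"
      unfolding w_def using nz[OF inb1] by (intro continuous_intros) auto
    have dbl: "w x * sqrt (1 - x) \<le> 2 * (w y * sqrt (1 - y))" if "0 \<le> y" "y \<le> x" "x \<le> R" for x y
    proof (cases "s = 0")
      case True
      have wxy: "w x = 1" "w y = 1" using nz[OF inb1, of x] nz[OF inb1, of y] that True unfolding w_def by auto
      have "sqrt (1 - x) \<le> sqrt (1 - y)" using that by simp
      moreover have "0 \<le> sqrt (1 - y)" using that R by simp
      ultimately have "sqrt (1 - x) \<le> 2 * sqrt (1 - y)" by linarith
      then show ?thesis by (simp only: wxy mult_1)
    next
      case False
      then have s2: "s = 1 / 2" using s by simp
      show ?thesis unfolding w_def s2 by (rule unit_weight_doubling) (use that R \<xi> in auto)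
    qed
    have w0: "w 0 = 1" by (simp add: w_def)
    have hw: "hardy_weight R w"
      unfolding hardy_weight_def using cw dbl w0 by (auto simp: w_def)
    have M0: "0 \<le> ?M"
    proof (rule circ_int_nonneg)
      have "norm (1 - cnj \<xi> * z) \<noteq> 0" if "z \<in> sphere 0 R" for z using that R by (intro nz) auto
      then have "continuous_on (sphere 0 R) (\<lambda>w. norm (1 - cnj \<xi> * w) powr (- s))"
        by (intro continuous_intros) auto
      then show "continuous_on (sphere 0 R) (\<lambda>w. norm (g w) powr q * norm (1 - cnj \<xi> * w) powr (- s))"
        by (rule continuous_on_mult[OF continuous_on_norm_powr[OF continuous_on_circle[OF ghol R(2)] q0]])
    qed (use R in auto)
    have "integral {0..R} (\<lambda>x. norm (deriv h (of_real x * cis \<beta>)) * w x)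
       \<le> C + C * integral {0..R} (\<lambda>x. norm (g (of_real x * cis \<beta>)) * (1 - x) ^ k * w x)"
      using Cle R hw by blast
    also have "integral {0..R} (\<lambda>x. norm (g (of_real x * cis \<beta>)) * (1 - x) ^ k * w x)
        \<le> integral {0..R} (\<lambda>x. G ^ k * (norm (g (of_real x * cis \<beta>)) powr q * w x))"
    proof (rule integral_le)
      have cg: "continuous_on {0..R} (\<lambda>x. g (of_real x * cis \<beta>))"
        by (rule continuous_on_compose2[OF holomorphic_on_imp_continuous_on[OF ghol]])
           (use inb1 in \<open>auto intro!: continuous_intros\<close>)
      show "(\<lambda>x. norm (g (of_real x * cis \<beta>)) * (1 - x) ^ k * w x) integrable_on {0..R}"
        by (intro integrable_continuous_real continuous_intros cg cw)
      show "(\<lambda>x. G ^ k * (norm (g (of_real x * cis \<beta>)) powr q * w x)) integrable_on {0..R}"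
        by (intro integrable_continuous_real continuous_on_mult continuous_on_const continuous_on_norm_powr cg cw q0)
      fix x assume x: "x \<in> {0..R}"
      have "norm (g (of_real x * cis \<beta>)) * (1 - x) ^ k \<le> G ^ k * norm (g (of_real x * cis \<beta>)) powr q"
        using gpow[OF inb1[OF x]] unfolding inb[OF x] .
      then show "norm (g (of_real x * cis \<beta>)) * (1 - x) ^ k * w x \<le> G ^ k * (norm (g (of_real x * cis \<beta>)) powr q * w x)"
        by (simp add: mult.assoc[symmetric] mult_right_mono w_def)
    qed
    also have "\<dots> = G ^ k * integral {0..R} (\<lambda>x. norm (g (of_real x * cis \<beta>)) powr q * w x)" by simp
    also have "integral {0..R} (\<lambda>x. norm (g (of_real x * cis \<beta>)) powr q * w x) \<le> R / 2 * ?M"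
      unfolding w_def by (rule fejer_riesz_weighted[OF ghol R q0 \<xi> \<beta>])
    also have "R / 2 * ?M \<le> 1 * ?M"
    proof (rule mult_right_mono)
      show "0 \<le> ?M" by (rule M0)
    qed (use R in simp)
    finally have le: "integral {0..R} (\<lambda>x. norm (deriv h (of_real x * cis \<beta>)) * w x) \<le> C + C * (G ^ k * (1 * ?M))"
      using C G by (simp add: mult_left_mono)
    have "C + C * (G ^ k * (1 * ?M)) \<le> (C + C * G ^ k) * (1 + ?M)"
    proof -
      have "(C + C * G ^ k) * (1 + ?M) - (C + C * (G ^ k * (1 * ?M))) = C * ?M + C * G ^ k" by (simp add: algebra_simps)
      moreover have "0 \<le> C * ?M + C * G ^ k" using C G M0 by simp
      ultimately show ?thesis by linarith
    qed
    then show ?thesis using le unfolding w_def by linarith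
  qed
  show ?thesis
    by (rule that[of "C + C * G ^ k"]) (use C G main in \<open>auto simp: g_def\<close>)
qed

text \<open>
  Let \<open>d\<close> be the distance of \<open>z\<close> and \<open>cis t\<close> and
  \<open>\<delta>\<close> its square root. Connect \<open>z\<close> and \<open>R cis t\<close>
  by radial segments to the circle of radius \<open>1 - \<delta>\<close> and a chord of the
  latter. On the radial segments the distance to \<open>cis t\<close> is at most \<open>2
  \<delta>\<close>, so the weighted integral bounds the oscillation by
  \<open>\<delta>\<^bsup>1/2\<^esup> = d\<^bsup>1/4\<^esup>\<close> times a constant and
  \<open>1 + N(t)\<close>, whatever the direction of \<open>z\<close>. On the chord the
  derivative of the bounded function \<open>h\<close> is of order \<open>1 / \<delta>\<close>
  and the length is of order \<open>d = \<delta>\<^sup>2\<close>. This is for \<open>d <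
  1\<close>; otherwise boundedness of \<open>h\<close> suffices.
\<close>

lemma hardy_circle_hoelder:
  assumes h: "h holomorphic_on ball 0 1" and hp: "(deriv ^^ k) h \<in> hardy p" and kp: "0 < p" "1 \<le> real k * p"
  shows "circle_hoelder h"
proof -
  obtain k' where k': "k = Suc k'" using kp by (cases k) auto
  \<comment> \<open>The critical exponent; \<open>H\<^sup>p\<close> is contained in the Hardy space with this exponent because \<open>k p \<ge> 1\<close>.\<close>
  define q where "q = 1 / real k"
  have q: "0 < q" "q \<le> p" "q * real (Suc k') = 1" using kp k' by (auto simp: q_def field_simps)
  define g where "g = (deriv ^^ Suc k') h"
  have gq: "g \<in> hardy q" unfolding g_def using hardy_antimono[OF hp q(1,2)] k' by simp
  obtain A where ghol: "g holomorphic_on ball 0 1"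
    and A: "0 \<le> A" "\<forall>r. 0 \<le> r \<and> r < 1 \<longrightarrow> circ_int r (\<lambda>z. norm (g z) powr q) \<le> A"
    using gq unfolding hardy_circ_int by blast
  obtain C where C: "0 \<le> C" and Cl: "\<forall>R s \<xi> \<beta>. 0 < R \<and> R < 1 \<and> R \<notin> zero_radii g \<and> (s = 0 \<or> s = 1 / 2) \<and> norm \<xi> = 1
      \<and> 0 \<le> \<beta> \<and> \<beta> \<le> 2 * pi \<longrightarrow>
     integral {0..R} (\<lambda>x. norm (deriv h (of_real x * cis \<beta>)) * norm (1 - cnj \<xi> * (of_real x * cis \<beta>)) powr (- s))
     \<le> C * (1 + circ_int R (\<lambda>w. norm (g w) powr q * norm (1 - cnj \<xi> * w) powr (- s)))"
    unfolding g_def by (rule hardy_weighted_radial_integral[OF h gq[unfolded g_def] q(3)])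
  have cdh: "continuous_on (ball 0 1) (deriv h)"
    by (intro holomorphic_on_imp_continuous_on holomorphic_deriv h) simp
  have inb: "norm (of_real x * cis \<beta>) = x" if "0 \<le> x" for x \<beta> using that by (simp add: norm_mult)
  have nz: "norm (1 - cnj \<xi> * z) \<noteq> 0" if "norm z < 1" "norm \<xi> = 1" for z \<xi>
  proof
    assume "norm (1 - cnj \<xi> * z) = 0"
    then have "norm (cnj \<xi> * z) = 1" by simp
    then show False using that by (simp add: norm_mult)
  qed
  define B where "B = norm (h 0) + C * (1 + A)"
  have hB: "norm (h z) \<le> B" if z: "norm z < 1" for z
  proof -
    obtain \<beta> where \<beta>: "0 \<le> \<beta>" "\<beta> \<le> 2 * pi" "z = of_real (norm z) * cis \<beta>" by (rule cis_polar)
    obtain R where R: "norm z < R" "R < 1" "R \<notin> zero_radii g"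
      by (rule obtain_radius[OF countable_zero_radii[OF ghol] z])
    have R0: "0 < R" using R(1) norm_ge_zero[of z] by linarith
    have cc: "continuous_on {0..R} (\<lambda>x. norm (deriv h (of_real x * cis \<beta>)))"
      by (intro continuous_on_norm continuous_on_compose2[OF cdh]) (use inb R in \<open>auto intro!: continuous_intros\<close>)
    have "norm (h (of_real (norm z) * cis \<beta>) - h (of_real 0 * cis \<beta>)) \<le> integral {0..norm z} (\<lambda>x. norm (deriv h (of_real x * cis \<beta>)))"
      by (rule radial_difference_le[OF h]) (use z in auto)
    also have "\<dots> \<le> integral {0..R} (\<lambda>x. norm (deriv h (of_real x * cis \<beta>)))"
      by (intro integral_subset_le integrable_continuous_real continuous_on_subset[OF cc]) (use R in auto)
    also have "\<dots> = integral {0..R} (\<lambda>x. norm (deriv h (of_real x * cis \<beta>)) * norm (1 - cnj 1 * (of_real x * cis \<beta>)) powr (- 0))"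
    proof (rule integral_cong)
      fix x assume x: "x \<in> {0..R}"
      then have "norm (1 - cnj 1 * (of_real x * cis \<beta>)) \<noteq> 0" using R inb by (intro nz) auto
      then show "norm (deriv h (of_real x * cis \<beta>)) =
         norm (deriv h (of_real x * cis \<beta>)) * norm (1 - cnj 1 * (of_real x * cis \<beta>)) powr (- 0)" by simp
    qed
    also have "\<dots> \<le> C * (1 + circ_int R (\<lambda>w. norm (g w) powr q * norm (1 - cnj 1 * w) powr (- 0)))"
      by (rule Cl[rule_format]) (use R R0 \<beta> in auto)
    also have "circ_int R (\<lambda>w. norm (g w) powr q * norm (1 - cnj 1 * w) powr (- 0)) = circ_int R (\<lambda>w. norm (g w) powr q)"
    proof (rule circ_int_cong)
      fix w :: complex assume "norm w = R"
      then have "norm (1 - cnj 1 * w) \<noteq> 0" using R by (intro nz) auto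
      then show "norm (g w) powr q * norm (1 - cnj 1 * w) powr (- 0) = norm (g w) powr q" by simp
    qed (use R0 in simp)
    also have "C * (1 + circ_int R (\<lambda>w. norm (g w) powr q)) \<le> C * (1 + A)"
      using A R R0 C by (intro mult_left_mono add_left_mono) auto
    finally have "norm (h z - h 0) \<le> C * (1 + A)" using \<beta>(3) by simp
    then show ?thesis unfolding B_def using norm_triangle_sub[of "h z" "h 0"] by linarith
  qed
  have B0: "0 \<le> B" using hB[of 0] norm_ge_zero[of "h 0"] by (intro order_trans[OF norm_ge_zero[of "h 0"]]) auto
  define K where "K = 2 * pi / cos (1 / 2 * pi / 2)"
  have K0: "0 \<le> K" unfolding K_def by (intro divide_nonneg_nonneg cos_ge_zero) auto
  define E where "E = 4 * C + 5 * B + K * A"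
  have E: "B \<le> E" "K * A \<le> E" "4 * C + 4 * B \<le> E" "2 * B \<le> E" "0 \<le> E"
    using C B0 mult_nonneg_nonneg[OF K0 A(1)] by (auto simp: E_def)
  show ?thesis unfolding circle_hoelder_def
  proof (intro exI[of _ E] conjI exI[of _ "zero_radii g"] allI impI)
    show "0 \<le> E" "countable (zero_radii g)" by (rule E, rule countable_zero_radii[OF ghol])
    show "norm (h z) \<le> E" if "norm z < 1" for z using hB[OF that] E by linarith
    fix R :: real assume R: "0 < R \<and> R < 1 \<and> R \<notin> zero_radii g"
    define N where "N = (\<lambda>t. circ_int R (\<lambda>w. norm (g w) powr q * norm (1 - cnj w * cis t) powr (- (1 / 2))))"
    have cg: "continuous_on (sphere 0 R) (\<lambda>w. norm (g w) powr q)"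
      using R q by (intro continuous_on_norm_powr continuous_on_circle[OF ghol]) auto
    have ccnj: "continuous_on (sphere 0 R) cnj" by (intro continuous_intros)
    have cn1: "norm (cnj w) < 1" if "norm w = R" for w using that R by simp
    note dk = integral_of_kernel_means[OF cg _ ccnj cn1 less_imp_le, of "1/2", folded N_def K_def]
    have N: "continuous_on {0..2 * pi} N" "integral {0..2 * pi} N \<le> E" "\<And>t. 0 \<le> N t"
    proof -
      show "continuous_on {0..2 * pi} N" by (rule dk(1)) (use R in auto)
      have "integral {0..2 * pi} N \<le> K * circ_int R (\<lambda>w. norm (g w) powr q)" by (rule dk(2)) (use R in auto)
      also have "\<dots> \<le> K * A" using A R K0 by (intro mult_left_mono) auto
      finally show "integral {0..2 * pi} N \<le> E" using E by linarith
      show "0 \<le> N t" for t unfolding N_def by (rule dk(3)[unfolded N_def]) (use R in auto)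
    qed
    have Nalt: "circ_int R (\<lambda>w. norm (g w) powr q * norm (1 - cnj (cis t) * w) powr (- (1 / 2))) = N t" for t
      unfolding N_def
    proof (rule circ_int_cong)
      fix w
      have "norm (1 - cnj (cis t) * w) = norm (cnj (1 - cnj (cis t) * w))" by (simp only: complex_mod_cnj)
      also have "cnj (1 - cnj (cis t) * w) = 1 - cnj w * cis t" by (simp add: mult.commute)
      finally show "norm (g w) powr q * norm (1 - cnj (cis t) * w) powr (- (1 / 2))
          = norm (g w) powr q * norm (1 - cnj w * cis t) powr (- (1 / 2))" by (simp only:)
    qed (use R in simp)
    have leg: "norm (h (of_real b * cis \<beta>) - h (of_real a * cis \<beta>)) \<le> sqrt \<tau> * (C * (1 + N t))"
      if ab: "0 \<le> a" "a \<le> b" "b \<le> R" and \<beta>: "0 \<le> \<beta>" "\<beta> \<le> 2 * pi"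
        and \<tau>: "\<And>x. a \<le> x \<Longrightarrow> x \<le> b \<Longrightarrow> norm (1 - cnj (cis t) * (of_real x * cis \<beta>)) \<le> \<tau>" for a b \<beta> \<tau> t
    proof -
      let ?w = "\<lambda>x. norm (1 - cnj (cis t) * (of_real x * cis \<beta>)) powr (- (1 / 2))"
      have nzx: "norm (1 - cnj (cis t) * (of_real x * cis \<beta>)) \<noteq> 0" if "x \<in> {0..R}" for x
        by (rule nz) (use that R inb in auto)
      have cc: "continuous_on {0..R} (\<lambda>x. norm (deriv h (of_real x * cis \<beta>)))"
        by (intro continuous_on_norm continuous_on_compose2[OF cdh]) (use inb R in \<open>auto intro!: continuous_intros\<close>)
      have cw: "continuous_on {0..R} ?w" using nzx by (intro continuous_intros) auto
      have \<tau>0: "0 \<le> \<tau>" by (rule order_trans[OF norm_ge_zero \<tau>[of a]]) (use ab in auto)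
      have "norm (h (of_real b * cis \<beta>) - h (of_real a * cis \<beta>)) \<le> integral {a..b} (\<lambda>x. norm (deriv h (of_real x * cis \<beta>)))"
        by (rule radial_difference_le[OF h]) (use ab R in auto)
      also have "\<dots> \<le> integral {a..b} (\<lambda>x. sqrt \<tau> * (norm (deriv h (of_real x * cis \<beta>)) * ?w x))"
      proof (rule integral_le)
        show "(\<lambda>x. norm (deriv h (of_real x * cis \<beta>))) integrable_on {a..b}"
          by (intro integrable_continuous_real continuous_on_subset[OF cc]) (use ab in auto)
        show "(\<lambda>x. sqrt \<tau> * (norm (deriv h (of_real x * cis \<beta>)) * ?w x)) integrable_on {a..b}"
          by (intro integrable_continuous_real continuous_on_subset[OF continuous_on_mult[OF continuous_on_const continuous_on_mult[OF cc cw]]])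
             (use ab in auto)
        fix x assume x: "x \<in> {a..b}"
        let ?X = "norm (1 - cnj (cis t) * (of_real x * cis \<beta>))"
        have X: "0 < ?X" "?X \<le> \<tau>"
        proof -
          have "?X \<noteq> 0" by (rule nzx) (use x ab in auto)
          then show "0 < ?X" by (metis norm_ge_zero order_le_less)
          show "?X \<le> \<tau>" by (rule \<tau>) (use x in auto)
        qed
        have "1 \<le> sqrt \<tau> / sqrt ?X" using X by (simp add: pos_le_divide_eq)
        also have "\<dots> = sqrt \<tau> * ?w x" using X by (simp only: powr_minus_divide powr_half_sqrt) simp
        finally have "norm (deriv h (of_real x * cis \<beta>)) * 1 \<le> norm (deriv h (of_real x * cis \<beta>)) * (sqrt \<tau> * ?w x)"
          by (intro mult_left_mono) auto
        then show "norm (deriv h (of_real x * cis \<beta>)) \<le> sqrt \<tau> * (norm (deriv h (of_real x * cis \<beta>)) * ?w x)"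
          by (simp only: mult_ac mult_1_right mult_1_left)
      qed
      also have "\<dots> = sqrt \<tau> * integral {a..b} (\<lambda>x. norm (deriv h (of_real x * cis \<beta>)) * ?w x)" by simp
      also have "\<dots> \<le> sqrt \<tau> * integral {0..R} (\<lambda>x. norm (deriv h (of_real x * cis \<beta>)) * ?w x)"
        using \<tau>0 ab by (intro mult_left_mono integral_subset_le integrable_continuous_real
             continuous_on_subset[OF continuous_on_mult[OF cc cw]]) auto
      also have "\<dots> \<le> sqrt \<tau> * (C * (1 + N t))"
      proof (rule mult_left_mono)
        have "integral {0..R} (\<lambda>x. norm (deriv h (of_real x * cis \<beta>)) * ?w x)
           \<le> C * (1 + circ_int R (\<lambda>w. norm (g w) powr q * norm (1 - cnj (cis t) * w) powr (- (1 / 2))))"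
          by (rule Cl[rule_format]) (use R \<beta> in auto)
        then show "integral {0..R} (\<lambda>x. norm (deriv h (of_real x * cis \<beta>)) * ?w x) \<le> C * (1 + N t)" unfolding Nalt .
      qed (use \<tau>0 in simp)
      finally show ?thesis .
    qed
    show "\<exists>N. continuous_on {0..2 * pi} N \<and> (\<forall>t. 0 \<le> N t) \<and> integral {0..2 * pi} N \<le> E \<and>
          (\<forall>t\<in>{0..2 * pi}. \<forall>z. norm z \<le> R \<longrightarrow>
             norm (h z - h (of_real R * cis t)) \<le> E * norm (z - cis t) powr (1 / 4) * (1 + N t))"
    proof (intro exI[of _ N] conjI allI ballI impI N)
      fix t :: real and z :: complex assume t: "t \<in> {0..2 * pi}" and z: "norm z \<le> R"
      define d where "d = norm (z - cis t)"
      define e where "e = sqrt (sqrt d)"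
      have d0: "0 \<le> d" by (simp add: d_def)
      have e: "d powr (1 / 4) = e"
      proof -
        have "d powr (1 / 4) = (d powr (1 / 2)) powr (1 / 2)" by (simp add: powr_powr)
        then show ?thesis using d0 by (simp add: powr_half_sqrt e_def)
      qed
      have e0: "0 \<le> e" using d0 by (simp add: e_def)
      have "norm (h z - h (of_real R * cis t)) \<le> E * e * (1 + N t)"
      proof (cases "d < 1")
        case False
        then have "1 \<le> e" by (simp add: e_def)
        have "norm (h z - h (of_real R * cis t)) \<le> norm (h z) + norm (h (of_real R * cis t))" by (rule norm_triangle_ineq4)
        also have "\<dots> \<le> B + B" using z R by (intro add_mono hB) (auto simp: norm_mult)
        also have "\<dots> \<le> E" using E(4) by simp
        also have "E \<le> E * (e * (1 + N t))"
        proof -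
          have "1 * 1 \<le> e * (1 + N t)" using \<open>1 \<le> e\<close> N(3)[of t] by (intro mult_mono) auto
          then show ?thesis using E(5) mult_left_mono[of 1 "e * (1 + N t)" E] by simp
        qed
        finally show ?thesis by (simp only: mult.assoc)
      next
        case True
        define \<delta> where "\<delta> = sqrt d"
        have zd: "1 - norm z \<le> d"
          using norm_triangle_ineq2[of "cis t" "z"] unfolding d_def by (simp add: norm_minus_commute)
        have dpos: "0 < d" using zd z R by linarith
        have \<delta>: "0 < \<delta>" "\<delta> < 1" "d \<le> \<delta>" "\<delta> = e\<^sup>2" "d = \<delta>\<^sup>2"
        proof -
          show "0 < \<delta>" "\<delta> < 1" "d = \<delta>\<^sup>2" using dpos True by (auto simp: \<delta>_def)
          then show "d \<le> \<delta>" by (simp add: power2_eq_square mult_left_le)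
          show "\<delta> = e\<^sup>2" using d0 by (simp add: \<delta>_def e_def)
        qed
        define a where "a = 1 - \<delta>"
        have a: "0 \<le> a" "a \<le> norm z" "a \<le> R" "a < 1" using \<delta> zd z by (auto simp: a_def)
        obtain \<beta> where \<beta>: "0 \<le> \<beta>" "\<beta> \<le> 2 * pi" "z = of_real (norm z) * cis \<beta>" by (rule cis_polar)
        have unit: "norm (1 - cnj (cis t) * w) = norm (cis t - w)" for w
        proof -
          have "cis t * (1 - cnj (cis t) * w) = cis t - w"
            by (simp add: algebra_simps mult.assoc[symmetric] cis_cnj cis_mult)
          then have "norm (cis t * (1 - cnj (cis t) * w)) = norm (cis t - w)" by simp
          then show ?thesis by (simp add: norm_mult)
        qed
        have diff_radial: "norm (of_real x * cis \<beta> - of_real y * cis \<beta>) = \<bar>x - y\<bar>" for x y \<beta>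
        proof -
          have "of_real x * cis \<beta> - of_real y * cis \<beta> = of_real (x - y) * cis \<beta>" by (simp add: algebra_simps)
          then show ?thesis by (simp only: norm_mult norm_of_real norm_cis mult_1_right)
        qed
        have sq: "sqrt (2 * \<delta>) \<le> 2 * e"
        proof -
          have "sqrt (2 * \<delta>) \<le> sqrt (4 * \<delta>)" using \<delta> by simp
          also have "\<dots> = 2 * e" using \<delta>(4) e0 by (simp only: real_sqrt_mult real_sqrt_four real_sqrt_abs abs_of_nonneg)
          finally show ?thesis .
        qed
        have l1: "norm (h z - h (of_real a * cis \<beta>)) \<le> sqrt (2 * \<delta>) * (C * (1 + N t))"
        proof -
          have "norm (h (of_real (norm z) * cis \<beta>) - h (of_real a * cis \<beta>)) \<le> sqrt (2 * \<delta>) * (C * (1 + N t))"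
          proof (rule leg[OF a(1,2) z \<beta>(1,2)])
            fix x assume x: "a \<le> x" "x \<le> norm z"
            have "norm (cis t - of_real x * cis \<beta>) \<le> norm (cis t - z) + norm (z - of_real x * cis \<beta>)"
              using norm_triangle_ineq[of "cis t - z" "z - of_real x * cis \<beta>"] by simp
            also have "norm (cis t - z) = d" by (simp add: d_def norm_minus_commute)
            also have "norm (z - of_real x * cis \<beta>) = norm z - x"
              using diff_radial[of "norm z" \<beta> x] \<beta>(3) x by simp
            finally show "norm (1 - cnj (cis t) * (of_real x * cis \<beta>)) \<le> 2 * \<delta>"
              unfolding unit using x \<delta>(3) z R a_def by linarith
          qed
          then show ?thesis using \<beta>(3) by simp
        qed
        have l2: "norm (h (of_real R * cis t) - h (of_real a * cis t)) \<le> sqrt (2 * \<delta>) * (C * (1 + N t))"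
        proof (rule leg[OF a(1,3) order_refl])
          fix x assume x: "a \<le> x" "x \<le> R"
          have "norm (cis t - of_real x * cis t) = \<bar>1 - x\<bar>" using diff_radial[of 1 t x] by simp
          then show "norm (1 - cnj (cis t) * (of_real x * cis t)) \<le> 2 * \<delta>"
            unfolding unit using x \<delta>(1) R a_def by linarith
        qed (use t in auto)
        have l3: "norm (h (of_real a * cis \<beta>) - h (of_real a * cis t)) \<le> 4 * B * e"
        proof -
          have cv: "norm (h (of_real a * cis \<beta>) - h (of_real a * cis t)) \<le> (2 * B / \<delta>) * norm (of_real a * cis \<beta> - of_real a * cis t)"
          proof (rule field_differentiable_bound[OF convex_cball[of 0 a]])
            fix w :: complex assume w: "w \<in> cball 0 a"
            then have w1: "norm w < 1" using a by simp
            show "(h has_field_derivative deriv h w) (at w within cball 0 a)"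
              using holomorphic_derivI[OF h open_ball, of w] w1 by (simp add: has_field_derivative_at_within)
            have "norm (deriv h w) \<le> 2 * B / (1 - norm w)" by (rule deriv_bound_of_bounded[OF h hB w1])
            also have "\<dots> \<le> 2 * B / \<delta>"
            proof (rule divide_left_mono)
              show "\<delta> \<le> 1 - norm w" using w by (simp add: a_def)
              show "0 < (1 - norm w) * \<delta>" using w1 \<delta>(1) by simp
            qed (use B0 in simp)
            finally show "norm (deriv h w) \<le> 2 * B / \<delta>" .
          qed (use a in \<open>auto simp: norm_mult\<close>)
          have "norm (of_real a * cis \<beta> - of_real a * cis t) = a * norm (cis \<beta> - cis t)"
            using a by (simp add: right_diff_distrib[symmetric] norm_mult)
          also have "\<dots> \<le> norm (cis \<beta> - cis t)"
            using a mult_right_mono[of a 1 "norm (cis \<beta> - cis t)"] by simp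
          also have "norm (cis \<beta> - cis t) \<le> norm (cis \<beta> - z) + d"
            using norm_triangle_ineq[of "cis \<beta> - z" "z - cis t"] unfolding d_def by simp
          also have "norm (cis \<beta> - z) = \<bar>1 - norm z\<bar>" using diff_radial[of 1 \<beta> "norm z"] \<beta>(3) by simp
          finally have "norm (of_real a * cis \<beta> - of_real a * cis t) \<le> 2 * d" using zd z R by linarith
          then have "(2 * B / \<delta>) * norm (of_real a * cis \<beta> - of_real a * cis t) \<le> (2 * B / \<delta>) * (2 * d)"
            using B0 \<delta> by (intro mult_left_mono) auto
          also have "\<dots> = 4 * B * \<delta>" using \<delta>(1) by (subst \<delta>(5)) (simp add: power2_eq_square field_simps)
          also have "\<dots> \<le> 4 * B * e"
          proof (intro mult_left_mono)
            have "e \<le> 1" using True d0 by (simp add: e_def)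
            then show "\<delta> \<le> e" unfolding \<delta>(4) using e0 by (simp add: power2_eq_square mult_left_le)
          qed (use B0 in auto)
          finally show ?thesis using cv by linarith
        qed
        have "norm (h z - h (of_real R * cis t)) \<le> norm (h z - h (of_real a * cis \<beta>))
            + norm (h (of_real a * cis \<beta>) - h (of_real a * cis t)) + norm (h (of_real R * cis t) - h (of_real a * cis t))"
        proof -
          let ?a = "h z - h (of_real a * cis \<beta>)" and ?b = "h (of_real a * cis \<beta>) - h (of_real a * cis t)"
            and ?c = "h (of_real R * cis t) - h (of_real a * cis t)"
          have "h z - h (of_real R * cis t) = ?a + ?b - ?c" by simp
          moreover have "norm (?a + ?b - ?c) \<le> norm ?a + norm ?b + norm ?c"
            using norm_triangle_ineq4[of "?a + ?b" ?c] norm_triangle_ineq[of ?a ?b] by linarith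
          ultimately show ?thesis by (simp only:)
        qed
        also have "\<dots> \<le> 2 * e * (C * (1 + N t)) + 4 * B * e + 2 * e * (C * (1 + N t))"
        proof -
          have "sqrt (2 * \<delta>) * (C * (1 + N t)) \<le> 2 * e * (C * (1 + N t))"
            using sq C N(3)[of t] by (intro mult_right_mono) auto
          then show ?thesis using l1 l2 l3 by linarith
        qed
        also have "\<dots> \<le> (4 * C + 4 * B) * (e * (1 + N t))"
        proof -
          have "(4 * C + 4 * B) * (e * (1 + N t)) - (2 * e * (C * (1 + N t)) + 4 * B * e + 2 * e * (C * (1 + N t))) = 4 * B * (e * N t)"
            by (simp add: algebra_simps)
          moreover have "0 \<le> 4 * B * (e * N t)" using B0 e0 N(3)[of t] by simp
          ultimately show ?thesis by linarith
        qed
        also have "\<dots> \<le> E * (e * (1 + N t))" using E(3) e0 N(3)[of t] by (intro mult_right_mono) auto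
        finally show ?thesis by (simp only: mult.assoc)
      qed
      then show "norm (h z - h (of_real R * cis t)) \<le> E * norm (z - cis t) powr (1 / 4) * (1 + N t)"
        unfolding e[unfolded d_def] .
    qed
  qed
qed

section \<open>The logarithmic integral of the distance to the zeros\<close>

lemma ext_log_tendsto:
  assumes x: "\<And>n. 0 < x n" "x \<longlonglongrightarrow> l"
  shows "(\<lambda>n. e2ennreal (- ext_log (x n))) \<longlonglongrightarrow> e2ennreal (- ext_log l)"
proof -
  have l0: "0 \<le> l" using x by (intro LIMSEQ_le_const[OF x(2)]) (auto intro: less_imp_le)
  have eq: "e2ennreal (- ext_log (x n)) = ennreal (- ln (x n))" for n
    using x(1)[of n] by (simp add: ext_log_def)
  show ?thesis
  proof (cases "l = 0")
    case True
    have "filterlim x (at_right 0) sequentially"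
      using x True by (intro tendsto_imp_filterlim_at_right) auto
    then have "filterlim (\<lambda>n. ln (x n)) at_bot sequentially"
      by (rule filterlim_compose[OF ln_at_0])
    then have "filterlim (\<lambda>n. - ln (x n)) at_top sequentially"
      by (simp add: filterlim_uminus_at_top)
    then have "(\<lambda>n. ennreal (- ln (x n))) \<longlonglongrightarrow> Orderings.top" by (simp add: ennreal_tendsto_top_eq_at_top)
    then show ?thesis unfolding eq using True by (simp add: ext_log_def)
  next
    case False
    then have "(\<lambda>n. ennreal (- ln (x n))) \<longlonglongrightarrow> ennreal (- ln l)"
      by (intro tendsto_intros tendsto_ennrealI x(2))
    then show ?thesis unfolding eq using False l0 by (simp add: ext_log_def)
  qed
qed

text \<open>
  For a zero \<open>z\<close> with \<open>\<bar>z\<bar> \<le> R\<close> the Hoelder estimate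
  bounds \<open>ln \<bar>W(R cis t)\<bar>\<close> by \<open>ln \<bar>z - cis t\<bar> / 4\<close>
  plus an integrable function, uniformly in \<open>z\<close>. So the logarithm of the distance
  to the zeros in the disc of radius \<open>R\<close> has an integral bounded below uniformly in
  \<open>R\<close>, and Fatou's lemma applies to a sequence of radii tending to
  \<open>1\<close>.
\<close>

lemma bc_set_zeros:
  assumes W: "W holomorphic_on ball 0 1" "\<exists>z\<in>ball 0 1. W z \<noteq> 0"
    and lh: "circle_hoelder W" and bl: "blaschke {z \<in> ball 0 1. W z = 0}"
  shows "bc_set {z \<in> ball 0 1. W z = 0}"
proof -
  define E where "E = {z \<in> ball 0 1. W z = 0}"
  have Esub: "E \<subseteq> ball 0 1" by (auto simp: E_def)
  have "circle_integral (\<lambda>\<zeta>. ext_log (infdist \<zeta> E)) > - \<infinity>" if "E \<noteq> {}"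
  proof -
    obtain z0 where z0: "z0 \<in> E" using \<open>E \<noteq> {}\<close> by blast
    then have z01: "norm z0 < 1" using Esub by auto
    obtain C X N where C: "0 \<le> C" "countable X"
      and N: "\<forall>R. 0 < R \<and> R < 1 \<and> R \<notin> X \<longrightarrow>
         continuous_on {0..2 * pi} (N R) \<and> (\<forall>t. 0 \<le> N R t) \<and> integral {0..2 * pi} (N R) \<le> C \<and>
            (\<forall>t\<in>{0..2 * pi}. \<forall>z. norm z \<le> R \<longrightarrow>
               norm (W z - W (of_real R * cis t)) \<le> C * norm (z - cis t) powr (1 / 4) * (1 + N R t))"
      using circle_hoelderE[OF lh] by metis
    obtain B where B: "\<forall>R. 1 / 2 \<le> R \<and> R < 1 \<and> R \<notin> zero_radii W \<longrightarrow> - B \<le> circ_int R (\<lambda>z. ln (norm (W z)))"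
      by (rule log_mean_lower_bound[OF W])
    have "\<exists>R. 1 - 1 / real (n + 2) < R \<and> norm z0 < R \<and> R < 1 \<and> R \<notin> X \<union> zero_radii W" for n
    proof -
      have "max (1 - 1 / real (n + 2)) (norm z0) < 1" using z01 by simp
      moreover have "countable (X \<union> zero_radii W)" using C countable_zero_radii[OF W(1)] by simp
      ultimately obtain R where "max (1 - 1 / real (n + 2)) (norm z0) < R" "R < 1" "R \<notin> X \<union> zero_radii W"
        using obtain_radius by metis
      then show ?thesis by (intro exI[of _ R]) auto
    qed
    then obtain R where R: "\<And>n. 1 - 1 / real (n + 2) < R n" "\<And>n. norm z0 < R n" "\<And>n. R n < 1"
      "\<And>n. R n \<notin> X" "\<And>n. R n \<notin> zero_radii W"
      by (metis UnCI)
    have Rhalf: "1 / 2 < R n" for n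
    proof -
      have "1 / real (n + 2) \<le> 1 / 2" by (intro divide_left_mono) auto
      then show ?thesis using R(1)[of n] by linarith
    qed
    have R0: "0 < R n" for n using Rhalf[of n] by linarith
    define En where "En = (\<lambda>n. E \<inter> cball 0 (R n))"
    have En: "z0 \<in> En n" for n using z0 R(2)[of n] by (simp add: En_def)
    define D where "D = (\<lambda>n t. infdist (cis t) (En n))"
    have Dpos: "1 - R n \<le> D n t" for n t
    proof -
      have "1 - R n \<le> dist (cis t) z" if "z \<in> En n" for z
        using that norm_triangle_ineq2[of "cis t" z] by (auto simp: En_def dist_norm)
      then show ?thesis unfolding D_def infdist_def using En[of n]
        by (auto intro!: cINF_greatest)
    qed
    have Dpos': "0 < D n t" for n t using Dpos[of n t] R(3)[of n] by linarith
    have Dle2: "D n t \<le> 2" for n t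
    proof -
      have "D n t \<le> dist (cis t) z0" unfolding D_def by (rule infdist_le[OF En])
      also have "\<dots> \<le> 2" using norm_triangle_ineq4[of "cis t" z0] z01 by (simp add: dist_norm)
      finally show ?thesis .
    qed
    have cD: "continuous_on A (D n)" for n A
      unfolding D_def by (intro continuous_on_infdist continuous_intros)
    have Dlim: "(\<lambda>n. D n t) \<longlonglongrightarrow> infdist (cis t) E" for t
    proof (rule LIMSEQ_I)
      fix e :: real assume e: "0 < e"
      have "Inf (dist (cis t) ` E) < infdist (cis t) E + e"
        using e \<open>E \<noteq> {}\<close> by (simp add: infdist_def)
      from cInf_lessD[OF _ this] obtain z where z: "z \<in> E" "dist (cis t) z < infdist (cis t) E + e"
        using \<open>E \<noteq> {}\<close> by blast
      have "0 < 1 - norm z" using z Esub by auto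
      then obtain n0 where n0: "1 / real (Suc n0) < 1 - norm z" by (rule nat_approx_posE)
      have "norm (D n t - infdist (cis t) E) < e" if n: "n0 \<le> n" for n
      proof -
        have "1 / real (n + 2) \<le> 1 / real (Suc n0)" using n by (intro divide_left_mono) auto
        then have "norm z \<le> R n" using R(1)[of n] n0 by linarith
        then have "z \<in> En n" using z by (simp add: En_def)
        then have "D n t \<le> dist (cis t) z" unfolding D_def by (rule infdist_le)
        moreover have "infdist (cis t) E \<le> D n t" unfolding D_def
          by (rule infdist_mono) (use En[of n] in \<open>auto simp: En_def\<close>)
        ultimately show ?thesis using z(2) by simp
      qed
      then show "\<exists>n0. \<forall>n\<ge>n0. norm (D n t - infdist (cis t) E) < e" by blast
    qed
    define J where "J = 4 * (2 * pi * ln C + C + B) + 2 * pi * ln 2"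
    have bound: "(\<integral>\<^sup>+ t. ennreal (- ln (D n t)) * indicator {0..2 * pi} t \<partial>lborel) \<le> ennreal J" for n
    proof -
      have NR: "continuous_on {0..2 * pi} (N (R n))" "\<And>t. 0 \<le> N (R n) t" "integral {0..2 * pi} (N (R n)) \<le> C"
        "\<And>t z. t \<in> {0..2 * pi} \<Longrightarrow> norm z \<le> R n \<Longrightarrow>
               norm (W z - W (of_real (R n) * cis t)) \<le> C * norm (z - cis t) powr (1 / 4) * (1 + N (R n) t)"
        using N R0 R by blast+
      have nzW: "W z \<noteq> 0" if "norm z = R n" for z by (rule zero_radiiD[OF R(5,3) W(2) that])
      define lw where "lw = (\<lambda>t. ln (norm (W (of_real (R n) * cis t))))"
      have clw0: "continuous_on (sphere 0 (R n)) (\<lambda>z. ln (norm (W z)))"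
        by (intro continuous_intros continuous_on_circle W(1) R) (use nzW in auto)
      have clw: "continuous_on {0..2 * pi} lw"
        unfolding lw_def by (rule circ_continuous[OF clw0]) (use R0[of n] in simp)
      \<comment> \<open>The distances are at most \<open>2\<close>, so adding \<open>ln 2\<close> makes the majorant nonnegative.\<close>
      define rhs where "rhs = (\<lambda>t. 4 * (ln C + N (R n) t - lw t) + ln 2)"
      have crhs: "continuous_on {0..2 * pi} rhs" unfolding rhs_def by (intro continuous_intros NR(1) clw)
      have le: "- ln (D n t) \<le> 4 * (ln C + N (R n) t - lw t)" if t: "t \<in> {0..2 * pi}" for t
      proof -
        have w0: "W (of_real (R n) * cis t) \<noteq> 0" by (rule nzW) (use R0[of n] in \<open>simp add: norm_mult\<close>)
        have "exp (4 * (lw t - ln C - N (R n) t)) \<le> dist (cis t) z" if z: "z \<in> En n" for z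
        proof -
          have "W z = 0" "norm z \<le> R n" using z by (auto simp: En_def E_def)
          then have le: "norm (W (of_real (R n) * cis t)) \<le> C * norm (z - cis t) powr (1 / 4) * (1 + N (R n) t)"
            using NR(4)[OF t, of z] by simp
          have "norm z < norm (cis t)" using \<open>norm z \<le> R n\<close> R(3)[of n] by simp
          then have d0: "0 < norm (z - cis t)" by auto
          have C0: "0 < C" using le w0 C(1) by (cases "C = 0") auto
          have N1: "0 < 1 + N (R n) t" using NR(2)[of t] by linarith
          have "lw t \<le> ln (C * norm (z - cis t) powr (1 / 4) * (1 + N (R n) t))"
            unfolding lw_def using le w0 by (intro ln_mono) auto
          also have "\<dots> = ln C + 1 / 4 * ln (norm (z - cis t)) + ln (1 + N (R n) t)"
            using C0 d0 N1 by (simp add: ln_mult_pos ln_powr)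
          also have "ln (1 + N (R n) t) \<le> N (R n) t" using NR(2)[of t] by (rule ln_add_one_self_le_self)
          finally have "4 * (lw t - ln C - N (R n) t) \<le> ln (norm (z - cis t))" by simp
          then have "exp (4 * (lw t - ln C - N (R n) t)) \<le> exp (ln (norm (z - cis t)))" by (simp only: exp_le_cancel_iff)
          also have "\<dots> = dist (cis t) z" using d0 by (simp add: dist_norm norm_minus_commute)
          finally show ?thesis .
        qed
        then have "exp (4 * (lw t - ln C - N (R n) t)) \<le> D n t"
          unfolding D_def infdist_def using En[of n] by (auto intro!: cINF_greatest)
        then have "4 * (lw t - ln C - N (R n) t) \<le> ln (D n t)" using Dpos'[of n t] by (simp add: ln_ge_iff)
        then show ?thesis by simp
      qed
      have rhs0: "0 \<le> rhs t" if "t \<in> {0..2 * pi}" for t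
      proof -
        have "ln (D n t) \<le> ln 2" using Dle2[of n t] Dpos'[of n t] by (intro ln_mono) auto
        then show ?thesis using le[OF that] unfolding rhs_def by linarith
      qed
      have "(\<integral>\<^sup>+ t. ennreal (- ln (D n t)) * indicator {0..2 * pi} t \<partial>lborel)
          \<le> (\<integral>\<^sup>+ t. ennreal (rhs t) * indicator {0..2 * pi} t \<partial>lborel)"
      proof (rule nn_integral_mono)
        fix t :: real
        show "ennreal (- ln (D n t)) * indicator {0..2 * pi} t \<le> ennreal (rhs t) * indicator {0..2 * pi} t"
        proof (cases "t \<in> {0..2 * pi}")
          case True
          have "- ln (D n t) \<le> rhs t" using le[OF True] unfolding rhs_def by (simp add: add_increasing2)
          then show ?thesis using True by (simp add: ennreal_leI)
        qed simp
      qed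
      also have "\<dots> = ennreal (integral {0..2 * pi} rhs)"
        by (rule nn_integral_has_integral_lebesgue'[OF rhs0 integrable_integral[OF integrable_continuous_real[OF crhs]]])
      also have "integral {0..2 * pi} rhs = 4 * (2 * pi * ln C + integral {0..2 * pi} (N (R n)) - integral {0..2 * pi} lw) + 2 * pi * ln 2"
      proof -
        have i: "N (R n) integrable_on {0..2 * pi}" "lw integrable_on {0..2 * pi}"
          by (intro integrable_continuous_real NR(1) clw)+
        have "(rhs has_integral (4 * ((2 * pi * ln C) + integral {0..2 * pi} (N (R n)) - integral {0..2 * pi} lw) + 2 * pi * ln 2)) {0..2 * pi}"
          unfolding rhs_def
          using has_integral_const_real[of "ln C" 0 "2 * pi"] has_integral_const_real[of "ln (2::real)" 0 "2 * pi"]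
          by (intro has_integral_add has_integral_mult_right has_integral_diff integrable_integral i) auto
        then show ?thesis by (rule integral_unique)
      qed
      also have "\<dots> \<le> J"
      proof -
        have "- B \<le> circ_int (R n) (\<lambda>z. ln (norm (W z)))" using B R Rhalf less_imp_le by blast
        then have "- B \<le> integral {0..2 * pi} lw" by (simp add: circ_int_def lw_def)
        then show ?thesis using NR(3) unfolding J_def by simp
      qed
      finally show ?thesis by (simp add: ennreal_leI)
    qed
    have meas: "(\<lambda>t. ennreal (- ln (D n t)) * indicator {0..2 * pi} t) \<in> borel_measurable lborel" for n
    proof -
      have "(\<lambda>t. - ln (D n t)) \<in> borel_measurable borel"
        by (intro borel_measurable_continuous_onI continuous_intros cD) (use Dpos' less_imp_neq in fastforce)
      then show ?thesis by simp
    qed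
    have "(\<integral>\<^sup>+ t. e2ennreal (- ext_log (infdist (cis t) E)) * indicator {0..2 * pi} t \<partial>lborel)
        \<le> (\<integral>\<^sup>+ t. liminf (\<lambda>n. ennreal (- ln (D n t)) * indicator {0..2 * pi} t) \<partial>lborel)"
    proof (rule nn_integral_mono)
      fix t :: real
      have "(\<lambda>n. e2ennreal (- ext_log (D n t))) \<longlonglongrightarrow> e2ennreal (- ext_log (infdist (cis t) E))"
        by (rule ext_log_tendsto[OF Dpos' Dlim])
      moreover have "e2ennreal (- ext_log (D n t)) = ennreal (- ln (D n t))" for n
        using Dpos'[of n t] by (simp add: ext_log_def)
      ultimately have lim: "(\<lambda>n. ennreal (- ln (D n t))) \<longlonglongrightarrow> e2ennreal (- ext_log (infdist (cis t) E))"
        by (simp only:)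
      show "e2ennreal (- ext_log (infdist (cis t) E)) * indicator {0..2 * pi} t
          \<le> liminf (\<lambda>n. ennreal (- ln (D n t)) * indicator {0..2 * pi} t)"
        using lim_imp_Liminf[OF _ lim] by (cases "t \<in> {0..2 * pi}") auto
    qed
    also have "\<dots> \<le> liminf (\<lambda>n. \<integral>\<^sup>+ t. ennreal (- ln (D n t)) * indicator {0..2 * pi} t \<partial>lborel)"
      by (rule nn_integral_liminf[OF meas])
    also have "\<dots> \<le> liminf (\<lambda>n. ennreal J)"
      by (rule Liminf_mono) (use bound in simp)
    also have "\<dots> = ennreal J" by (simp add: Liminf_const)
    finally have fin: "(\<integral>\<^sup>+ t\<in>{0..2 * pi}. e2ennreal (- ext_log (infdist (cis t) E)) \<partial>lborel) \<le> ennreal J" .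
    define a where "a = (\<integral>\<^sup>+ t\<in>{0..2 * pi}. e2ennreal (ext_log (infdist (cis t) E)) \<partial>lborel)"
    define b where "b = (\<integral>\<^sup>+ t\<in>{0..2 * pi}. e2ennreal (- ext_log (infdist (cis t) E)) \<partial>lborel)"
    have "b < Orderings.top" using fin unfolding b_def by (metis ennreal_less_top le_less_trans)
    then obtain r where "0 \<le> r" "b = ennreal r" by (cases b) auto
    then have "enn2ereal b = ereal r" by simp
    moreover have "0 \<le> enn2ereal a" by simp
    ultimately have "- \<infinity> < enn2ereal a - enn2ereal b" by (cases "enn2ereal a") auto
    then show ?thesis unfolding circle_integral_def a_def b_def by simp
  qed
  moreover have "E \<inter> ball 0 1 = E" "E \<subseteq> cball 0 1" using Esub by auto
  ultimately show ?thesis using bl unfolding bc_set_def E_def by auto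
qed

section \<open>Deep zeros and the Wronskian\<close>

text \<open>
  The case in which all derivatives vanish is the one where \<^const>\<open>zorder\<close> is
  unspecified; there the function vanishes identically.
\<close>

lemma deep_zero_iff_derivs:
  assumes g: "g holomorphic_on ball 0 1" and z: "z \<in> ball 0 1"
  shows "deep_zero n g z \<longleftrightarrow> (\<forall>i\<le>n. (deriv ^^ i) g z = 0)"
proof (cases "\<forall>i. (deriv ^^ i) g z = 0")
  case True
  have "g w = 0" if "w \<in> ball 0 1" for w
    by (rule holomorphic_fun_eq_0_on_connected[OF g open_ball connected_ball]) (use True z that in auto)
  then have "\<forall>\<^sub>F w in nhds z. g w = 0"
    using eventually_nhds_in_open[OF open_ball z] by (rule eventually_mono[rotated])
  then show ?thesis using True eventually_nhds_x_imp_x unfolding deep_zero_def by blast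
next
  case False
  define k where "k = (LEAST i. (deriv ^^ i) g z \<noteq> 0)"
  have k: "(deriv ^^ k) g z \<noteq> 0" "\<And>i. i < k \<Longrightarrow> (deriv ^^ i) g z = 0"
    using False LeastI_ex[of "\<lambda>i. (deriv ^^ i) g z \<noteq> 0"] not_less_Least unfolding k_def by blast+
  have zo: "zorder g z = int k"
    by (rule zorder_zero_eqI[OF g open_ball z]) (use k in auto)
  have "\<not> (\<forall>\<^sub>F w in nhds z. g w = 0)"
  proof
    assume "\<forall>\<^sub>F w in nhds z. g w = 0"
    then have "(deriv ^^ k) g z = (deriv ^^ k) (\<lambda>_. 0) z"
      by (intro higher_deriv_cong_ev) auto
    also have "\<dots> = 0" by simp
    finally show False using k by simp
  qed
  then have "deep_zero n g z \<longleftrightarrow> g z = 0 \<and> n < k"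
    unfolding deep_zero_def zo by auto
  also have "\<dots> \<longleftrightarrow> (\<forall>i\<le>n. (deriv ^^ i) g z = 0)"
  proof
    assume "g z = 0 \<and> n < k"
    then show "\<forall>i\<le>n. (deriv ^^ i) g z = 0" using k(2) by auto
  next
    assume *: "\<forall>i\<le>n. (deriv ^^ i) g z = 0"
    then have "g z = 0" by (metis funpow_0 zero_le)
    moreover have "n < k" using * k(1) not_le by blast
    ultimately show "g z = 0 \<and> n < k" by blast
  qed
  finally show ?thesis .
qed

lemma higher_deriv_sum:
  assumes "finite J" "\<And>j. j \<in> J \<Longrightarrow> f j holomorphic_on S" "open S" "z \<in> S"
  shows "(deriv ^^ i) (\<lambda>w. \<Sum>j\<in>J. c j * f j w) z = (\<Sum>j\<in>J. c j * (deriv ^^ i) (f j) z)"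
  using assms(1,2)
proof (induction J rule: finite_induct)
  case (insert a J)
  have "(deriv ^^ i) (\<lambda>w. c a * f a w + (\<Sum>j\<in>J. c j * f j w)) z
     = (deriv ^^ i) (\<lambda>w. c a * f a w) z + (deriv ^^ i) (\<lambda>w. \<Sum>j\<in>J. c j * f j w) z"
    by (rule higher_deriv_add[OF _ _ assms(3,4)]) (use insert in \<open>auto intro!: holomorphic_intros\<close>)
  also have "(deriv ^^ i) (\<lambda>w. c a * f a w) z = c a * (deriv ^^ i) (f a) z"
    by (rule higher_deriv_cmult[OF _ assms(4,3)]) (use insert in auto)
  finally show ?case using insert by simp
qed simp

definition wronskian_mat :: "nat \<Rightarrow> (nat \<Rightarrow> complex \<Rightarrow> complex) \<Rightarrow> complex \<Rightarrow> complex mat" where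
  "wronskian_mat N f z = Matrix.mat N N (\<lambda>(i, j). (deriv ^^ i) (f j) z)"

definition wronskian :: "nat \<Rightarrow> (nat \<Rightarrow> complex \<Rightarrow> complex) \<Rightarrow> complex \<Rightarrow> complex" where
  "wronskian N f z = Determinant.det (wronskian_mat N f z)"

lemma wronskian_leibniz:
  "wronskian N f z = (\<Sum>p | p permutes {0..<N}. of_int (sign p) * (\<Prod>i<N. (deriv ^^ i) (f (p i)) z))"
proof -
  have "(\<Prod>i = 0..<N. wronskian_mat N f z $$ (i, p i)) = (\<Prod>i<N. (deriv ^^ i) (f (p i)) z)"
    if "p permutes {0..<N}" for p
    unfolding atLeast0LessThan
    by (rule prod.cong) (use permutes_in_image[OF that] in \<open>auto simp: wronskian_mat_def\<close>)
  then show ?thesis unfolding wronskian_def Determinant.det_def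
    by (simp add: wronskian_mat_def)
qed

lemma wronskian_holomorphic:
  assumes "\<And>j. j < N \<Longrightarrow> f j holomorphic_on ball 0 1"
  shows "wronskian N f holomorphic_on ball 0 1"
proof -
  have "(\<lambda>z. \<Sum>p | p permutes {0..<N}. of_int (sign p) * (\<Prod>i<N. (deriv ^^ i) (f (p i)) z)) holomorphic_on ball 0 1"
  proof (intro holomorphic_intros)
    fix p i assume "p \<in> {p. p permutes {0..<N}}" "i \<in> {..<N}"
    then have "p i < N" using permutes_in_image[of p "{0..<N}" i] by auto
    then show "f (p i) holomorphic_on ball 0 1" by (rule assms)
  qed auto
  then show ?thesis by (rule holomorphic_transform) (simp add: wronskian_leibniz)
qed

lemma wronskian_zero_iff_kernel:
  "wronskian N f z = 0 \<longleftrightarrow> (\<exists>c. (\<exists>j<N. c j \<noteq> 0) \<and> (\<forall>i<N. (\<Sum>j<N. c j * (deriv ^^ i) (f j) z) = 0))"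
proof -
  have M: "wronskian_mat N f z \<in> carrier_mat N N" by (simp add: wronskian_mat_def)
  have mv: "Matrix.vec_index (wronskian_mat N f z *\<^sub>v v) i = (\<Sum>j<N. Matrix.vec_index v j * (deriv ^^ i) (f j) z)"
    if "v \<in> carrier_vec N" "i < N" for v i
    using that by (simp add: wronskian_mat_def scalar_prod_def atLeast0LessThan mult.commute)
  show ?thesis unfolding wronskian_def det_0_iff_vec_prod_zero_field[OF M]
  proof
    assume "\<exists>v. v \<in> carrier_vec N \<and> v \<noteq> 0\<^sub>v N \<and> wronskian_mat N f z *\<^sub>v v = 0\<^sub>v N"
    then obtain v where v: "v \<in> carrier_vec N" "v \<noteq> 0\<^sub>v N" "wronskian_mat N f z *\<^sub>v v = 0\<^sub>v N" by blast
    have "\<exists>j<N. Matrix.vec_index v j \<noteq> 0"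
    proof (rule ccontr)
      assume "\<not> ?thesis"
      then have "v = 0\<^sub>v N" using v(1) by (intro eq_vecI) auto
      then show False using v by simp
    qed
    moreover have "\<forall>i<N. (\<Sum>j<N. Matrix.vec_index v j * (deriv ^^ i) (f j) z) = 0"
      using mv[OF v(1)] v(3) by (metis index_zero_vec(1))
    ultimately show "\<exists>c. (\<exists>j<N. c j \<noteq> 0) \<and> (\<forall>i<N. (\<Sum>j<N. c j * (deriv ^^ i) (f j) z) = 0)"
      by (intro exI[of _ "\<lambda>j. Matrix.vec_index v j"]) auto
  next
    assume "\<exists>c. (\<exists>j<N. c j \<noteq> 0) \<and> (\<forall>i<N. (\<Sum>j<N. c j * (deriv ^^ i) (f j) z) = 0)"
    then obtain c where c: "\<exists>j<N. c j \<noteq> 0" "\<forall>i<N. (\<Sum>j<N. c j * (deriv ^^ i) (f j) z) = 0" by blast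
    define v where "v = Matrix.vec N c"
    have v: "v \<in> carrier_vec N" "\<And>j. j < N \<Longrightarrow> Matrix.vec_index v j = c j" by (auto simp: v_def)
    have "v \<noteq> 0\<^sub>v N" using c(1) v(2) by (metis index_zero_vec(1))
    moreover have "wronskian_mat N f z *\<^sub>v v = 0\<^sub>v N"
    proof (rule eq_vecI)
      fix i assume "i < dim_vec (0\<^sub>v N :: complex Matrix.vec)"
      then have i: "i < N" by simp
      have "(\<Sum>j<N. Matrix.vec_index v j * (deriv ^^ i) (f j) z) = (\<Sum>j<N. c j * (deriv ^^ i) (f j) z)"
        by (rule sum.cong) (auto simp: v)
      then show "Matrix.vec_index (wronskian_mat N f z *\<^sub>v v) i = Matrix.vec_index (0\<^sub>v N) i" using mv[OF v(1) i] c(2) i by simp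
    qed (simp add: wronskian_mat_def)
    ultimately show "\<exists>v. v \<in> carrier_vec N \<and> v \<noteq> 0\<^sub>v N \<and> wronskian_mat N f z *\<^sub>v v = 0\<^sub>v N"
      using v(1) by blast
  qed
qed

lemma deep_zero_set_eq_wronskian_zeros:
  assumes f: "\<And>j. j \<le> n \<Longrightarrow> f j holomorphic_on ball 0 1"
  shows "deep_zero_set n f = {z \<in> ball 0 1. wronskian (Suc n) f z = 0}"
proof -
  have "(\<exists>c. (\<exists>j\<le>n. c j \<noteq> 0) \<and> deep_zero n (\<lambda>w. \<Sum>j\<le>n. c j * f j w) z) \<longleftrightarrow> wronskian (Suc n) f z = 0"
    if z: "z \<in> ball 0 1" for z
  proof -
    have "deep_zero n (\<lambda>w. \<Sum>j\<le>n. c j * f j w) z \<longleftrightarrow> (\<forall>i\<le>n. (\<Sum>j\<le>n. c j * (deriv ^^ i) (f j) z) = 0)" for c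
    proof -
      have "(\<lambda>w. \<Sum>j\<le>n. c j * f j w) holomorphic_on ball 0 1" by (intro holomorphic_intros f) auto
      then have "deep_zero n (\<lambda>w. \<Sum>j\<le>n. c j * f j w) z
          \<longleftrightarrow> (\<forall>i\<le>n. (deriv ^^ i) (\<lambda>w. \<Sum>j\<le>n. c j * f j w) z = 0)"
        by (rule deep_zero_iff_derivs) (rule z)
      moreover have "(deriv ^^ i) (\<lambda>w. \<Sum>j\<le>n. c j * f j w) z = (\<Sum>j\<le>n. c j * (deriv ^^ i) (f j) z)" for i
        by (rule higher_deriv_sum[OF _ _ open_ball z]) (use f in auto)
      ultimately show ?thesis by simp
    qed
    then show ?thesis
      unfolding wronskian_zero_iff_kernel less_Suc_eq_le lessThan_Suc_atMost by simp
  qed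
  then show ?thesis unfolding deep_zero_set_def by blast
qed

text \<open>
  For \<open>i \<noteq> n\<close> the sum is the determinant of the matrix whose last row has
  been replaced by its row \<open>i\<close>.
\<close>

lemma sum_cofactors_last_row:
  fixes A :: "complex mat"
  assumes A: "A \<in> carrier_mat (Suc n) (Suc n)" and i: "i \<le> n"
  shows "(\<Sum>j<Suc n. A $$ (i, j) * cofactor A n j) = (if i = n then Determinant.det A else 0)"
proof (cases "i = n")
  case True
  then show ?thesis using laplace_expansion_row[OF A, of n] by simp
next
  case False
  define B where "B = Matrix.mat (Suc n) (Suc n) (\<lambda>(r, c). if r = n then A $$ (i, c) else A $$ (r, c))"
  have B: "B \<in> carrier_mat (Suc n) (Suc n)" by (simp add: B_def)
  have "Matrix.row B i = Matrix.row B n"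
    using False i by (intro eq_vecI) (auto simp: B_def)
  then have "Determinant.det B = 0"
    by (intro det_identical_rows[OF B False]) (use i in auto)
  moreover have "Determinant.det B = (\<Sum>j<Suc n. B $$ (n, j) * cofactor B n j)"
    by (rule laplace_expansion_row[OF B]) simp
  moreover have "B $$ (n, j) * cofactor B n j = A $$ (i, j) * cofactor A n j" if "j < Suc n" for j
  proof -
    have "mat_delete B n j = mat_delete A n j"
      using A that by (intro eq_matI) (auto simp: mat_delete_def B_def)
    then show ?thesis using that by (simp add: cofactor_def B_def)
  qed
  ultimately show ?thesis using False by simp
qed

text \<open>
  Induction on \<open>N\<close>. Suppose that the Wronskian of \<open>f\<^sub>0, \<dots>,
  f\<^sub>n\<close> vanishes identically. The cofactors \<open>C\<^sub>j\<close> of its last row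
  then annihilate all rows, and by differentiation their derivatives annihilate all rows but the
  last. Where the Wronskian \<open>C\<^sub>n\<close> of \<open>f\<^sub>0, \<dots>,
  f\<^bsub>n-1\<^esub>\<close> does not vanish, these rows have a one-dimensional kernel, so the
  vector of the derivatives is a multiple of the vector of the cofactors and every quotient
  \<open>C\<^sub>j / C\<^sub>n\<close> is constant. These constants are the coefficients of a
  linear relation, and the coefficient of \<open>f\<^sub>n\<close> is \<open>1\<close>.
\<close>

lemma wronskian_nonzero:
  assumes "\<And>j. j < N \<Longrightarrow> f j holomorphic_on ball 0 1"
    and "\<And>c. (\<forall>z\<in>ball 0 1. (\<Sum>j<N. c j * f j z) = 0) \<Longrightarrow> (\<forall>j<N. c j = 0)"
  shows "\<exists>z\<in>ball 0 1. wronskian N f z \<noteq> 0"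
  using assms
proof (induction N)
  case 0
  have "wronskian 0 f 0 = 1" by (simp add: wronskian_leibniz)
  then show ?case by (intro bexI[of _ 0]) auto
next
  case (Suc n)
  note f = Suc.prems(1) and indep = Suc.prems(2)
  have indep': "\<forall>j<n. c j = 0" if "\<forall>z\<in>ball 0 1. (\<Sum>j<n. c j * f j z) = 0" for c
  proof -
    have "\<forall>z\<in>ball 0 1. (\<Sum>j<Suc n. (if j < n then c j else 0) * f j z) = 0" using that by simp
    from indep[OF this] show ?thesis by (metis less_SucI)
  qed
  obtain z0 where z0: "z0 \<in> ball 0 1" "wronskian n f z0 \<noteq> 0"
    using Suc.IH[OF f indep'] by auto
  show ?case
  proof (rule ccontr)
    assume "\<not> ?thesis"
    then have W0: "wronskian (Suc n) f z = 0" if "z \<in> ball 0 1" for z using that by blast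
    define C where "C = (\<lambda>j z. cofactor (wronskian_mat (Suc n) f z) n j)"
    have Ceq: "C j z = (- 1) ^ (n + j) * wronskian n (\<lambda>k. f (if k < j then k else Suc k)) z" if "j < Suc n" for j z
    proof -
      have "mat_delete (wronskian_mat (Suc n) f z) n j = wronskian_mat n (\<lambda>k. f (if k < j then k else Suc k)) z"
        using that by (intro eq_matI) (auto simp: mat_delete_def wronskian_mat_def)
      then show ?thesis by (simp add: C_def cofactor_def wronskian_def)
    qed
    have Chol: "C j holomorphic_on ball 0 1" if "j < Suc n" for j
    proof -
      have "wronskian n (\<lambda>k. f (if k < j then k else Suc k)) holomorphic_on ball 0 1"
        by (rule wronskian_holomorphic) (auto intro!: f)
      then have "(\<lambda>z. (- 1) ^ (n + j) * wronskian n (\<lambda>k. f (if k < j then k else Suc k)) z) holomorphic_on ball 0 1"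
        by (intro holomorphic_intros)
      then show ?thesis by (rule holomorphic_transform) (simp add: Ceq that)
    qed
    have Cn: "C n z = wronskian n f z" for z
    proof -
      have "C n z = wronskian n (\<lambda>k. f (if k < n then k else Suc k)) z"
        by (subst Ceq) (auto simp: power_add[symmetric] mult_2[symmetric])
      also have "\<dots> = wronskian n f z" unfolding wronskian_def
        by (rule arg_cong[of _ _ Determinant.det]) (auto simp: wronskian_mat_def intro!: eq_matI)
      finally show ?thesis .
    qed
    have ker: "(\<Sum>j<Suc n. C j z * (deriv ^^ i) (f j) z) = 0" if "z \<in> ball 0 1" "i \<le> n" for z i
    proof -
      have "(\<Sum>j<Suc n. wronskian_mat (Suc n) f z $$ (i, j) * cofactor (wronskian_mat (Suc n) f z) n j) = 0"
        using sum_cofactors_last_row[of "wronskian_mat (Suc n) f z" n i] W0[OF that(1)] that(2)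
        by (simp add: wronskian_mat_def wronskian_def split: if_splits del: sum.lessThan_Suc)
      moreover have "wronskian_mat (Suc n) f z $$ (i, j) = (deriv ^^ i) (f j) z" if "j < Suc n" for j
        using that \<open>i \<le> n\<close> by (simp add: wronskian_mat_def)
      ultimately show ?thesis by (simp add: C_def mult.commute del: sum.lessThan_Suc)
    qed
    have ker': "(\<Sum>j<Suc n. deriv (C j) z * (deriv ^^ i) (f j) z) = 0" if z: "z \<in> ball 0 1" and i: "i < n" for z i
    proof -
      have d: "((\<lambda>w. \<Sum>j<Suc n. C j w * (deriv ^^ i) (f j) w) has_field_derivative
          (\<Sum>j<Suc n. deriv (C j) z * (deriv ^^ i) (f j) z + C j z * (deriv ^^ Suc i) (f j) z)) (at z)"
      proof (rule DERIV_sum)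
        fix j assume "j \<in> {..<Suc n}"
        then have j: "j < Suc n" by simp
        have 1: "(C j has_field_derivative deriv (C j) z) (at z)"
          by (rule holomorphic_derivI[OF Chol[OF j] open_ball z])
        have 2: "((deriv ^^ i) (f j) has_field_derivative (deriv ^^ Suc i) (f j) z) (at z)"
          using holomorphic_derivI[OF holomorphic_higher_deriv[OF f[OF j] open_ball] open_ball z] by simp
        show "((\<lambda>w. C j w * (deriv ^^ i) (f j) w) has_field_derivative
            deriv (C j) z * (deriv ^^ i) (f j) z + C j z * (deriv ^^ Suc i) (f j) z) (at z)"
          using DERIV_mult[OF 1 2] by (simp add: algebra_simps)
      qed
      moreover have "((\<lambda>w. \<Sum>j<Suc n. C j w * (deriv ^^ i) (f j) w) has_field_derivative 0) (at z)"
      proof (rule has_field_derivative_transform_within_open[OF DERIV_const open_ball z])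
        fix x :: complex assume "x \<in> ball 0 1"
        then show "0 = (\<Sum>j<Suc n. C j x * (deriv ^^ i) (f j) x)" using ker[of x i] i by simp
      qed
      ultimately have "(\<Sum>j<Suc n. deriv (C j) z * (deriv ^^ i) (f j) z + C j z * (deriv ^^ Suc i) (f j) z) = 0"
        using DERIV_unique by blast
      then show ?thesis using ker[OF z, of "Suc i"] i by (simp add: sum.distrib del: sum.lessThan_Suc funpow.simps)
    qed
    have Cprop: "C n z * deriv (C j) z = deriv (C n) z * C j z"
      if z: "z \<in> ball 0 1" "wronskian n f z \<noteq> 0" and j: "j < n" for z j
    proof -
      define D where "D = (\<lambda>j. C n z * deriv (C j) z - deriv (C n) z * C j z)"
      have "(\<Sum>j<n. D j * (deriv ^^ i) (f j) z) = 0" if i: "i < n" for i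
      proof -
        have "(\<Sum>j<Suc n. D j * (deriv ^^ i) (f j) z)
           = C n z * (\<Sum>j<Suc n. deriv (C j) z * (deriv ^^ i) (f j) z) - deriv (C n) z * (\<Sum>j<Suc n. C j z * (deriv ^^ i) (f j) z)"
          unfolding D_def by (simp only: sum_distrib_left sum_subtractf[symmetric]) (simp only: algebra_simps)
        also have "\<dots> = 0" using ker'[OF z(1) i] ker[OF z(1), of i] i by (simp del: sum.lessThan_Suc)
        finally show ?thesis by (simp add: D_def mult.commute)
      qed
      then have "D j = 0" using wronskian_zero_iff_kernel[of n f z] z(2) j by blast
      then show ?thesis by (simp add: D_def)
    qed
    have "continuous_on (ball 0 1) (wronskian n f)"
      by (intro holomorphic_on_imp_continuous_on wronskian_holomorphic) (auto intro!: f)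
    then have "open (ball 0 1 \<inter> wronskian n f -` (- {0}))"
      by (intro continuous_open_preimage) auto
    moreover have "z0 \<in> ball 0 1 \<inter> wronskian n f -` (- {0})" using z0 by simp
    ultimately obtain e where e: "0 < e" "ball z0 e \<subseteq> ball 0 1 \<inter> wronskian n f -` (- {0})"
      using openE by blast
    define c where "c = (\<lambda>j. C j z0 / C n z0)"
    have cC: "C j z = c j * C n z" if j: "j < Suc n" and z: "z \<in> ball z0 e" for j z
    proof -
      have "(\<lambda>z. C j z / C n z) constant_on ball z0 e"
      proof (rule has_field_derivative_0_imp_constant_on)
        fix w assume w: "w \<in> ball z0 e"
        then have w1: "w \<in> ball 0 1" and w2: "wronskian n f w \<noteq> 0" using e by auto
        have dj: "(C j has_field_derivative deriv (C j) w) (at w)"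
          by (rule holomorphic_derivI[OF Chol[OF j] open_ball w1])
        have dn: "(C n has_field_derivative deriv (C n) w) (at w)"
          by (rule holomorphic_derivI[OF Chol[of n] open_ball w1]) simp
        have "deriv (C j) w * C n w - C j w * deriv (C n) w = 0"
          using Cprop[OF w1 w2, of j] j by (cases "j = n") (auto simp: mult.commute)
        then show "((\<lambda>z. C j z / C n z) has_field_derivative 0) (at w)"
          using DERIV_divide[OF dj dn] w2 Cn by simp
      qed auto
      then obtain k where "\<And>z. z \<in> ball z0 e \<Longrightarrow> C j z / C n z = k" by (auto simp: constant_on_def)
      then have "C j z / C n z = c j" using z e(1) by (simp add: c_def)
      moreover have "C n z \<noteq> 0" using z e Cn by auto
      ultimately show ?thesis by (simp add: field_simps)
    qed
    define F where "F = (\<lambda>z. \<Sum>j<Suc n. c j * f j z)"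
    have F0: "F z = 0" if z: "z \<in> ball z0 e" for z
    proof -
      have "z \<in> ball 0 1" "C n z \<noteq> 0" using z e Cn by auto
      have "C n z * F z = (\<Sum>j<Suc n. C j z * (deriv ^^ 0) (f j) z)"
        unfolding F_def sum_distrib_left
      proof (rule sum.cong)
        fix j assume "j \<in> {..<Suc n}"
        then have "C j z = c j * C n z" using cC z by blast
        then show "C n z * (c j * f j z) = C j z * (deriv ^^ 0) (f j) z" by simp
      qed simp
      also have "\<dots> = 0" by (rule ker) (use \<open>z \<in> ball 0 1\<close> in auto)
      finally show ?thesis using \<open>C n z \<noteq> 0\<close> by simp
    qed
    have Fhol: "F holomorphic_on ball 0 1" unfolding F_def by (intro holomorphic_intros f) auto
    have "F z = 0" if "z \<in> ball 0 1" for z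
    proof (rule analytic_continuation_open[OF open_ball open_ball _ connected_ball _ Fhol])
      show "ball z0 e \<noteq> {}" using e by auto
      show "ball z0 e \<subseteq> ball 0 1" using e by auto
      show "(\<lambda>_. 0) holomorphic_on ball 0 1" by simp
    qed (use F0 that in auto)
    then have "\<forall>z\<in>ball 0 1. (\<Sum>j<Suc n. c j * f j z) = 0" unfolding F_def by blast
    from indep[OF this] have "c n = 0" by blast
    then show False using z0(2) Cn by (simp add: c_def)
  qed
qed

section \<open>Prescribing the Wronskian\<close>

lemma locally_uniform_limit:
  assumes F: "\<And>n. F n holomorphic_on ball 0 1"
    and step: "\<And>r. 0 \<le> r \<Longrightarrow> r < 1 \<Longrightarrow> \<exists>a. summable a \<and> (\<forall>n z. norm z \<le> r \<longrightarrow> norm (F (Suc n) z - F n z) \<le> a n)"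
  obtains G where "G holomorphic_on ball 0 1"
    "\<forall>k. \<forall>z\<in>ball 0 1. (\<lambda>n. (deriv ^^ k) (F n) z) \<longlonglongrightarrow> (deriv ^^ k) G z"
proof -
  define G where "G = (\<lambda>z. F 0 z + (\<Sum>i. F (Suc i) z - F i z))"
  have tel: "F n z = F 0 z + (\<Sum>i<n. F (Suc i) z - F i z)" for n z
    using sum_lessThan_telescope[of "\<lambda>i. F i z" n] by simp
  have unif: "uniform_limit (cball 0 r) F G sequentially" if r: "0 \<le> r" "r < 1" for r
  proof -
    obtain a where a: "summable a" "\<forall>n z. norm z \<le> r \<longrightarrow> norm (F (Suc n) z - F n z) \<le> a n"
      using step[OF r] by blast
    have "uniform_limit (cball 0 r) (\<lambda>n z. \<Sum>i<n. F (Suc i) z - F i z) (\<lambda>z. \<Sum>i. F (Suc i) z - F i z) sequentially"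
      by (rule Weierstrass_m_test[OF _ a(1)]) (use a(2) in auto)
    then have "uniform_limit (cball 0 r) (\<lambda>n z. F 0 z + (\<Sum>i<n. F (Suc i) z - F i z)) G sequentially"
      unfolding G_def by (intro uniform_limit_add uniform_limit_const)
    moreover have "(\<lambda>n z. F 0 z + (\<Sum>i<n. F (Suc i) z - F i z)) = F" by (intro ext) (rule tel[symmetric])
    ultimately show ?thesis by simp
  qed
  show ?thesis
  proof (rule that)
    show "G holomorphic_on ball 0 1"
    proof (rule holomorphic_uniform_sequence[OF open_ball F])
      fix x :: complex assume x: "x \<in> ball 0 1"
      define d where "d = (1 - norm x) / 2"
      have d: "0 < d" "norm x + d < 1" using x by (auto simp: d_def field_simps)
      have sub: "cball x d \<subseteq> cball 0 (norm x + d)"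
      proof
        fix w assume "w \<in> cball x d"
        then show "w \<in> cball 0 (norm x + d)" using norm_triangle_sub[of w x] by (simp add: dist_norm norm_minus_commute)
      qed
      have "uniform_limit (cball x d) F G sequentially"
        by (rule uniform_limit_on_subset[OF unif sub]) (use d in auto)
      then show "\<exists>d. 0 < d \<and> cball x d \<subseteq> ball 0 1 \<and> uniform_limit (cball x d) F G sequentially"
        using d sub by (intro exI[of _ d]) (auto simp: subset_iff)
    qed
    show "\<forall>k. \<forall>z\<in>ball 0 1. (\<lambda>n. (deriv ^^ k) (F n) z) \<longlonglongrightarrow> (deriv ^^ k) G z"
    proof (intro allI ballI)
      fix k and z :: complex assume z: "z \<in> ball 0 1"
      define r where "r = (1 + norm z) / 2"
      have r: "norm z < r" "r < 1" "0 \<le> r" using z by (auto simp: r_def field_simps add_nonneg_nonneg)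
      show "(\<lambda>n. (deriv ^^ k) (F n) z) \<longlonglongrightarrow> (deriv ^^ k) G z"
      proof (rule higher_deriv_complex_uniform_limit)
        show "uniform_limit (ball 0 r) F G sequentially"
          by (rule uniform_limit_on_subset[OF unif[OF r(3,2)]]) auto
        show "\<forall>\<^sub>F n in sequentially. F n holomorphic_on ball 0 r"
          using r by (intro always_eventually allI holomorphic_on_subset[OF F]) auto
      qed (use r in auto)
    qed
  qed
qed

lemma iterated_primitive:
  assumes "G holomorphic_on ball 0 1"
  obtains g where "g holomorphic_on ball 0 1" "\<forall>z\<in>ball 0 1. (deriv ^^ n) g z = G z"
proof -
  have "\<exists>g. g holomorphic_on ball 0 1 \<and> (\<forall>z\<in>ball 0 1. (deriv ^^ n) g z = G z)"
  proof (induction n)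
    case 0
    show ?case using assms by auto
  next
    case (Suc n)
    then obtain g where g: "g holomorphic_on ball 0 1" "\<forall>z\<in>ball 0 1. (deriv ^^ n) g z = G z" by blast
    obtain h where h0: "\<And>z. z \<in> ball 0 1 \<Longrightarrow> (h has_field_derivative g z) (at z within ball 0 1)"
      using holomorphic_convex_primitive'[OF convex_ball open_ball g(1)] by blast
    have h: "(h has_field_derivative g z) (at z)" if "z \<in> ball 0 1" for z
      using h0[OF that] that by (simp add: at_within_open[of z "ball 0 1"])
    have hol: "h holomorphic_on ball 0 1" unfolding holomorphic_on_open[OF open_ball] using h by blast
    have "(deriv ^^ Suc n) h z = G z" if z: "z \<in> ball 0 1" for z
    proof -
      have "(deriv ^^ Suc n) h z = (deriv ^^ n) (deriv h) z" by (simp add: funpow_swap1)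
      also have "\<dots> = (deriv ^^ n) g z"
        by (rule higher_deriv_transform_within_open[OF holomorphic_deriv[OF hol open_ball] g(1) open_ball z])
           (rule DERIV_imp_deriv[OF h])
      finally show ?thesis using g(2) z by simp
    qed
    then show ?case using hol by blast
  qed
  then show ?thesis using that by blast
qed

text \<open>
  Complete \<open>g\<close> by the monomials of degree less than \<open>n\<close>. The Wronskian
  matrix is then upper triangular with the diagonal \<open>0!, \<dots>, (n - 1)!, G(z)\<close>.
  Linear independence follows from \<open>G(0) \<noteq> 0\<close>: a relation would make
  \<open>0\<close> a deep zero.
\<close>

lemma deep_zero_sets_of_derivative_zeros:
  assumes p: "0 < p" and g: "g holomorphic_on ball 0 1" "(deriv ^^ m) g \<in> hardy p"
    and G: "\<forall>z\<in>ball 0 1. (deriv ^^ n) g z = G z" "G 0 \<noteq> 0"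
  shows "{z \<in> ball 0 1. G z = 0} \<in> deep_zero_sets n (hardy_deriv p m)"
proof -
  define f where "f = (\<lambda>j. if j < n then (\<lambda>w. w ^ j) else g)"
  have pow: "(deriv ^^ i) (\<lambda>w. w ^ j) z = pochhammer (of_nat (Suc j - i)) i * z ^ (j - i)" for i j and z :: complex
    using higher_deriv_power[of i 0 j z] by simp
  have fhol: "f j holomorphic_on ball 0 1" for j using g by (auto simp: f_def intro!: holomorphic_intros)
  have fX: "f j \<in> hardy_deriv p m" for j
  proof (cases "j < n")
    case True
    have "(deriv ^^ m) (\<lambda>w. w ^ j) \<in> hardy p"
    proof (rule hardyI_bounded[OF _ _ p])
      show "(deriv ^^ m) (\<lambda>w. w ^ j) holomorphic_on ball 0 1"
        by (intro holomorphic_higher_deriv holomorphic_intros open_ball)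
      show "norm ((deriv ^^ m) (\<lambda>w. w ^ j) z) \<le> norm (pochhammer (of_nat (Suc j - m)) m :: complex) * 1" if "norm z < 1" for z :: complex
        unfolding pow norm_mult norm_power using that by (intro mult_left_mono power_le_one) auto
    qed
    then show ?thesis using fhol[of j] True by (simp add: f_def hardy_deriv_def)
  qed (use g in \<open>simp add: f_def hardy_deriv_def\<close>)
  have Wz: "wronskian (Suc n) f z = 0 \<longleftrightarrow> G z = 0" if z: "z \<in> ball 0 1" for z
  proof -
    let ?A = "wronskian_mat (Suc n) f z"
    have A: "?A \<in> carrier_mat (Suc n) (Suc n)" by (simp add: wronskian_mat_def)
    have "upper_triangular ?A"
    proof (rule upper_triangularI)
      fix i j assume ij: "j < i" "i < dim_row ?A"
      then have "j < n" "i < Suc n" by (auto simp: wronskian_mat_def)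
      moreover have "pochhammer (of_nat (Suc j - i)) i = (0 :: complex)"
        using ij by (simp add: pochhammer_0_left)
      ultimately show "?A $$ (i, j) = 0" using ij by (simp add: wronskian_mat_def f_def pow)
    qed
    then have "wronskian (Suc n) f z = prod_list (diag_mat ?A)"
      unfolding wronskian_def by (rule det_upper_triangular[OF _ A])
    then have "wronskian (Suc n) f z = 0 \<longleftrightarrow> (\<exists>i<Suc n. ?A $$ (i, i) = 0)"
    proof -
      have "set (diag_mat ?A) = (\<lambda>i. ?A $$ (i, i)) ` {0..<Suc n}"
        using A by (simp only: diag_mat_def set_map set_upt carrier_matD)
      moreover have "prod_list (diag_mat ?A) = 0 \<longleftrightarrow> 0 \<in> set (diag_mat ?A)" by (simp add: prod_list_zero_iff)
      moreover have "0 \<in> h ` {0..<Suc n} \<longleftrightarrow> (\<exists>i<Suc n. h i = 0)" for h :: "nat \<Rightarrow> complex" by force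
      ultimately show ?thesis using \<open>wronskian (Suc n) f z = prod_list (diag_mat ?A)\<close> by (simp only:)
    qed
    also have "\<dots> \<longleftrightarrow> G z = 0"
    proof -
      have "?A $$ (i, i) \<noteq> 0" if "i < n" for i
      proof -
        have "Suc i - i = 1" by simp
        then have "?A $$ (i, i) = pochhammer 1 i" using that by (simp add: wronskian_mat_def f_def pow)
        then show ?thesis by (simp flip: pochhammer_fact)
      qed
      moreover have "?A $$ (n, n) = G z" using G(1) z by (simp add: wronskian_mat_def f_def)
      ultimately show ?thesis by (auto simp: less_Suc_eq)
    qed
    finally show ?thesis .
  qed
  have E: "deep_zero_set n f = {z \<in> ball 0 1. G z = 0}"
    using deep_zero_set_eq_wronskian_zeros[of n f] fhol Wz by auto
  have "lin_indep_on_disk n f"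
    unfolding lin_indep_on_disk_def
  proof (rule allI, rule impI, rule ccontr)
    fix c assume c: "\<forall>z\<in>ball 0 1. (\<Sum>j\<le>n. c j * f j z) = 0" and nz: "\<not> (\<forall>j\<le>n. c j = 0)"
    have "\<forall>\<^sub>F w in nhds 0. (\<Sum>j\<le>n. c j * f j w) = 0"
      using eventually_nhds_in_open[OF open_ball, of "0::complex" 0 1] c by (auto elim: eventually_mono)
    then have "0 \<in> deep_zero_set n f"
      unfolding deep_zero_set_def deep_zero_def using c nz by auto
    then show False using E G(2) by simp
  qed
  then show ?thesis unfolding deep_zero_sets_def using E fX by blast
qed

lemma bounded_of_deriv_growth:
  assumes F: "F holomorphic_on ball 0 1"
    and B: "\<And>z. norm z < 1 \<Longrightarrow> norm (deriv F z) \<le> B / sqrt (1 - norm z)" "0 \<le> B" and z: "norm z < 1"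
  shows "norm (F z) \<le> norm (F 0) + 2 * B"
proof -
  obtain t where t: "z = of_real (norm z) * cis t"
    using rcis_cmod_Arg[of z] by (metis rcis_def)
  have "norm (F (of_real (norm z) * cis t) - F 0) \<le> 2 * B * sqrt (norm z)"
  proof (rule radial_growth[OF F _ z])
    fix \<rho> :: real assume \<rho>: "0 \<le> \<rho>" "\<rho> < norm z"
    have n: "norm (of_real \<rho> * cis t) = \<rho>" using \<rho> by (simp add: norm_mult)
    have "norm (deriv F (of_real \<rho> * cis t)) \<le> B / sqrt (1 - \<rho>)" using B(1)[of "of_real \<rho> * cis t"] n \<rho> z by simp
    also have "\<dots> \<le> B / sqrt (norm z - \<rho>)" using \<rho> z B(2) by (intro divide_left_mono) auto
    finally show "norm (deriv F (of_real \<rho> * cis t)) \<le> B / sqrt (norm z - \<rho>)" .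
  qed simp
  also have "\<dots> \<le> 2 * B * 1" using B(2) z by (intro mult_left_mono) auto
  finally show ?thesis using t norm_triangle_sub[of "F z" "F 0"] by simp
qed

text \<open>
  A single integration already makes the function bounded, and boundedness is stronger than the
  growth condition, so the argument can be repeated down to order \<open>m\<close>.
\<close>

lemma primitive_bounded_of_growth:
  assumes g: "g holomorphic_on ball 0 1"
    and G: "\<And>z. norm z < 1 \<Longrightarrow> norm ((deriv ^^ n) g z) \<le> B / sqrt (1 - norm z)" "0 \<le> B" and m: "m < n"
  obtains B' where "\<forall>z. norm z < 1 \<longrightarrow> norm ((deriv ^^ m) g z) \<le> B'"
proof -
  have hol: "(deriv ^^ i) g holomorphic_on ball 0 1" for i by (rule holomorphic_higher_deriv[OF g open_ball])
  have bnd: "norm ((deriv ^^ i) g z) \<le> norm ((deriv ^^ i) g 0) + 2 * B"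
    if "\<And>z. norm z < 1 \<Longrightarrow> norm ((deriv ^^ Suc i) g z) \<le> B / sqrt (1 - norm z)" "0 \<le> B" "norm z < 1" for i B z
    by (rule bounded_of_deriv_growth[OF hol _ that(2,3)]) (use that(1) in simp)
  have "\<exists>B\<ge>0. \<forall>z. norm z < 1 \<longrightarrow> norm ((deriv ^^ (n - i)) g z) \<le> B / sqrt (1 - norm z)" if "i \<le> n" for i
    using that
  proof (induction i)
    case 0
    then show ?case using G by (intro exI[of _ B]) auto
  next
    case (Suc i)
    then obtain B where B: "0 \<le> B" "\<forall>z. norm z < 1 \<longrightarrow> norm ((deriv ^^ (n - i)) g z) \<le> B / sqrt (1 - norm z)" by auto
    have eq: "n - i = Suc (n - Suc i)" using Suc.prems by simp
    define B' where "B' = norm ((deriv ^^ (n - Suc i)) g 0) + 2 * B"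
    have B'0: "0 \<le> B'" using B by (simp add: B'_def)
    have "norm ((deriv ^^ (n - Suc i)) g z) \<le> B' / sqrt (1 - norm z)" if z: "norm z < 1" for z
    proof -
      have "norm ((deriv ^^ (n - Suc i)) g z) \<le> B'"
        unfolding B'_def by (rule bnd[OF _ B(1) z]) (use B(2) eq in simp)
      also have "B' \<le> B' / sqrt (1 - norm z)"
        using z B'0 by (simp add: pos_le_divide_eq mult_left_le)
      finally show ?thesis .
    qed
    then show ?case using B'0 by blast
  qed
  from this[of "n - Suc m"] obtain B where B: "0 \<le> B"
    "\<forall>z. norm z < 1 \<longrightarrow> norm ((deriv ^^ (n - (n - Suc m))) g z) \<le> B / sqrt (1 - norm z)" by auto
  have "n - (n - Suc m) = Suc m" using m by simp
  then show ?thesis using bnd[of m B] B that by metis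
qed

section \<open>A zero set violating the Blaschke condition\<close>

definition lacunary_product :: "nat \<Rightarrow> complex \<Rightarrow> complex" where
  "lacunary_product J z = (\<Prod>j<J. 1 - 2 * z ^ (4 * 9 ^ j))"

text \<open>
  With \<open>y = x\<^sup>M\<close>, \<open>M = 9\<^sup>j\<close>, the inequality \<open>(1 + 2
  y\<^sup>4)\<^sup>2 (1 - y) \<le> 1 - y\<^sup>9\<close> makes the product telescope. It holds
  since \<open>(1 + 2 y\<^sup>4)\<^sup>2 = 1 + 4 y\<^sup>4 + 4 y\<^sup>8\<close> is at most
  \<open>1 + y + \<dots> + y\<^sup>8\<close>.
\<close>

lemma lacunary_majorant_bound:
  fixes x :: real
  assumes x: "0 \<le> x" "x \<le> 1"
  shows "(\<Prod>j<J. 1 + 2 * x ^ (4 * 9 ^ j)) ^ 2 * (1 - x) \<le> 1 - x ^ (9 ^ J)"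
proof (induction J)
  case (Suc J)
  define y where "y = x ^ (9 ^ J)"
  have y: "0 \<le> y" "y \<le> 1" using x by (auto simp: y_def power_le_one)
  have key: "(1 + 2 * y ^ 4) ^ 2 * (1 - y) \<le> 1 - y ^ 9"
  proof -
    have "1 - y ^ 9 - (1 + 2 * y ^ 4) ^ 2 * (1 - y)
        = (1 - y) * ((y - y ^ 4) + (y ^ 2 - y ^ 4) + (y ^ 3 - y ^ 4) + (y ^ 5 - y ^ 8) + (y ^ 6 - y ^ 8) + (y ^ 7 - y ^ 8))"
      by (simp add: algebra_simps power2_eq_square eval_nat_numeral)
    moreover have "y ^ 4 \<le> y" "y ^ 4 \<le> y ^ 2" "y ^ 4 \<le> y ^ 3" "y ^ 8 \<le> y ^ 5" "y ^ 8 \<le> y ^ 6" "y ^ 8 \<le> y ^ 7"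
      using y power_decreasing[of 1 4 y] by (auto intro!: power_decreasing)
    ultimately have "0 \<le> 1 - y ^ 9 - (1 + 2 * y ^ 4) ^ 2 * (1 - y)"
      using y by (simp add: mult_nonneg_nonneg)
    then show ?thesis by simp
  qed
  have y4: "x ^ (4 * 9 ^ J) = y ^ 4" by (simp add: y_def power_mult[symmetric] mult.commute)
  have y9: "x ^ (9 ^ Suc J) = y ^ 9" by (simp add: y_def power_mult[symmetric] mult.commute)
  have "(\<Prod>j<Suc J. 1 + 2 * x ^ (4 * 9 ^ j)) ^ 2 * (1 - x)
      = ((\<Prod>j<J. 1 + 2 * x ^ (4 * 9 ^ j)) ^ 2 * (1 - x)) * (1 + 2 * y ^ 4) ^ 2"
    unfolding prod.lessThan_Suc y4 by (simp add: power_mult_distrib)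
  also have "\<dots> \<le> (1 - y) * (1 + 2 * y ^ 4) ^ 2"
    using Suc.IH by (intro mult_right_mono) (auto simp: y_def)
  also have "\<dots> \<le> 1 - y ^ 9" using key by (simp add: mult.commute)
  finally show ?case unfolding y9 .
qed simp

lemma lacunary_product_bound:
  assumes z: "norm z < 1"
  shows "norm (lacunary_product J z) \<le> 1 / sqrt (1 - norm z)"
proof -
  let ?P = "\<Prod>j<J. 1 + 2 * norm z ^ (4 * 9 ^ j)"
  have "norm (lacunary_product J z) \<le> ?P"
    unfolding lacunary_product_def prod_norm[symmetric]
  proof (intro prod_mono conjI)
    fix j
    show "norm (1 - 2 * z ^ (4 * 9 ^ j)) \<le> 1 + 2 * norm z ^ (4 * 9 ^ j)"
      using norm_triangle_ineq4[of 1 "2 * z ^ (4 * 9 ^ j)"] by (simp add: norm_mult norm_power)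
  qed auto
  also have "?P \<le> 1 / sqrt (1 - norm z)"
  proof -
    have "?P ^ 2 * (1 - norm z) \<le> 1"
      using lacunary_majorant_bound[OF norm_ge_zero less_imp_le[OF z], of J] zero_le_power[OF norm_ge_zero[of z], of "9 ^ J"]
      by linarith
    then have "?P ^ 2 \<le> 1 / (1 - norm z)" using z by (simp add: field_simps)
    then have "sqrt (?P ^ 2) \<le> sqrt (1 / (1 - norm z))" by (rule real_sqrt_le_mono)
    moreover have "0 \<le> ?P" by (intro prod_nonneg) auto
    ultimately show ?thesis by (simp add: real_sqrt_divide)
  qed
  finally show ?thesis .
qed

text \<open>
  The \<open>M = 4 \<cdot> 9\<^sup>j\<close> roots on level \<open>j\<close> lie on the circle
  of radius \<open>\<rho>\<close> with \<open>\<rho>\<^sup>M = 1 / 2\<close>, and \<open>1 / 2 =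
  1 - \<rho>\<^sup>M \<le> M (1 - \<rho>)\<close>, so that each level contributes at least
  \<open>1 / 2\<close> to the sum.
\<close>

lemma not_blaschke_lacunary_zeros:
  assumes "\<And>j z. z ^ (4 * 9 ^ j) = 1 / 2 \<Longrightarrow> z \<in> E" "E \<subseteq> ball (0 :: complex) 1"
  shows "\<not> blaschke E"
proof
  assume "blaschke E"
  then have summ: "(\<lambda>z. 1 - norm z) summable_on E" by (simp add: blaschke_def)
  define M where "M = (\<lambda>j::nat. 4 * 9 ^ j :: nat)"
  have M0: "0 < M j" for j by (simp add: M_def)
  define A where "A = (\<lambda>j. {z :: complex. z ^ M j = 1 / 2})"
  have cardA: "card (A j) = M j" for j unfolding A_def by (rule card_nth_roots) (use M0 in auto)
  have finA: "finite (A j)" for j using cardA[of j] M0[of j] card_gt_0_iff by metis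
  have normA: "norm z ^ M j = 1 / 2" if "z \<in> A j" for z j
  proof -
    have "z ^ M j = 1 / 2" using that by (simp only: A_def mem_Collect_eq)
    then have "norm (z ^ M j) = norm (1 / 2 :: complex)" by (simp only:)
    then show ?thesis by (simp add: norm_power)
  qed
  have normA1: "norm z < 1" if "z \<in> A j" for z j
  proof (rule ccontr)
    assume "\<not> norm z < 1"
    then have "1 \<le> norm z ^ M j" by (intro one_le_power) simp
    then show False using normA[OF that] by simp
  qed
  have disj: "A i \<inter> A j = {}" if "i < j" for i j
  proof (rule ccontr)
    assume "A i \<inter> A j \<noteq> {}"
    then obtain z where z: "z \<in> A i" "z \<in> A j" by blast
    have "z \<noteq> 0" using normA[OF z(1)] M0[of i] by (metis divide_eq_0_iff norm_zero power_eq_0_iff zero_neq_numeral zero_neq_one zero_power)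
    moreover have "M i < M j" using that by (simp add: M_def)
    ultimately have "norm z ^ M j < norm z ^ M i"
      using normA1[OF z(1)] by (intro power_strict_decreasing) auto
    then show False using normA z by simp
  qed
  have block: "1 / 2 \<le> (\<Sum>z\<in>A j. 1 - norm z)" for j
  proof -
    have "1 / (2 * real (M j)) \<le> 1 - norm z" if z: "z \<in> A j" for z
    proof -
      have "1 - norm z ^ M j = (1 - norm z) * (\<Sum>i<M j. norm z ^ i)" by (rule one_diff_power_eq)
      also have "\<dots> \<le> (1 - norm z) * (\<Sum>i<M j. 1)"
        using normA1[OF z] by (intro mult_left_mono sum_mono power_le_one) auto
      finally have "1 / 2 \<le> (1 - norm z) * real (M j)" using normA[OF z] by simp
      then show ?thesis using M0[of j] by (simp add: field_simps)
    qed
    then have "(\<Sum>z\<in>A j. 1 / (2 * real (M j))) \<le> (\<Sum>z\<in>A j. 1 - norm z)" by (rule sum_mono)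
    moreover have "(\<Sum>z\<in>A j. 1 / (2 * real (M j))) = 1 / 2" using cardA[of j] M0[of j] by simp
    ultimately show ?thesis by simp
  qed
  have "real J / 2 \<le> infsum (\<lambda>z. 1 - norm z) E" for J
  proof -
    have "real J / 2 = (\<Sum>j<J. 1 / 2)" by simp
    also have "\<dots> \<le> (\<Sum>j<J. \<Sum>z\<in>A j. 1 - norm z)" by (intro sum_mono block)
    also have "\<dots> = (\<Sum>z\<in>(\<Union>j<J. A j). 1 - norm z)"
    proof (rule sum.UNION_disjoint[symmetric])
      have "A i \<inter> A j = {}" if "i \<noteq> j" for i j
        using disj[of i j] disj[of j i] that by (cases i j rule: linorder_cases) (auto simp: Int_commute)
      then show "\<forall>i\<in>{..<J}. \<forall>j\<in>{..<J}. i \<noteq> j \<longrightarrow> A i \<inter> A j = {}" by blast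
      show "\<forall>i\<in>{..<J}. finite (A i)" using finA by blast
    qed simp
    also have "\<dots> \<le> infsum (\<lambda>z. 1 - norm z) E"
    proof (rule finite_sum_le_infsum[OF summ])
      show "(\<Union>j<J. A j) \<subseteq> E" using assms(1) by (auto simp: A_def M_def)
      show "0 \<le> 1 - norm z" if "z \<in> E - (\<Union>j<J. A j)" for z using that assms(2) by auto
    qed (use finA in auto)
    finally show ?thesis .
  qed
  moreover obtain J :: nat where "infsum (\<lambda>z. 1 - norm z) E < real J / 2"
    using reals_Archimedean2[of "2 * infsum (\<lambda>z. 1 - norm z) E"] by (auto simp: field_simps)
  ultimately show False by (meson not_le)
qed

lemma exists_non_blaschke_set:
  assumes p: "0 < p" and m: "m < n"
  shows "\<exists>E \<in> deep_zero_sets n (hardy_deriv p m). \<not> blaschke E"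
proof -
  have hol: "lacunary_product J holomorphic_on ball 0 1" for J
    unfolding lacunary_product_def by (intro holomorphic_intros)
  obtain G where G: "G holomorphic_on ball 0 1"
    "\<forall>k. \<forall>z\<in>ball 0 1. (\<lambda>J. (deriv ^^ k) (lacunary_product J) z) \<longlonglongrightarrow> (deriv ^^ k) G z"
  proof (rule locally_uniform_limit[OF hol])
    fix r :: real assume r: "0 \<le> r" "r < 1"
    show "\<exists>a. summable a \<and> (\<forall>J z. norm z \<le> r \<longrightarrow> norm (lacunary_product (Suc J) z - lacunary_product J z) \<le> a J)"
    proof (intro exI[of _ "\<lambda>J. 1 / sqrt (1 - r) * 2 * r ^ J"] conjI allI impI)
      show "summable (\<lambda>J. 1 / sqrt (1 - r) * 2 * r ^ J)" using r by (intro summable_mult summable_geometric) auto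
      fix J and z :: complex assume z: "norm z \<le> r"
      have "lacunary_product (Suc J) z - lacunary_product J z = - (lacunary_product J z * (2 * z ^ (4 * 9 ^ J)))"
        by (simp add: lacunary_product_def algebra_simps)
      then have "norm (lacunary_product (Suc J) z - lacunary_product J z) = norm (lacunary_product J z) * (2 * norm z ^ (4 * 9 ^ J))"
        by (simp add: norm_mult norm_power)
      also have "\<dots> \<le> (1 / sqrt (1 - r)) * (2 * r ^ J)"
      proof (intro mult_mono)
        have "norm (lacunary_product J z) \<le> 1 / sqrt (1 - norm z)" by (rule lacunary_product_bound) (use z r in simp)
        also have "\<dots> \<le> 1 / sqrt (1 - r)" using z r by (intro divide_left_mono) auto
        finally show "norm (lacunary_product J z) \<le> 1 / sqrt (1 - r)" .
        have "J \<le> 9 ^ J" by (simp add: less_imp_le power_gt_expt)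
        then have "J \<le> 4 * 9 ^ J" by linarith
        then have "norm z ^ (4 * 9 ^ J) \<le> norm z ^ J" using z r by (intro power_decreasing) auto
        also have "\<dots> \<le> r ^ J" using z by (intro power_mono) auto
        finally show "norm z ^ (4 * 9 ^ J) \<le> r ^ J" .
      qed (use r in auto)
      finally show "norm (lacunary_product (Suc J) z - lacunary_product J z) \<le> 1 / sqrt (1 - r) * 2 * r ^ J" by simp
    qed
  qed
  have lim: "(\<lambda>J. lacunary_product J z) \<longlonglongrightarrow> G z" if "norm z < 1" for z
    using G(2)[rule_format, of z 0] that by simp
  have Gb: "norm (G z) \<le> 1 / sqrt (1 - norm z)" if z: "norm z < 1" for z
    by (rule LIMSEQ_le_const2[OF tendsto_norm[OF lim[OF z]]]) (use lacunary_product_bound[OF z] in auto)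
  have "lacunary_product J 0 = 1" for J by (simp add: lacunary_product_def zero_power)
  then have "(\<lambda>J::nat. 1) \<longlonglongrightarrow> G 0" using lim[of 0] by simp
  then have "1 = G 0" by (simp only: LIMSEQ_const_iff)
  then have G0: "G 0 \<noteq> 0" by (metis zero_neq_one)
  obtain g where g: "g holomorphic_on ball 0 1" "\<forall>z\<in>ball 0 1. (deriv ^^ n) g z = G z"
    by (rule iterated_primitive[OF G(1)])
  obtain B where B: "\<forall>z. norm z < 1 \<longrightarrow> norm ((deriv ^^ m) g z) \<le> B"
    by (rule primitive_bounded_of_growth[OF g(1) _ _ m, of 1]) (use g(2) Gb in auto)
  have "(deriv ^^ m) g \<in> hardy p"
    by (rule hardyI_bounded[OF holomorphic_higher_deriv[OF g(1) open_ball] _ p]) (use B in auto)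
  then have mem: "{z \<in> ball 0 1. G z = 0} \<in> deep_zero_sets n (hardy_deriv p m)"
    by (rule deep_zero_sets_of_derivative_zeros[OF p g(1) _ g(2) G0])
  have "\<not> blaschke {z \<in> ball 0 1. G z = 0}"
  proof (rule not_blaschke_lacunary_zeros)
    fix j and z :: complex assume z: "z ^ (4 * 9 ^ j) = 1 / 2"
    have z1: "norm z < 1"
    proof (rule ccontr)
      assume "\<not> norm z < 1"
      then have "1 \<le> norm z ^ (4 * 9 ^ j)" by (intro one_le_power) simp
      also have "\<dots> = norm (z ^ (4 * 9 ^ j))" by (simp add: norm_power)
      finally show False unfolding z by simp
    qed
    have "lacunary_product J z = 0" if "j < J" for J
    proof -
      have "1 - 2 * z ^ (4 * 9 ^ j) = 0" by (simp only: z) simp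
      then show ?thesis unfolding lacunary_product_def using that by (intro prod_zero bexI[of _ j]) simp_all
    qed
    then have "\<forall>\<^sub>F J in sequentially. lacunary_product J z = 0"
      by (rule eventually_mono[OF eventually_gt_at_top[of j]])
    then have "(\<lambda>J. lacunary_product J z) \<longlonglongrightarrow> 0" by (rule tendsto_eventually)
    then have "G z = 0" using LIMSEQ_unique[OF lim[OF z1]] by blast
    then show "z \<in> {z \<in> ball 0 1. G z = 0}" using z1 by simp
  qed auto
  then show ?thesis by (rule bexI[OF _ mem])
qed

section \<open>Zeros accumulating at every point of the circle\<close>

text \<open>
  With \<open>w = 1 - cnj \<zeta> z\<close>, which has nonnegative real part on the closed disc,
  this is \<open>(w - \<epsilon>) / (w + \<epsilon>)\<close>, a Blaschke factor of the right
  half-plane. Its zero is \<open>(1 - \<epsilon>) \<zeta>\<close>.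
\<close>

definition half_plane_factor :: "complex \<Rightarrow> real \<Rightarrow> complex \<Rightarrow> complex" where
  "half_plane_factor \<zeta> \<epsilon> z = (of_real (1 - \<epsilon>) - cnj \<zeta> * z) / (of_real (1 + \<epsilon>) - cnj \<zeta> * z)"

lemma half_plane_denominator:
  assumes "norm \<zeta> = 1" "0 < \<epsilon>" "norm z \<le> 1"
  shows "\<epsilon> \<le> norm (of_real (1 + \<epsilon>) - cnj \<zeta> * z)"
    "norm (1 - cnj \<zeta> * z) \<le> norm (of_real (1 + \<epsilon>) - cnj \<zeta> * z)"
    "norm (of_real (1 - \<epsilon>) - cnj \<zeta> * z) \<le> norm (of_real (1 + \<epsilon>) - cnj \<zeta> * z)"
proof -
  define w where "w = 1 - cnj \<zeta> * z"
  have "norm (cnj \<zeta> * z) \<le> 1" using assms by (simp add: norm_mult)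
  then have w: "0 \<le> Re w" unfolding w_def using complex_Re_le_cmod[of "cnj \<zeta> * z"] by simp
  have p: "of_real (1 + \<epsilon>) - cnj \<zeta> * z = w + of_real \<epsilon>" and m: "of_real (1 - \<epsilon>) - cnj \<zeta> * z = w - of_real \<epsilon>"
    by (simp_all add: w_def)
  have sq: "norm (w + of_real \<epsilon>) ^ 2 = norm w ^ 2 + 2 * \<epsilon> * Re w + \<epsilon> ^ 2"
    "norm (w - of_real \<epsilon>) ^ 2 = norm w ^ 2 - 2 * \<epsilon> * Re w + \<epsilon> ^ 2"
    unfolding cmod_power2 by (simp_all add: power2_eq_square algebra_simps)
  have e: "0 \<le> \<epsilon> * Re w" using w assms by simp
  show "\<epsilon> \<le> norm (of_real (1 + \<epsilon>) - cnj \<zeta> * z)"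
    unfolding p by (rule power2_le_imp_le) (use sq e in auto)
  show "norm (1 - cnj \<zeta> * z) \<le> norm (of_real (1 + \<epsilon>) - cnj \<zeta> * z)"
    unfolding p w_def[symmetric] by (rule power2_le_imp_le) (use sq e in auto)
  show "norm (of_real (1 - \<epsilon>) - cnj \<zeta> * z) \<le> norm (of_real (1 + \<epsilon>) - cnj \<zeta> * z)"
    unfolding p m by (rule power2_le_imp_le) (use sq e in auto)
qed

lemma half_plane_factor_minus_one:
  assumes "of_real (1 + \<epsilon>) - cnj \<zeta> * z \<noteq> 0"
  shows "half_plane_factor \<zeta> \<epsilon> z - 1 = - of_real (2 * \<epsilon>) / (of_real (1 + \<epsilon>) - cnj \<zeta> * z)"
  using assms by (simp add: half_plane_factor_def field_simps)

lemma half_plane_factor_holomorphic: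
  assumes "norm \<zeta> = 1" "0 < \<epsilon>"
  shows "half_plane_factor \<zeta> \<epsilon> holomorphic_on ball 0 (1 + \<epsilon>)"
proof -
  have "of_real (1 + \<epsilon>) - cnj \<zeta> * z \<noteq> 0" if "norm z < 1 + \<epsilon>" for z
  proof
    assume "of_real (1 + \<epsilon>) - cnj \<zeta> * z = 0"
    then have "cnj \<zeta> * z = of_real (1 + \<epsilon>)" by simp
    then have "norm (cnj \<zeta> * z) = \<bar>1 + \<epsilon>\<bar>" by (simp only: norm_of_real)
    moreover have "norm (cnj \<zeta> * z) = norm z" using assms by (simp add: norm_mult)
    ultimately show False using that assms by simp
  qed
  then show ?thesis unfolding half_plane_factor_def by (intro holomorphic_intros) auto
qed

text \<open>
  Let \<open>D = \<bar>1 + \<epsilon> - cnj \<zeta> z\<bar>\<close>. The change of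
  \<open>F\<close> is \<open>2 \<epsilon> \<bar>F\<bar> / D\<close>, and Cauchy's estimate on a
  disc of radius comparable to \<open>D\<close> bounds its \<open>k\<close>-th derivative by a
  multiple of \<open>\<epsilon> / D\<^bsup>k+1\<^esup>\<close>. As \<open>\<epsilon> \<le>
  D\<close>, the \<open>p\<close>-th power of this is, up to a constant, at most
  \<open>\<epsilon>\<^sup>s D\<^bsup>-(kp+s)\<^esup>\<close> for \<open>s \<le> p\<close>; since
  \<open>k p < 1\<close>, some \<open>s > 0\<close> keeps the exponent \<open>k p + s\<close>
  below \<open>1\<close>, where \<open>kernel_integral_bound\<close> applies uniformly in the
  radius.
\<close>

lemma factor_perturbation_small:
  assumes F: "F holomorphic_on ball 0 \<rho>" "1 < \<rho>" and k: "real k * p < 1" "0 < p" and \<zeta>: "norm \<zeta> = 1" and \<eta>: "0 < \<eta>"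
  obtains \<epsilon>0 where "0 < \<epsilon>0" "\<forall>\<epsilon> r. 0 < \<epsilon> \<and> \<epsilon> \<le> \<epsilon>0 \<and> 0 \<le> r \<and> r < 1 \<longrightarrow>
      circ_int r (\<lambda>z. norm ((deriv ^^ k) (\<lambda>w. F w * half_plane_factor \<zeta> \<epsilon> w - F w) z) powr p) \<le> \<eta>"
proof -
  define \<sigma> where "\<sigma> = (1 + \<rho>) / 2"
  have \<sigma>: "1 < \<sigma>" "\<sigma> < \<rho>" using F by (auto simp: \<sigma>_def)
  have "bounded (F ` cball 0 \<sigma>)"
    by (intro compact_imp_bounded compact_continuous_image continuous_on_subset[OF holomorphic_on_imp_continuous_on[OF F(1)]])
       (use \<sigma> in auto)
  then obtain B where "\<forall>w\<in>cball 0 \<sigma>. norm (F w) \<le> B" unfolding bounded_iff by blast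
  then have B: "norm (F w) \<le> \<bar>B\<bar>" if "norm w \<le> \<sigma>" for w
    using that by (intro order_trans[OF _ abs_ge_self]) simp
  \<comment> \<open>Since the denominator is at most \<open>3\<close>, discs of \<open>c\<close> times its size stay in the disc of radius \<open>\<sigma>\<close>.\<close>
  define c where "c = min (1 / 2) ((\<sigma> - 1) / 3)"
  have c: "0 < c" "c \<le> 1 / 2" "c * 3 \<le> \<sigma> - 1" using \<sigma> by (auto simp: c_def min_def)
  define K where "K = fact k * (4 * \<bar>B\<bar>) / c ^ k"
  have K: "0 \<le> K" using c by (simp add: K_def)
  define s where "s = min p ((1 - real k * p) / 2)"
  have s: "0 < s" "s \<le> p" "real k * p + s < 1"
    using k by (auto simp: s_def min_def field_simps)
  define T where "T = 2 * pi / cos ((real k * p + s) * pi / 2)"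
  have main: "circ_int r (\<lambda>z. norm ((deriv ^^ k) (\<lambda>w. F w * half_plane_factor \<zeta> \<epsilon> w - F w) z) powr p) \<le> K powr p * \<epsilon> powr s * T"
    if \<epsilon>: "0 < \<epsilon>" "\<epsilon> \<le> 1" and r: "0 \<le> r" "r < 1" for \<epsilon> r
  proof -
    let ?H = "\<lambda>w. F w * half_plane_factor \<zeta> \<epsilon> w - F w"
    let ?D = "\<lambda>z. norm (of_real (1 + \<epsilon>) - cnj \<zeta> * z)"
    have hol: "?H holomorphic_on ball 0 (min \<rho> (1 + \<epsilon>))"
      by (intro holomorphic_intros holomorphic_on_subset[OF F(1)]
           holomorphic_on_subset[OF half_plane_factor_holomorphic[OF \<zeta> \<epsilon>(1)]]) auto
    have hol1: "?H holomorphic_on ball 0 1" by (rule holomorphic_on_subset[OF hol]) (use F \<epsilon> in auto)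
    have pt: "norm ((deriv ^^ k) ?H z) \<le> K * \<epsilon> / ?D z ^ Suc k" if z: "norm z < 1" for z
    proof -
      have D: "0 < ?D z" "?D z \<le> 3"
      proof -
        show "0 < ?D z" using half_plane_denominator(1)[OF \<zeta> \<epsilon>(1), of z] z \<epsilon> by linarith
        have "?D z \<le> norm (of_real (1 + \<epsilon>) :: complex) + norm (cnj \<zeta> * z)" by (rule norm_triangle_ineq4)
        also have "\<dots> = (1 + \<epsilon>) + norm z" using \<epsilon> \<zeta> by (simp add: norm_mult del: of_real_add)
        finally show "?D z \<le> 3" using \<epsilon> z by linarith
      qed
      define \<delta> where "\<delta> = c * ?D z"
      have \<delta>: "0 < \<delta>" "\<delta> \<le> ?D z / 2" "\<delta> \<le> \<sigma> - 1"
      proof -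
        show "0 < \<delta>" using c D by (simp add: \<delta>_def)
        show "\<delta> \<le> ?D z / 2" using mult_right_mono[OF c(2), of "?D z"] by (simp add: \<delta>_def)
        have "\<delta> \<le> c * 3" using c D by (simp add: \<delta>_def)
        then show "\<delta> \<le> \<sigma> - 1" using c by linarith
      qed
      have near: "norm w < \<sigma>" "?D z / 2 \<le> ?D w" if w: "norm (z - w) \<le> \<delta>" for w
      proof -
        have "norm w \<le> norm z + norm (z - w)" by (metis norm_minus_commute norm_triangle_sub)
        then show "norm w < \<sigma>" using w z \<delta>(3) by linarith
        have "of_real (1 + \<epsilon>) - cnj \<zeta> * z = (of_real (1 + \<epsilon>) - cnj \<zeta> * w) + cnj \<zeta> * (w - z)" by (simp add: algebra_simps)
        then have "?D z \<le> ?D w + norm (cnj \<zeta> * (w - z))" by (metis norm_triangle_ineq)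
        also have "norm (cnj \<zeta> * (w - z)) = norm (z - w)" using \<zeta> by (simp add: norm_mult norm_minus_commute)
        finally have "?D z \<le> ?D w + norm (z - w)" .
        then show "?D z / 2 \<le> ?D w" using w \<delta>(2) by linarith
      qed
      have Heq: "?H w = F w * (- of_real (2 * \<epsilon>) / (of_real (1 + \<epsilon>) - cnj \<zeta> * w))" if w: "norm (z - w) \<le> \<delta>" for w
      proof -
        have "of_real (1 + \<epsilon>) - cnj \<zeta> * w \<noteq> 0" using near(2)[OF w] D by auto
        from half_plane_factor_minus_one[OF this]
        have "F w * (half_plane_factor \<zeta> \<epsilon> w - 1) = F w * (- of_real (2 * \<epsilon>) / (of_real (1 + \<epsilon>) - cnj \<zeta> * w))" by simp
        then show ?thesis by (simp add: algebra_simps)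
      qed
      have hz: "?H holomorphic_on cball z \<delta>"
      proof -
        have "(\<lambda>w. F w * (- of_real (2 * \<epsilon>) / (of_real (1 + \<epsilon>) - cnj \<zeta> * w))) holomorphic_on cball z \<delta>"
        proof (intro holomorphic_intros holomorphic_on_subset[OF F(1)])
          show "cball z \<delta> \<subseteq> ball 0 \<rho>"
          proof
            fix w assume "w \<in> cball z \<delta>"
            then have "norm w < \<sigma>" by (intro near(1)) (simp add: dist_norm)
            then show "w \<in> ball 0 \<rho>" using \<sigma> by simp
          qed
          show "of_real (1 + \<epsilon>) - cnj \<zeta> * w \<noteq> 0" if "w \<in> cball z \<delta>" for w
            using near(2)[of w] that D by (auto simp: dist_norm)
        qed
        then show ?thesis by (rule holomorphic_transform) (use Heq in \<open>auto simp: dist_norm\<close>)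
      qed
      have "norm ((deriv ^^ k) ?H z) \<le> fact k * (4 * \<bar>B\<bar> * \<epsilon> / ?D z) / \<delta> ^ k"
      proof (rule Cauchy_inequality)
        show "?H holomorphic_on ball z \<delta>" by (rule holomorphic_on_subset[OF hz]) auto
        show "continuous_on (cball z \<delta>) ?H" by (rule holomorphic_on_imp_continuous_on[OF hz])
        fix w assume w: "norm (z - w) = \<delta>"
        have "norm (?H w) = norm (F w) * (2 * \<epsilon> / ?D w)"
          unfolding Heq[OF eq_refl[OF w]] using \<epsilon> by (simp add: norm_mult norm_divide)
        also have "\<dots> \<le> \<bar>B\<bar> * (2 * \<epsilon> / (?D z / 2))"
        proof (intro mult_mono divide_left_mono)
          show "norm (F w) \<le> \<bar>B\<bar>" using B[of w] near(1)[of w] w by simp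
          show "?D z / 2 \<le> ?D w" using near(2)[of w] w by simp
          then show "0 < ?D w * (?D z / 2)" using D by (intro mult_pos_pos) linarith+
        qed (use \<epsilon> D in auto)
        finally show "norm (?H w) \<le> 4 * \<bar>B\<bar> * \<epsilon> / ?D z" by (simp add: mult_ac)
      qed (use \<delta> in auto)
      also have "\<dots> = K * \<epsilon> / ?D z ^ Suc k"
        using c D by (simp add: K_def \<delta>_def power_mult_distrib field_simps)
      finally show ?thesis .
    qed
    have pt2: "norm ((deriv ^^ k) ?H z) powr p \<le> K powr p * \<epsilon> powr s * norm (1 - cnj \<zeta> * z) powr (- (real k * p + s))"
      if z: "norm z < 1" for z
    proof -
      have D: "\<epsilon> \<le> ?D z" "norm (1 - cnj \<zeta> * z) \<le> ?D z" using half_plane_denominator[OF \<zeta> \<epsilon>(1), of z] z by auto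
      have Dpos: "0 < ?D z" using D \<epsilon> by linarith
      have w0: "0 < norm (1 - cnj \<zeta> * z)"
      proof -
        have "norm (cnj \<zeta> * z) < 1" using z \<zeta> by (simp add: norm_mult)
        then have "cnj \<zeta> * z \<noteq> 1" by auto
        then show ?thesis by simp
      qed
      have "norm ((deriv ^^ k) ?H z) powr p \<le> (K * \<epsilon> / ?D z ^ Suc k) powr p"
        using pt[OF z] k by (intro powr_mono2) auto
      also have "\<dots> = K powr p * (\<epsilon> powr p * ?D z powr (- (real (Suc k) * p)))"
      proof -
        have "?D z ^ Suc k = ?D z powr real (Suc k)" by (rule powr_realpow[symmetric, OF Dpos])
        then show ?thesis using K \<epsilon> Dpos
          by (simp only: powr_divide powr_mult powr_powr powr_minus_divide) (simp add: powr_minus_divide powr_powr)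
      qed
      also have "\<epsilon> powr p * ?D z powr (- (real (Suc k) * p)) \<le> \<epsilon> powr s * ?D z powr (- (real k * p + s))"
      proof -
        have "\<epsilon> powr p = \<epsilon> powr s * \<epsilon> powr (p - s)" by (simp add: powr_add[symmetric])
        also have "\<dots> \<le> \<epsilon> powr s * ?D z powr (p - s)" using D \<epsilon> s by (intro mult_left_mono powr_mono2) auto
        finally have "\<epsilon> powr p * ?D z powr (- (real (Suc k) * p)) \<le> \<epsilon> powr s * ?D z powr (p - s) * ?D z powr (- (real (Suc k) * p))"
          by (intro mult_right_mono) auto
        also have "\<dots> = \<epsilon> powr s * ?D z powr ((p - s) + (- (real (Suc k) * p)))" by (simp only: powr_add mult.assoc)
        also have "(p - s) + (- (real (Suc k) * p)) = - (real k * p + s)" by (simp add: algebra_simps)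
        finally show ?thesis .
      qed
      also have "?D z powr (- (real k * p + s)) \<le> norm (1 - cnj \<zeta> * z) powr (- (real k * p + s))"
      proof (rule powr_mono2')
        have "0 \<le> real k * p" using k by simp
        then show "- (real k * p + s) \<le> 0" using s(1) by linarith
      qed (use D w0 in auto)
      finally show ?thesis using K by (simp add: mult_left_mono mult.assoc)
    qed
    define c' where "c' = of_real r * cnj \<zeta>"
    have c': "norm c' < 1" using r \<zeta> by (simp add: c'_def norm_mult)
    have nzc: "norm (1 - c' * cis t) \<noteq> 0" for t
    proof
      assume "norm (1 - c' * cis t) = 0"
      then have "norm (c' * cis t) = 1" by simp
      then show False using c' by (simp add: norm_mult)
    qed
    have ceq: "1 - cnj \<zeta> * (of_real r * cis t) = 1 - c' * cis t" for t by (simp add: c'_def mult_ac)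
    have "circ_int r (\<lambda>z. norm ((deriv ^^ k) ?H z) powr p)
        \<le> integral {0..2*pi} (\<lambda>t. K powr p * \<epsilon> powr s * norm (1 - c' * cis t) powr (- (real k * p + s)))"
      unfolding circ_int_def
    proof (rule integral_le)
      have "continuous_on (sphere 0 r) (\<lambda>z. norm ((deriv ^^ k) ?H z) powr p)"
        by (intro continuous_on_norm_powr continuous_on_circle holomorphic_higher_deriv hol1 open_ball r k)
      then show "(\<lambda>t. norm ((deriv ^^ k) ?H (of_real r * cis t)) powr p) integrable_on {0..2*pi}"
        by (rule circ_integrable) (rule r)
      show "(\<lambda>t. K powr p * \<epsilon> powr s * norm (1 - c' * cis t) powr (- (real k * p + s))) integrable_on {0..2*pi}"
        by (intro integrable_continuous_real continuous_intros) (use nzc in auto)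
      show "norm ((deriv ^^ k) ?H (of_real r * cis t)) powr p
          \<le> K powr p * \<epsilon> powr s * norm (1 - c' * cis t) powr (- (real k * p + s))" for t
        using pt2[of "of_real r * cis t"] r unfolding ceq by (simp add: norm_mult)
    qed
    also have "\<dots> = K powr p * \<epsilon> powr s * integral {0..2*pi} (\<lambda>t. norm (1 - c' * cis t) powr (- (real k * p + s)))"
      by (rule integral_mult_right)
    also have "\<dots> \<le> K powr p * \<epsilon> powr s * T"
      unfolding T_def by (intro mult_left_mono kernel_integral_bound c') (use s k in auto)
    finally show ?thesis .
  qed
  have "((\<lambda>\<epsilon>. K powr p * \<epsilon> powr s * T) \<longlongrightarrow> K powr p * 0 powr s * T) (at_right 0)"
    by (intro tendsto_intros tendsto_powr' tendsto_ident_at) (use s in \<open>auto simp: eventually_at_right_less eventually_at intro!: exI[of _ 1]\<close>)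
  then have "((\<lambda>\<epsilon>. K powr p * \<epsilon> powr s * T) \<longlongrightarrow> 0) (at_right 0)" using s by simp
  then have "\<forall>\<^sub>F \<epsilon> in at_right 0. K powr p * \<epsilon> powr s * T < \<eta>" by (rule order_tendstoD) (rule \<eta>)
  then obtain b where b: "0 < b" "\<And>\<epsilon>. 0 < \<epsilon> \<Longrightarrow> \<epsilon> < b \<Longrightarrow> K powr p * \<epsilon> powr s * T < \<eta>"
    unfolding eventually_at_right_field by auto
  show ?thesis
  proof (rule that[of "min 1 (b / 2)"])
    show "\<forall>\<epsilon> r. 0 < \<epsilon> \<and> \<epsilon> \<le> min 1 (b / 2) \<and> 0 \<le> r \<and> r < 1 \<longrightarrow>
      circ_int r (\<lambda>z. norm ((deriv ^^ k) (\<lambda>w. F w * half_plane_factor \<zeta> \<epsilon> w - F w) z) powr p) \<le> \<eta>"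
    proof (intro allI impI)
      fix \<epsilon> r :: real assume *: "0 < \<epsilon> \<and> \<epsilon> \<le> min 1 (b / 2) \<and> 0 \<le> r \<and> r < 1"
      then have "K powr p * \<epsilon> powr s * T < \<eta>" using b(1) by (intro b(2)) auto
      then show "circ_int r (\<lambda>z. norm ((deriv ^^ k) (\<lambda>w. F w * half_plane_factor \<zeta> \<epsilon> w - F w) z) powr p) \<le> \<eta>"
        using main[of \<epsilon> r] * by force
    qed
  qed (use b in auto)
qed

lemma circ_int_limit_le:
  assumes u: "\<And>n. continuous_on (sphere 0 r) (u n)" "continuous_on (sphere 0 r) v" "0 \<le> r"
    and nonneg: "\<And>n z. norm z = r \<Longrightarrow> 0 \<le> u n z"
    and lim: "\<And>z. norm z = r \<Longrightarrow> (\<lambda>n. u n z) \<longlonglongrightarrow> (v z :: real)"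
    and C: "\<And>n. circ_int r (u n) \<le> C"
  shows "circ_int r v \<le> C"
proof -
  have sph: "norm (of_real r * cis t) = r" for t using u(3) by (simp add: norm_mult)
  have v0: "0 \<le> v z" if "norm z = r" for z by (rule LIMSEQ_le_const[OF lim[OF that]]) (use nonneg that in auto)
  have C0: "0 \<le> C" using C[of 0] circ_int_nonneg[OF u(1) u(3) nonneg, of 0] by linarith
  have eq: "(\<integral>\<^sup>+ t. ennreal (x (of_real r * cis t)) * indicator {0..2 * pi} t \<partial>lborel) = ennreal (circ_int r x)"
    if "continuous_on (sphere 0 r) x" "\<And>z. norm z = r \<Longrightarrow> 0 \<le> x z" for x
    unfolding circ_int_def
    by (rule nn_integral_has_integral_lebesgue'[OF _ integrable_integral[OF circ_integrable[OF that(1) u(3)]]])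
       (use that(2) sph in auto)
  have meas: "(\<lambda>t. ennreal (u n (of_real r * cis t)) * indicator {0..2 * pi} t) \<in> borel_measurable lborel" for n
  proof -
    have "(\<lambda>t. u n (of_real r * cis t)) \<in> borel_measurable borel"
      by (intro borel_measurable_continuous_onI circ_continuous u)
    then show ?thesis by simp
  qed
  have "ennreal (circ_int r v) = (\<integral>\<^sup>+ t. ennreal (v (of_real r * cis t)) * indicator {0..2 * pi} t \<partial>lborel)"
    by (rule eq[OF u(2) v0, symmetric])
  also have "\<dots> \<le> (\<integral>\<^sup>+ t. liminf (\<lambda>n. ennreal (u n (of_real r * cis t)) * indicator {0..2 * pi} t) \<partial>lborel)"
  proof (rule nn_integral_mono)
    fix t :: real
    have "(\<lambda>n. ennreal (u n (of_real r * cis t))) \<longlonglongrightarrow> ennreal (v (of_real r * cis t))"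
      by (intro tendsto_ennrealI lim sph)
    then show "ennreal (v (of_real r * cis t)) * indicator {0..2 * pi} t
        \<le> liminf (\<lambda>n. ennreal (u n (of_real r * cis t)) * indicator {0..2 * pi} t)"
      using lim_imp_Liminf[of sequentially "\<lambda>n. ennreal (u n (of_real r * cis t))"]
      by (cases "t \<in> {0..2 * pi}") auto
  qed
  also have "\<dots> \<le> liminf (\<lambda>n. \<integral>\<^sup>+ t. ennreal (u n (of_real r * cis t)) * indicator {0..2 * pi} t \<partial>lborel)"
    by (rule nn_integral_liminf[OF meas])
  also have "\<dots> \<le> liminf (\<lambda>n. ennreal C)"
    by (rule Liminf_mono) (use eq[OF u(1) nonneg] C in \<open>simp add: ennreal_leI\<close>)
  also have "\<dots> = ennreal C" by (simp add: Liminf_const)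
  finally show ?thesis using C0 by simp
qed

lemma norm_cis_diff_le: "norm (cis a - cis b) \<le> \<bar>a - b\<bar>"
proof -
  have "cis a - cis b = cis b * (cis (a - b) - 1)" by (simp add: right_diff_distrib cis_mult)
  then have "norm (cis a - cis b) = norm (cis (a - b) - 1)" by (simp add: norm_mult)
  also have "\<dots> = 2 * \<bar>sin ((a - b) / 2)\<bar>" unfolding cis_conv_exp by (rule dist_exp_i_1)
  also have "\<dots> \<le> \<bar>a - b\<bar>" using abs_sin_x_le_abs_x[of "(a - b) / 2"] by simp
  finally show ?thesis .
qed

text \<open>
  The points are \<open>cis (a / (b + 1))\<close>, enumerated by the pairs \<open>(a,
  b)\<close>. The index of a pair is at least \<open>b\<close>, so every arc contains points of
  arbitrarily large index.
\<close>

lemma circle_points_dense: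
  obtains \<zeta> :: "nat \<Rightarrow> complex" where "\<forall>j. norm (\<zeta> j) = 1"
    "\<forall>t e N. 0 \<le> t \<and> 0 < e \<longrightarrow> (\<exists>j\<ge>N. dist (cis t) (\<zeta> j) < e)"
proof -
  define \<zeta> where "\<zeta> = (\<lambda>j. cis (real (fst (prod_decode j)) / real (Suc (snd (prod_decode j)))))"
  have "\<exists>j\<ge>N. dist (cis t) (\<zeta> j) < e" if t: "0 \<le> t" and e: "0 < e" for t e N
  proof -
    obtain n0 where n0: "1 / real (Suc n0) < e" using nat_approx_posE[OF e] by blast
    define b where "b = max n0 N"
    define a where "a = nat \<lfloor>t * real (Suc b)\<rfloor>"
    define j where "j = prod_encode (a, b)"
    have "b \<le> j" unfolding j_def by (rule le_prod_encode_2)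
    then have "N \<le> j" by (simp add: b_def)
    have a: "real a \<le> t * real (Suc b)" "t * real (Suc b) < real a + 1"
      unfolding a_def using t by (auto simp: of_nat_nat mult_nonneg_nonneg; linarith)+
    have "\<bar>t - real a / real (Suc b)\<bar> \<le> 1 / real (Suc b)"
    proof -
      have "real a / real (Suc b) \<le> t" using a(1) by (simp add: pos_divide_le_eq del: of_nat_Suc)
      moreover have "t \<le> (real a + 1) / real (Suc b)" using a(2) by (simp add: pos_le_divide_eq del: of_nat_Suc)
      ultimately show ?thesis by (simp add: add_divide_distrib del: of_nat_Suc)
    qed
    also have "\<dots> \<le> 1 / real (Suc n0)" by (intro divide_left_mono) (auto simp: b_def)
    finally have d: "\<bar>t - real a / real (Suc b)\<bar> < e" using n0 by linarith
    have "dist (cis t) (\<zeta> j) = norm (cis t - cis (real a / real (Suc b)))" by (simp add: \<zeta>_def j_def dist_norm)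
    also have "\<dots> \<le> \<bar>t - real a / real (Suc b)\<bar>"
      by (rule norm_cis_diff_le)
    finally show ?thesis using d \<open>N \<le> j\<close> by (intro exI[of _ j]) auto
  qed
  then show ?thesis using that[of \<zeta>] by (simp add: \<zeta>_def)
qed

lemma not_bc_set_of_dense_boundary:
  assumes E: "E \<noteq> {}" "\<And>t. 0 \<le> t \<Longrightarrow> infdist (cis t) E = 0"
  shows "\<not> bc_set E"
proof -
  have "(\<integral>\<^sup>+ t\<in>{0..2 * pi}. e2ennreal (- ext_log (infdist (cis t) E)) \<partial>lborel)
      = (\<integral>\<^sup>+ t. Orderings.top * indicator {0..2 * pi} t \<partial>lborel)"
    by (rule nn_integral_cong) (use E(2) in \<open>auto simp: ext_log_def indicator_def\<close>)
  also have "\<dots> = Orderings.top * emeasure lborel {0..2 * pi}" by (rule nn_integral_cmult_indicator) simp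
  also have "\<dots> = Orderings.top" by (simp add: ennreal_top_mult)
  finally have b: "(\<integral>\<^sup>+ t\<in>{0..2 * pi}. e2ennreal (- ext_log (infdist (cis t) E)) \<partial>lborel) = Orderings.top" .
  have "(\<integral>\<^sup>+ t\<in>{0..2 * pi}. e2ennreal (ext_log (infdist (cis t) E)) \<partial>lborel) = (\<integral>\<^sup>+ t. 0 \<partial>(lborel :: real measure))"
    by (rule nn_integral_cong) (use E(2) in \<open>auto simp: ext_log_def indicator_def e2ennreal_neg\<close>)
  then have a: "(\<integral>\<^sup>+ t\<in>{0..2 * pi}. e2ennreal (ext_log (infdist (cis t) E)) \<partial>lborel) = 0" by simp
  have "circle_integral (\<lambda>\<zeta>. ext_log (infdist \<zeta> E)) = - \<infinity>"
    unfolding circle_integral_def a b by (simp add: zero_ennreal.rep_eq top_ennreal.rep_eq)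
  then show ?thesis using E(1) by (simp add: bc_set_def)
qed

lemma powr_add_le:
  fixes a b p :: real
  assumes "0 \<le> a" "0 \<le> b" "0 < p" "p \<le> 1"
  shows "(a + b) powr p \<le> a powr p + b powr p"
proof (cases "a + b = 0")
  case False
  then have ab: "0 < a + b" using assms by linarith
  have *: "x / (a + b) \<le> (x / (a + b)) powr p" if "0 \<le> x" "x \<le> a + b" for x
  proof (cases "x = 0")
    case False
    then have "(x / (a + b)) powr 1 \<le> (x / (a + b)) powr p"
      using that assms ab by (intro powr_mono') auto
    then show ?thesis using that ab by simp
  qed simp
  have "a / (a + b) + b / (a + b) = 1" using ab by (simp add: add_divide_distrib[symmetric])
  then have "1 \<le> (a / (a + b)) powr p + (b / (a + b)) powr p"
    using *[of a] *[of b] assms by linarith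
  also have "\<dots> = (a powr p + b powr p) / (a + b) powr p"
    using assms ab by (simp add: powr_divide add_divide_distrib)
  finally show ?thesis using ab by (simp add: pos_le_divide_eq)
qed (use assms in auto)

lemma hardy_cong:
  assumes f: "f \<in> hardy p" and eq: "\<And>z. norm z < 1 \<Longrightarrow> g z = f z"
  shows "g \<in> hardy p"
proof -
  obtain A where hol: "f holomorphic_on ball 0 1"
    and A: "0 \<le> A" "\<forall>r. 0 \<le> r \<and> r < 1 \<longrightarrow> circ_int r (\<lambda>z. norm (f z) powr p) \<le> A"
    using f unfolding hardy_circ_int by blast
  have "circ_int r (\<lambda>z. norm (g z) powr p) = circ_int r (\<lambda>z. norm (f z) powr p)" if "0 \<le> r" "r < 1" for r
    by (rule circ_int_cong) (use eq that in auto)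
  moreover have "g holomorphic_on ball 0 1" by (rule holomorphic_transform[OF hol]) (use eq in auto)
  ultimately show ?thesis unfolding hardy_circ_int using A by auto
qed

lemma hardy_derivs:
  assumes f: "f \<in> hardy_deriv p m" and p: "0 < p" and i: "i \<le> m"
  shows "(deriv ^^ i) f \<in> hardy p"
  using i
proof (induction i rule: inc_induct)
  case base
  then show ?case using f by (simp add: hardy_deriv_def)
next
  case (step i)
  have "f holomorphic_on ball 0 1" using f by (simp add: hardy_deriv_def)
  then show ?case
    by (intro hardy_primitive[OF holomorphic_higher_deriv[OF _ open_ball] _ p]) (use step in auto)
qed

text \<open>
  Starting from the constant \<open>1\<close>, multiply in step \<open>n\<close> by a half-plane
  factor with its zero near \<open>\<zeta>\<^sub>n\<close>, choosing
  \<open>\<epsilon>\<^sub>n\<close> so small that the change in \<open>H\<^sup>p\<close> of the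
  \<open>k\<close>-th derivative and the change on compact subsets of the disc are summable. For
  \<open>k \<ge> 1\<close> the exponent \<open>p\<close> is less than \<open>1\<close> and the
  \<open>p\<close>-th powers are subadditive; for \<open>k = 0\<close> all partial products are
  bounded by \<open>1\<close>.
\<close>

lemma exists_accumulating_zeros:
  assumes k: "real k * p < 1" and p: "0 < p"
  obtains G where "G holomorphic_on ball 0 1" "(deriv ^^ k) G \<in> hardy p" "G 0 \<noteq> 0"
    "\<forall>t\<ge>0. infdist (cis t) {z \<in> ball 0 1. G z = 0} = 0" "{z \<in> ball 0 1. G z = 0} \<noteq> {}"
proof -
  obtain \<zeta> :: "nat \<Rightarrow> complex" where \<zeta>: "\<forall>j. norm (\<zeta> j) = 1"
    "\<forall>t e N. 0 \<le> t \<and> 0 < e \<longrightarrow> (\<exists>j\<ge>N. dist (cis t) (\<zeta> j) < e)"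
    by (rule circle_points_dense)
  \<comment> \<open>The bound \<open>(1 / 2)\<^bsup>n+3\<^esup>\<close> for \<open>\<epsilon>\<^sub>n\<close> keeps the values at \<open>0\<close> within \<open>1 / 2\<close> of \<open>1\<close>, so the limit is not zero.\<close>
  define P where "P = (\<lambda>n F. (\<exists>\<rho>>1. F holomorphic_on ball 0 \<rho>) \<and> (\<forall>z. norm z \<le> 1 \<longrightarrow> norm (F z) \<le> 1) \<and>
      (n = (0::nat) \<longrightarrow> F = (\<lambda>_. 1 :: complex)))"
  define Q where "Q = (\<lambda>n F F'. \<exists>\<epsilon>. 0 < \<epsilon> \<and> \<epsilon> \<le> (1 / 2) ^ (n + 3) \<and> F' = (\<lambda>z. F z * half_plane_factor (\<zeta> n) \<epsilon> z) \<and>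
      (\<forall>r. 0 \<le> r \<and> r < 1 \<longrightarrow> circ_int r (\<lambda>z. norm ((deriv ^^ k) (\<lambda>w. F' w - F w) z) powr p) \<le> (1 / 2) ^ n))"
  have "\<exists>F. \<forall>n. P n (F n) \<and> Q n (F n) (F (Suc n))"
  proof (rule dependent_nat_choice)
    show "\<exists>F. P 0 F" by (rule exI[of _ "\<lambda>_. 1"]) (auto simp: P_def intro!: exI[of _ 2])
    fix F n assume PF: "P n F"
    then obtain \<rho> where \<rho>: "1 < \<rho>" "F holomorphic_on ball 0 \<rho>" by (auto simp: P_def)
    have \<eta>: "0 < (1 / 2 :: real) ^ n" by simp
    obtain \<epsilon>0 where \<epsilon>0: "0 < \<epsilon>0" "\<forall>\<epsilon> r. 0 < \<epsilon> \<and> \<epsilon> \<le> \<epsilon>0 \<and> 0 \<le> r \<and> r < 1 \<longrightarrow>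
      circ_int r (\<lambda>z. norm ((deriv ^^ k) (\<lambda>w. F w * half_plane_factor (\<zeta> n) \<epsilon> w - F w) z) powr p) \<le> (1 / 2) ^ n"
      by (rule factor_perturbation_small[OF \<rho>(2,1) k p \<zeta>(1)[rule_format] \<eta>])
    define \<epsilon> where "\<epsilon> = min \<epsilon>0 ((1 / 2) ^ (n + 3))"
    have \<epsilon>: "0 < \<epsilon>" "\<epsilon> \<le> \<epsilon>0" "\<epsilon> \<le> (1 / 2) ^ (n + 3)" using \<epsilon>0 by (auto simp: \<epsilon>_def)
    define F' where "F' = (\<lambda>z. F z * half_plane_factor (\<zeta> n) \<epsilon> z)"
    have "F' holomorphic_on ball 0 (min \<rho> (1 + \<epsilon>))"
      unfolding F'_def by (intro holomorphic_intros holomorphic_on_subset[OF \<rho>(2)]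
           holomorphic_on_subset[OF half_plane_factor_holomorphic[OF \<zeta>(1)[rule_format] \<epsilon>(1)]]) auto
    moreover have "1 < min \<rho> (1 + \<epsilon>)" using \<rho> \<epsilon> by simp
    moreover have "norm (F' z) \<le> 1" if z: "norm z \<le> 1" for z
    proof -
      have d: "\<epsilon> \<le> norm (of_real (1 + \<epsilon>) - cnj (\<zeta> n) * z)"
        "norm (of_real (1 - \<epsilon>) - cnj (\<zeta> n) * z) \<le> norm (of_real (1 + \<epsilon>) - cnj (\<zeta> n) * z)"
        using half_plane_denominator[OF \<zeta>(1)[rule_format] \<epsilon>(1) z] by auto
      have "norm (half_plane_factor (\<zeta> n) \<epsilon> z) \<le> 1"
        unfolding half_plane_factor_def norm_divide using d \<epsilon>(1) by (subst divide_le_eq_1_pos) linarith+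
      moreover have "norm (F z) \<le> 1" using PF z by (auto simp: P_def)
      ultimately show ?thesis unfolding F'_def norm_mult by (intro mult_le_one) auto
    qed
    ultimately have "P (Suc n) F'" unfolding P_def by blast
    moreover have "Q n F F'" unfolding Q_def F'_def using \<epsilon> \<epsilon>0(2) by (intro exI[of _ \<epsilon>]) auto
    ultimately show "\<exists>F'. P (Suc n) F' \<and> Q n F F'" by blast
  qed
  then obtain F where PF: "\<And>n. P n (F n)" and QF: "\<And>n. Q n (F n) (F (Suc n))" by blast
  have F0: "F 0 = (\<lambda>_. 1)" using PF[of 0] by (simp add: P_def)
  have Fle: "norm (F n z) \<le> 1" if "norm z \<le> 1" for n z using PF[of n] that by (simp add: P_def)
  have Fhol: "F n holomorphic_on ball 0 1" for n
  proof -
    obtain \<rho> where \<rho>: "1 < \<rho>" "F n holomorphic_on ball 0 \<rho>" using PF[of n] by (auto simp: P_def)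
    show ?thesis by (rule holomorphic_on_subset[OF \<rho>(2)]) (use \<rho> in auto)
  qed
  define S where "S = (\<lambda>n \<epsilon>. 0 < \<epsilon> \<and> \<epsilon> \<le> (1 / 2) ^ (n + 3) \<and> F (Suc n) = (\<lambda>z. F n z * half_plane_factor (\<zeta> n) \<epsilon> z) \<and>
      (\<forall>r. 0 \<le> r \<and> r < 1 \<longrightarrow> circ_int r (\<lambda>z. norm ((deriv ^^ k) (\<lambda>w. F (Suc n) w - F n w) z) powr p) \<le> (1 / 2) ^ n))"
  have "\<forall>n. \<exists>\<epsilon>. S n \<epsilon>" using QF unfolding Q_def S_def by (rule allI)
  then obtain \<epsilon> where S: "\<forall>n. S n (\<epsilon> n)" by (rule choice[THEN exE])
  have \<epsilon>: "\<And>n. 0 < \<epsilon> n" "\<And>n. \<epsilon> n \<le> (1 / 2) ^ (n + 3)"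
    and FS: "\<And>n. F (Suc n) = (\<lambda>z. F n z * half_plane_factor (\<zeta> n) (\<epsilon> n) z)"
    and small: "\<And>n r. 0 \<le> r \<Longrightarrow> r < 1 \<Longrightarrow> circ_int r (\<lambda>z. norm ((deriv ^^ k) (\<lambda>w. F (Suc n) w - F n w) z) powr p) \<le> (1 / 2) ^ n"
    using S unfolding S_def by blast+
  have \<epsilon>1: "\<epsilon> n < 1" for n
  proof -
    have "(1 / 2 :: real) ^ (n + 3) \<le> (1 / 2) ^ 1" by (intro power_decreasing) auto
    then show ?thesis using \<epsilon>(2)[of n] by simp
  qed
  have diff: "norm (F (Suc n) z - F n z) \<le> 2 * \<epsilon> n / (1 - norm z)" if z: "norm z < 1" for n z
  proof -
    have d: "\<epsilon> n \<le> norm (of_real (1 + \<epsilon> n) - cnj (\<zeta> n) * z)"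
      "norm (1 - cnj (\<zeta> n) * z) \<le> norm (of_real (1 + \<epsilon> n) - cnj (\<zeta> n) * z)"
      using half_plane_denominator[OF \<zeta>(1)[rule_format] \<epsilon>(1), of z n n] z by auto
    have "1 - norm z \<le> norm (1 - cnj (\<zeta> n) * z)"
      using norm_triangle_ineq2[of 1 "cnj (\<zeta> n) * z"] \<zeta>(1) by (simp add: norm_mult)
    then have d2: "1 - norm z \<le> norm (of_real (1 + \<epsilon> n) - cnj (\<zeta> n) * z)" using d by linarith
    have nz: "of_real (1 + \<epsilon> n) - cnj (\<zeta> n) * z \<noteq> 0" using d(1) \<epsilon>(1)[of n] by auto
    have "F (Suc n) z - F n z = F n z * (half_plane_factor (\<zeta> n) (\<epsilon> n) z - 1)" by (simp add: FS algebra_simps)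
    then have "norm (F (Suc n) z - F n z) = norm (F n z) * norm (half_plane_factor (\<zeta> n) (\<epsilon> n) z - 1)"
      by (simp add: norm_mult)
    also have "\<dots> \<le> 1 * norm (half_plane_factor (\<zeta> n) (\<epsilon> n) z - 1)"
      using Fle[of z n] z by (intro mult_right_mono) auto
    also have "\<dots> = 2 * \<epsilon> n / norm (of_real (1 + \<epsilon> n) - cnj (\<zeta> n) * z)"
      unfolding half_plane_factor_minus_one[OF nz] norm_divide norm_minus_cancel norm_of_real
      using \<epsilon>(1)[of n] by simp
    also have "\<dots> \<le> 2 * \<epsilon> n / (1 - norm z)"
      by (rule divide_left_mono[OF d2]) (use \<epsilon>(1)[of n] z d2 in \<open>auto intro!: mult_pos_pos\<close>)
    finally show ?thesis .
  qed
  obtain G where G: "G holomorphic_on ball 0 1"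
    and Glim: "\<forall>k. \<forall>z\<in>ball 0 1. (\<lambda>n. (deriv ^^ k) (F n) z) \<longlonglongrightarrow> (deriv ^^ k) G z"
  proof (rule locally_uniform_limit[OF Fhol])
    fix r :: real assume r: "0 \<le> r" "r < 1"
    show "\<exists>a. summable a \<and> (\<forall>n z. norm z \<le> r \<longrightarrow> norm (F (Suc n) z - F n z) \<le> a n)"
    proof (intro exI[of _ "\<lambda>n. 1 / (1 - r) * (1 / 2) ^ n"] conjI allI impI)
      show "summable (\<lambda>n. 1 / (1 - r) * (1 / 2) ^ n)" by (intro summable_mult summable_geometric) auto
      fix n and z :: complex assume z: "norm z \<le> r"
      have "norm (F (Suc n) z - F n z) \<le> 2 * \<epsilon> n / (1 - norm z)" by (rule diff) (use z r in simp)
      also have "\<dots> \<le> (1 / 2) ^ n / (1 - r)"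
      proof (rule frac_le)
        have "(1 / 2 :: real) ^ (n + 3) = (1 / 2) ^ n / 8" by (simp add: power_add eval_nat_numeral)
        moreover have "0 \<le> (1 / 2 :: real) ^ n" by simp
        ultimately show "2 * \<epsilon> n \<le> (1 / 2) ^ n" using \<epsilon>(2)[of n] by linarith
      qed (use z r in auto)
      finally show "norm (F (Suc n) z - F n z) \<le> 1 / (1 - r) * (1 / 2) ^ n" by simp
    qed
  qed
  have lim: "(\<lambda>n. F n z) \<longlonglongrightarrow> G z" if "norm z < 1" for z
    using Glim[rule_format, of z 0] that by simp
  have G0: "G 0 \<noteq> 0"
  proof -
    have "norm (F n 0 - 1) \<le> 1 / 2 - (1 / 2) ^ (n + 1)" for n
    proof (induction n)
      case 0
      then show ?case by (simp add: F0)
    next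
      case (Suc n)
      have "norm (F (Suc n) 0 - 1) \<le> norm (F (Suc n) 0 - F n 0) + norm (F n 0 - 1)"
        using norm_triangle_ineq[of "F (Suc n) 0 - F n 0" "F n 0 - 1"] by simp
      also have "\<dots> \<le> 2 * (1 / 2) ^ (n + 3) + (1 / 2 - (1 / 2) ^ (n + 1))"
        using diff[of 0 n] \<epsilon>(2)[of n] Suc.IH by (intro add_mono) auto
      also have "\<dots> = 1 / 2 - (1 / 2) ^ (Suc n + 1)" by (simp add: power_add eval_nat_numeral)
      finally show ?case .
    qed
    then have "norm (F n 0 - 1) \<le> 1 / 2" for n by (rule order_trans) simp
    moreover have "(\<lambda>n. norm (F n 0 - 1)) \<longlonglongrightarrow> norm (G 0 - 1)" by (intro tendsto_intros lim) simp
    ultimately have "norm (G 0 - 1) \<le> 1 / 2" by (intro LIMSEQ_le_const2) auto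
    then show ?thesis by auto
  qed
  have hk: "(deriv ^^ k) G \<in> hardy p"
  proof (cases "k = 0")
    case True
    have "norm (G z) \<le> 1" if z: "norm z < 1" for z
      by (rule LIMSEQ_le_const2[OF tendsto_norm[OF lim[OF z]]]) (use Fle z in auto)
    then have "G \<in> hardy p" by (intro hardyI_bounded[OF G _ p, of 1])
    then show ?thesis using True by simp
  next
    case False
    have p1: "p \<le> 1"
    proof -
      have "1 * p \<le> real k * p" using False p by (intro mult_right_mono) auto
      then show ?thesis using k by linarith
    qed
    have dhol: "(deriv ^^ k) (F n) holomorphic_on ball 0 1" for n by (rule holomorphic_higher_deriv[OF Fhol open_ball])
    have cn: "continuous_on (sphere 0 r) (\<lambda>z. norm ((deriv ^^ k) (F n) z) powr p)" if "r < 1" for n r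
      by (intro continuous_on_norm_powr continuous_on_circle dhol that p)
    have Fbound: "circ_int r (\<lambda>z. norm ((deriv ^^ k) (F n) z) powr p) \<le> 2 - 2 * (1 / 2) ^ n" if r: "0 \<le> r" "r < 1" for n r
    proof (induction n)
      case 0
      have "(deriv ^^ k) (F 0) z = 0" for z using False by (simp add: F0)
      then show ?case using p by (simp add: circ_int_const)
    next
      case (Suc n)
      let ?d = "\<lambda>z. norm ((deriv ^^ k) (\<lambda>w. F (Suc n) w - F n w) z) powr p"
      have cd: "continuous_on (sphere 0 r) ?d"
        by (intro continuous_on_norm_powr continuous_on_circle holomorphic_higher_deriv holomorphic_on_diff Fhol open_ball r p)
      have "circ_int r (\<lambda>z. norm ((deriv ^^ k) (F (Suc n)) z) powr p)
         \<le> circ_int r (\<lambda>z. norm ((deriv ^^ k) (F n) z) powr p + ?d z)"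
      proof (rule circ_int_mono)
        fix z :: complex assume "norm z = r"
        then have z: "z \<in> ball 0 1" using r by simp
        have "(deriv ^^ k) (\<lambda>w. F (Suc n) w - F n w) z = (deriv ^^ k) (F (Suc n)) z - (deriv ^^ k) (F n) z"
          by (rule higher_deriv_diff[OF Fhol Fhol open_ball z])
        then have "norm ((deriv ^^ k) (F (Suc n)) z) \<le> norm ((deriv ^^ k) (F n) z) + norm ((deriv ^^ k) (\<lambda>w. F (Suc n) w - F n w) z)"
          by (metis norm_triangle_sub)
        then have "norm ((deriv ^^ k) (F (Suc n)) z) powr p
            \<le> (norm ((deriv ^^ k) (F n) z) + norm ((deriv ^^ k) (\<lambda>w. F (Suc n) w - F n w) z)) powr p"
          using p by (intro powr_mono2) auto
        also have "\<dots> \<le> norm ((deriv ^^ k) (F n) z) powr p + ?d z" by (intro powr_add_le p p1) auto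
        finally show "norm ((deriv ^^ k) (F (Suc n)) z) powr p \<le> norm ((deriv ^^ k) (F n) z) powr p + ?d z" .
      qed (use r cn cd in \<open>auto intro!: continuous_on_add\<close>)
      also have "\<dots> = circ_int r (\<lambda>z. norm ((deriv ^^ k) (F n) z) powr p) + circ_int r ?d"
        by (rule circ_int_add[OF cn[OF r(2)] cd r(1)])
      also have "\<dots> \<le> (2 - 2 * (1 / 2) ^ n) + (1 / 2) ^ n" using Suc.IH small[OF r] by (intro add_mono)
      also have "\<dots> = 2 - 2 * (1 / 2) ^ Suc n" by simp
      finally show ?case .
    qed
    have Gk: "(deriv ^^ k) G holomorphic_on ball 0 1" by (rule holomorphic_higher_deriv[OF G open_ball])
    show ?thesis unfolding hardy_circ_int
    proof (intro conjI Gk exI[of _ 2] allI impI)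
      fix r :: real assume r: "0 \<le> r \<and> r < 1"
      show "circ_int r (\<lambda>z. norm ((deriv ^^ k) G z) powr p) \<le> 2"
      proof (rule circ_int_limit_le[where u = "\<lambda>n z. norm ((deriv ^^ k) (F n) z) powr p"])
        show "circ_int r (\<lambda>z. norm ((deriv ^^ k) (F n) z) powr p) \<le> 2" for n
          by (rule order_trans[OF Fbound]) (use r in auto)
        show "continuous_on (sphere 0 r) (\<lambda>z. norm ((deriv ^^ k) G z) powr p)"
          using r by (intro continuous_on_norm_powr continuous_on_circle Gk p) auto
        fix z :: complex assume "norm z = r"
        then have "(\<lambda>n. (deriv ^^ k) (F n) z) \<longlonglongrightarrow> (deriv ^^ k) G z" using Glim r by simp
        then show "(\<lambda>n. norm ((deriv ^^ k) (F n) z) powr p) \<longlonglongrightarrow> norm ((deriv ^^ k) G z) powr p"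
          using p by (intro tendsto_powr' tendsto_norm tendsto_const) auto
      qed (use r cn in auto)
    qed simp
  qed
  define E where "E = {z \<in> ball 0 1. G z = 0}"
  have zE: "of_real (1 - \<epsilon> n) * \<zeta> n \<in> E" for n
  proof -
    let ?z = "of_real (1 - \<epsilon> n) * \<zeta> n"
    have nz: "norm ?z = 1 - \<epsilon> n" using \<zeta>(1) \<epsilon>1[of n] by (simp only: norm_mult norm_of_real) simp
    then have z1: "norm ?z < 1" using \<epsilon>(1)[of n] by simp
    have "cnj (\<zeta> n) * \<zeta> n = 1"
      using complex_norm_square[of "\<zeta> n"] \<zeta>(1) by (simp add: mult.commute)
    then have "cnj (\<zeta> n) * ?z = of_real (1 - \<epsilon> n)" by (metis mult.left_commute mult.right_neutral)
    then have u: "half_plane_factor (\<zeta> n) (\<epsilon> n) ?z = 0" by (simp only: half_plane_factor_def) simp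
    have "F (Suc n + m) ?z = 0" for m
    proof (induction m)
      case 0
      then show ?case by (simp only: FS add_0_right u mult_zero_right)
    next
      case (Suc m)
      have "F (Suc n + Suc m) ?z = F (Suc n + m) ?z * half_plane_factor (\<zeta> (Suc n + m)) (\<epsilon> (Suc n + m)) ?z"
        unfolding add_Suc_right FS ..
      then show ?case using Suc.IH by simp
    qed
    then have "(\<lambda>m. F (m + Suc n) ?z) \<longlonglongrightarrow> 0" by (simp add: add.commute)
    then have "(\<lambda>m. F m ?z) \<longlonglongrightarrow> 0" by (rule LIMSEQ_offset)
    then have "G ?z = 0" using LIMSEQ_unique[OF lim[OF z1]] by blast
    then show ?thesis using z1 by (simp add: E_def)
  qed
  have inf0: "infdist (cis t) E = 0" if t: "0 \<le> t" for t
  proof (rule ccontr)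
    assume "infdist (cis t) E \<noteq> 0"
    then have e: "0 < infdist (cis t) E / 2" using infdist_nonneg[of "cis t" E] by simp
    obtain N where N: "(1 / 2 :: real) ^ N < infdist (cis t) E / 2"
      using real_arch_pow_inv[OF e, of "1 / 2"] by auto
    obtain j where j: "N \<le> j" "dist (cis t) (\<zeta> j) < infdist (cis t) E / 2" using \<zeta>(2) t e by blast
    have "infdist (cis t) E \<le> dist (cis t) (of_real (1 - \<epsilon> j) * \<zeta> j)" by (rule infdist_le[OF zE])
    also have "\<dots> \<le> dist (cis t) (\<zeta> j) + dist (\<zeta> j) (of_real (1 - \<epsilon> j) * \<zeta> j)" by (rule dist_triangle)
    also have "dist (\<zeta> j) (of_real (1 - \<epsilon> j) * \<zeta> j) = \<epsilon> j"
    proof -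
      have "\<zeta> j - of_real (1 - \<epsilon> j) * \<zeta> j = of_real (\<epsilon> j) * \<zeta> j" by (simp add: algebra_simps)
      then show ?thesis using \<zeta>(1) \<epsilon>(1)[of j] unfolding dist_norm by (simp add: norm_mult)
    qed
    also have "\<epsilon> j \<le> (1 / 2) ^ N"
      by (rule order_trans[OF \<epsilon>(2)]) (use j in \<open>auto intro!: power_decreasing\<close>)
    finally show False using j(2) N by linarith
  qed
  show ?thesis
  proof (rule that[OF G hk G0])
    show "\<forall>t\<ge>0. infdist (cis t) {z \<in> ball 0 1. G z = 0} = 0" using inf0 unfolding E_def by blast
    show "{z \<in> ball 0 1. G z = 0} \<noteq> {}" using zE[of 0] unfolding E_def by blast
  qed
qed

lemma exists_non_bc_set:
  assumes p: "0 < p" and nm: "n \<le> m" and m: "real m < real n + 1 / p"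
  shows "\<exists>E \<in> deep_zero_sets n (hardy_deriv p m). \<not> bc_set E"
proof -
  have "real (m - n) < 1 / p" using nm m by (simp add: of_nat_diff)
  then have k: "real (m - n) * p < 1" using p by (simp add: field_simps)
  obtain G where G: "G holomorphic_on ball 0 1" "(deriv ^^ (m - n)) G \<in> hardy p" "G 0 \<noteq> 0"
    "\<forall>t\<ge>0. infdist (cis t) {z \<in> ball 0 1. G z = 0} = 0" "{z \<in> ball 0 1. G z = 0} \<noteq> {}"
    by (rule exists_accumulating_zeros[OF k p])
  obtain g where g: "g holomorphic_on ball 0 1" "\<forall>z\<in>ball 0 1. (deriv ^^ n) g z = G z"
    by (rule iterated_primitive[OF G(1)])
  have "(deriv ^^ m) g \<in> hardy p"
  proof (rule hardy_cong[OF G(2)])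
    fix z :: complex assume z: "norm z < 1"
    have "(deriv ^^ m) g z = (deriv ^^ (m - n)) ((deriv ^^ n) g) z"
      using nm by (metis comp_apply funpow_add le_add_diff_inverse2)
    also have "\<dots> = (deriv ^^ (m - n)) G z"
      by (rule higher_deriv_transform_within_open[OF holomorphic_higher_deriv[OF g(1) open_ball] G(1) open_ball])
         (use z g(2) in auto)
    finally show "(deriv ^^ m) g z = (deriv ^^ (m - n)) G z" .
  qed
  then have mem: "{z \<in> ball 0 1. G z = 0} \<in> deep_zero_sets n (hardy_deriv p m)"
    by (rule deep_zero_sets_of_derivative_zeros[OF p g(1) _ g(2) G(3)])
  have "\<not> bc_set {z \<in> ball 0 1. G z = 0}"
    by (rule not_bc_set_of_dense_boundary[OF G(5)]) (use G(4) in blast)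
  then show ?thesis by (rule bexI[OF _ mem])
qed

section \<open>The characterizations\<close>

lemma deep_zero_setsE:
  assumes "E \<in> deep_zero_sets n X" "\<And>f. f \<in> X \<Longrightarrow> f holomorphic_on ball 0 1"
  obtains f where "\<forall>j\<le>n. f j \<in> X" "E = {z \<in> ball 0 1. wronskian (Suc n) f z = 0}"
    "wronskian (Suc n) f holomorphic_on ball 0 1" "\<exists>z\<in>ball 0 1. wronskian (Suc n) f z \<noteq> 0"
proof -
  obtain f where f: "E = deep_zero_set n f" "\<forall>j\<le>n. f j \<in> X" "lin_indep_on_disk n f"
    using assms(1) unfolding deep_zero_sets_def by blast
  have hol: "f j holomorphic_on ball 0 1" if "j < Suc n" for j using f(2) assms(2) that by (simp add: less_Suc_eq_le)
  show ?thesis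
  proof (rule that[OF f(2)])
    show "E = {z \<in> ball 0 1. wronskian (Suc n) f z = 0}"
      unfolding f(1) by (rule deep_zero_set_eq_wronskian_zeros) (simp add: hol)
    show "wronskian (Suc n) f holomorphic_on ball 0 1" by (rule wronskian_holomorphic[OF hol])
    show "\<exists>z\<in>ball 0 1. wronskian (Suc n) f z \<noteq> 0"
    proof (rule wronskian_nonzero[OF hol])
      fix c assume "\<forall>z\<in>ball 0 1. (\<Sum>j<Suc n. c j * f j z) = 0"
      then show "\<forall>j<Suc n. c j = 0"
        using f(3) unfolding lin_indep_on_disk_def lessThan_Suc_atMost less_Suc_eq_le by blast
    qed
  qed
qed

lemma blaschke_deep_zero_sets:
  assumes p: "0 < p" and m: "n \<le> m" and E: "E \<in> deep_zero_sets n (hardy_deriv p m)"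
  shows "blaschke E"
proof -
  obtain f where f: "\<forall>j\<le>n. f j \<in> hardy_deriv p m" "E = {z \<in> ball 0 1. wronskian (Suc n) f z = 0}"
    "wronskian (Suc n) f holomorphic_on ball 0 1" "\<exists>z\<in>ball 0 1. wronskian (Suc n) f z \<noteq> 0"
    by (rule deep_zero_setsE[OF E]) (simp add: hardy_deriv_def)
  have "nevanlinna (\<lambda>z. \<Sum>\<pi> | \<pi> permutes {0..<Suc n}. of_int (sign \<pi>) * (\<Prod>i<Suc n. (deriv ^^ i) (f (\<pi> i)) z))"
  proof (intro nevanlinna_sum nevanlinna_mult nevanlinna_const nevanlinna_prod)
    fix \<pi> i assume "\<pi> \<in> {\<pi>. \<pi> permutes {0..<Suc n}}" "i \<in> {..<Suc n}"
    then have "\<pi> i \<in> {0..<Suc n}" "i \<in> {0..<Suc n}" by (simp_all only: permutes_in_image mem_Collect_eq) auto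
    then have "\<pi> i \<le> n" "i \<le> n" by auto
    then show "nevanlinna ((deriv ^^ i) (f (\<pi> i)))"
      using f(1) m by (intro hardy_nevanlinna[OF hardy_derivs[of _ p m] p] p) auto
  qed (auto simp: finite_permutations)
  then have "nevanlinna (wronskian (Suc n) f)" unfolding wronskian_leibniz[abs_def] .
  then show ?thesis unfolding f(2) by (rule blaschke_zeros[OF f(3,4)])
qed

lemma bc_deep_zero_sets:
  assumes p: "0 < p" and m: "real n + 1 / p \<le> real m" and E: "E \<in> deep_zero_sets n (hardy_deriv p m)"
  shows "bc_set E"
proof -
  have nm: "n \<le> m" using m p by (metis add_increasing2 divide_nonneg_nonneg less_imp_le of_nat_le_iff order_trans order_refl zero_le_one)
  obtain f where f: "\<forall>j\<le>n. f j \<in> hardy_deriv p m" "E = {z \<in> ball 0 1. wronskian (Suc n) f z = 0}"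
    "wronskian (Suc n) f holomorphic_on ball 0 1" "\<exists>z\<in>ball 0 1. wronskian (Suc n) f z \<noteq> 0"
    by (rule deep_zero_setsE[OF E]) (simp add: hardy_deriv_def)
  have "circle_hoelder (\<lambda>z. \<Sum>\<pi> | \<pi> permutes {0..<Suc n}. of_int (sign \<pi>) * (\<Prod>i<Suc n. (deriv ^^ i) (f (\<pi> i)) z))"
  proof (intro circle_hoelder_sum circle_hoelder_mult circle_hoelder_const circle_hoelder_prod)
    fix \<pi> i assume "\<pi> \<in> {\<pi>. \<pi> permutes {0..<Suc n}}" "i \<in> {..<Suc n}"
    then have "\<pi> i \<in> {0..<Suc n}" "i \<in> {0..<Suc n}" by (simp_all only: permutes_in_image mem_Collect_eq) auto
    then have i: "\<pi> i \<le> n" "i \<le> n" by auto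
    then have fi: "f (\<pi> i) holomorphic_on ball 0 1" "(deriv ^^ m) (f (\<pi> i)) \<in> hardy p"
      using f(1) by (auto simp: hardy_deriv_def)
    have "i \<le> m" using i nm by simp
    then have "(deriv ^^ (m - i)) ((deriv ^^ i) (f (\<pi> i))) = (deriv ^^ m) (f (\<pi> i))"
      by (metis comp_apply funpow_add le_add_diff_inverse2)
    then have hp: "(deriv ^^ (m - i)) ((deriv ^^ i) (f (\<pi> i))) \<in> hardy p" using fi by simp
    have "1 / p \<le> real (m - i)" using m i \<open>i \<le> m\<close> by (simp add: of_nat_diff)
    then have "1 \<le> real (m - i) * p" by (simp only: pos_divide_le_eq[OF p])
    then show "circle_hoelder ((deriv ^^ i) (f (\<pi> i)))"
      using hardy_circle_hoelder[OF holomorphic_higher_deriv[OF fi(1) open_ball] hp p] by blast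
  qed (auto simp: finite_permutations)
  then have "circle_hoelder (wronskian (Suc n) f)" unfolding wronskian_leibniz[abs_def] .
  moreover have "blaschke E" by (rule blaschke_deep_zero_sets[OF p nm E])
  ultimately show ?thesis unfolding f(2) by (intro bc_set_zeros f(3,4))
qed

theorem theorem5p2:
  fixes m n :: nat and p :: real
  assumes "0 < p"
  shows "((\<forall>E \<in> deep_zero_sets n (hardy_deriv p m). blaschke E) \<longleftrightarrow> m \<ge> n) \<and>
         ((\<forall>E \<in> deep_zero_sets n (hardy_deriv p m). bc_set E) \<longleftrightarrow> real m \<ge> real n + 1 / p)"
proof -
  have i: "(\<forall>E \<in> deep_zero_sets n (hardy_deriv p m). blaschke E) \<longleftrightarrow> m \<ge> n"
    using blaschke_deep_zero_sets[OF assms] exists_non_blaschke_set[OF assms, of m n] by (meson not_le)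
  have bl: "blaschke E" if "bc_set E" "E \<in> deep_zero_sets n (hardy_deriv p m)" for E
  proof (cases "E = {}")
    case True
    then show ?thesis by (simp add: blaschke_def)
  next
    case False
    have "E \<subseteq> ball 0 1" using that(2) by (auto simp: deep_zero_sets_def deep_zero_set_def)
    then have "E \<inter> ball 0 1 = E" by blast
    then show ?thesis using that(1) False by (simp add: bc_set_def)
  qed
  have "(\<forall>E \<in> deep_zero_sets n (hardy_deriv p m). bc_set E) \<longleftrightarrow> real m \<ge> real n + 1 / p"
  proof
    assume bc: "\<forall>E \<in> deep_zero_sets n (hardy_deriv p m). bc_set E"
    then have "n \<le> m" using i bl by blast
    then show "real m \<ge> real n + 1 / p" using bc exists_non_bc_set[OF assms, of n m] by (meson not_le)
  qed (use bc_deep_zero_sets[OF assms] in blast)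
  then show ?thesis using i by blast
qed

end
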